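(* Assume that for each $k=1,2$ the hypotheses of Lemma 3 hold with $\alpha_n$ replaced by $\alpha_{k,n}$ (and the corresponding auxiliary quantities $\gamma_{\alpha_{k,n},i,n}$, $e_{\alpha_{k,n},i,n}$). Then $\Gamma_n=E(\boldsymbol T_n\boldsymbol T_n^\top)$ is positive semi-definite with bounded eigenvalues for all large $n$. If in addition the eigenvalues of $\Gamma_n$ are bounded away from zero for all large $n$, then $\Gamma_n^{-1/2}\boldsymbol T_n\to_d N(0,\mathrm I_{2p\times2p})$.
   Context: Two-level setting: $(\boldsymbol x_{i,n},y_{i,n})$, $i=1,\dots,n$, with nonrandom $\boldsymbol x_{i,n}\in\mathbb R^p$. For $k=1,2$ and levels $1-\alpha_{k,n}$, $\alpha_{k,n}\in(0,1)$, $y_{i,n}=\boldsymbol x_{i,n}^\top\boldsymbol\beta_{1-\alpha_{k,n},n}+\gamma_{\alpha_{k,n},i,n}e_{\alpha_{k,n},i,n}$, with nonrandom $0<\gamma_{\alpha_{k,n},i,n}<\infty$, $n^{-1}\sum_i\gamma_{\alpha_{k,n},i,n}=1$, $e_{\alpha_{k,n},i,n}=G_{n,k}(\mathcal F_i)$ for measurable $G_{n,k}$, $\mathcal F_i=(\dots,\epsilon_{i-1},\epsilon_i)$ with common i.i.d. innovations $(\epsilon_j)$, and $\Pr(e_{\alpha_{k,n},i,n}\le0)=1-\alpha_{k,n}$. Lemma 3 hypotheses for a generic level $\alpha_n$ with model $y_{i,n}=\boldsymbol x_{i,n}^\top\boldsymbol\beta_{1-\alpha_n,n}+\gamma_{i,n}e_{i,n}$,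 $e_{i,n}=G_n(\mathcal F_i)$, $F_n(u)=\Pr(e_{i,n}\le u)$, density $f_n$: $\Sigma_n=n^{-1}\sum_i\boldsymbol x_{i,n}\boldsymbol x_{i,n}^\top$ nonsingular for large $n$, $\boldsymbol z_{i,n}=\Sigma_n^{-1/2}\boldsymbol x_{i,n}$, $\tilde\Sigma_n=n^{-1}\sum_i\gamma_{i,n}^{-1}\boldsymbol z_{i,n}\boldsymbol z_{i,n}^\top$, $\tau_n=(n\alpha_n)^{1/2}f_n(0)/\{1-F_n(0)\}$; (A1) $(e_{i,n})\in\mathrm{TAS}_q$ for some $q\ge2$, where, with $\epsilon_0^\star$ an independent copy of $\epsilon_0$, $\mathcal F_k^\star=(\mathcal F_{-1},\epsilon_0^\star,\epsilon_1,\dots,\epsilon_k)$, $e^\star_{k,n}=G_n(\mathcal F_k^\star)$, $\theta_{n,\alpha}(k)=\sup_{a\in(0,\alpha],N\ge n}\Pr\{e^\star_{k,N}\le F_N^{-1}(1-a)\mid e_{k,N}>F_N^{-1}(1-a)\}$, $\mathrm{TAS}_q$ means $\lim_{\alpha\downarrow0}\lim_n\sum_{k\ge0}\{\theta_{n,\alpha}(k)\}^{1/q}<\infty$; (A2) there is $\alpha\in(0,1)$ with $F_n$ continuously differentiable with uniformly bounded strictly positive derivative on $\{F_n^{-1}(1-\alpha),F_n^{-1}(1)\}$ and $\liminf_n|F_n^{-1}(1)-F_n^{-1}(1-\alpha)|>0$; (A3) $\max_i|\boldsymbol z_{i,n}|=o\{(n\alpha_n)^{1/2}\}$; (A4) $c_{\gamma,1}\le\min_i\gamma_{i,n}\le\max_i\gamma_{i,n}\le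 c_{\gamma,2}$ for constants $0<c_{\gamma,1}\le c_{\gamma,2}<\infty$; $\alpha_n\to0$, $n\alpha_n\to\infty$, $\tau_n\to\infty$, $\max_i|\boldsymbol z_{i,n}|=o(\tau_n)$; for every $c<\infty$, $\max_i\sup_{|\boldsymbol\varphi|\le c}|f_n(\gamma_{i,n}^{-1}\tau_n^{-1}\boldsymbol z_{i,n}^\top\boldsymbol\varphi)-f_n(0)|/f_n(0)\to0$; eigenvalues of $\tilde\Sigma_n$ bounded away from zero. Linear form: $\psi_{1-\alpha}(u)=(1-\alpha)-\mathbb 1\{u\le0\}$; $\zeta_{i,n,k}=\{\alpha_{k,n}(1-\alpha_{k,n})\}^{-1/2}\psi_{1-\alpha_{k,n}}(\gamma_{\alpha_{k,n},i,n}e_{\alpha_{k,n},i,n})$, $\boldsymbol\zeta_{i,n}=(\zeta_{i,n,1},\zeta_{i,n,2})^\top$, $\boldsymbol T_n=n^{-1/2}\sum_{i=1}^n\boldsymbol\zeta_{i,n}\otimes\boldsymbol z_{i,n}\in\mathbb R^{2p}$ with $\otimes$ the Kronecker product. *)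

theory Defs
  imports "HOL-Probability.Probability" "HOL-Library.Landau_Symbols"
begin

definition outer :: "real^'n \<Rightarrow> real^'m \<Rightarrow> real^'m^'n" where
  "outer u v = (\<chi> a b. u $ a * v $ b)"

definition psd_mat :: "real^'n^'n \<Rightarrow> bool" where
  "psd_mat A \<longleftrightarrow> transpose A = A \<and> (\<forall>v. 0 \<le> v \<bullet> (A *v v))"

definition psd_sqrt :: "real^'n^'n \<Rightarrow> real^'n^'n" where
  "psd_sqrt A = (THE B. psd_mat B \<and> B ** B = A)"

definition eigvals :: "real^'n^'n \<Rightarrow> real set" where
  "eigvals A = {c. \<exists>v. v \<noteq> 0 \<and> A *v v = c *\<^sub>R v}"

definition Sigma_n :: "(nat \<Rightarrow> nat \<Rightarrow> real^'p) \<Rightarrow> nat \<Rightarrow> real^'p^'p" where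
  "Sigma_n x n = (1 / real n) *\<^sub>R (\<Sum>i\<in>{1..n}. outer (x n i) (x n i))"

definition zvec :: "(nat \<Rightarrow> nat \<Rightarrow> real^'p) \<Rightarrow> nat \<Rightarrow> nat \<Rightarrow> real^'p" where
  "zvec x n i = psd_sqrt (matrix_inv (Sigma_n x n)) *v x n i"

definition tSigma_n :: "(nat \<Rightarrow> nat \<Rightarrow> real) \<Rightarrow> (nat \<Rightarrow> nat \<Rightarrow> real^'p) \<Rightarrow> nat \<Rightarrow> real^'p^'p" where
  "tSigma_n gam x n = (1 / real n) *\<^sub>R
     (\<Sum>i\<in>{1..n}. (1 / gam n i) *\<^sub>R outer (zvec x n i) (zvec x n i))"

text \<open>F_i = (..., eps_{i-1}, eps_i), coded as j \<mapsto> eps_{i-j}\<close>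
definition Fi :: "(int \<Rightarrow> 'w \<Rightarrow> 'e) \<Rightarrow> int \<Rightarrow> 'w \<Rightarrow> nat \<Rightarrow> 'e" where
  "Fi eps i \<omega> = (\<lambda>j. eps (i - int j) \<omega>)"

text \<open>F_k^* = (F_{-1}, eps_0^*, eps_1, ..., eps_k)\<close>
definition Fi_star :: "(int \<Rightarrow> 'w \<Rightarrow> 'e) \<Rightarrow> ('w \<Rightarrow> 'e) \<Rightarrow> nat \<Rightarrow> 'w \<Rightarrow> nat \<Rightarrow> 'e" where
  "Fi_star eps eps0s k \<omega> = (\<lambda>j. if j = k then eps0s \<omega> else eps (int k - int j) \<omega>)"

text \<open>distribution function F_n(u) = Pr(e_{i,n} \<le> u) (stationary, computed at i = 0)\<close>
definition cdfF :: "'w measure \<Rightarrow> (int \<Rightarrow> 'w \<Rightarrow> 'e) \<Rightarrow> ((nat \<Rightarrow> 'e) \<Rightarrow> real) \<Rightarrow> real \<Rightarrow> real" where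
  "cdfF M eps g u = measure M {\<omega>\<in>space M. g (Fi eps 0 \<omega>) \<le> u}"

text \<open>generalised inverse F^{-1}(a) = inf{u : F(u) \<ge> a}, in the extended reals
  (so that F^{-1}(1) may be +\<infinity>)\<close>
definition qinv :: "(real \<Rightarrow> real) \<Rightarrow> real \<Rightarrow> ereal" where
  "qinv F a = Inf {ereal u | u. a \<le> F u}"

definition theta :: "'w measure \<Rightarrow> (int \<Rightarrow> 'w \<Rightarrow> 'e) \<Rightarrow> ('w \<Rightarrow> 'e)
    \<Rightarrow> (nat \<Rightarrow> (nat \<Rightarrow> 'e) \<Rightarrow> real) \<Rightarrow> nat \<Rightarrow> real \<Rightarrow> nat \<Rightarrow> real" where
  "theta M eps eps0s G n alpha k =
     Sup ((\<lambda>(a, N).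
        let Q = qinv (cdfF M eps (G N)) (1 - a) in
        measure M {\<omega>\<in>space M. ereal (G N (Fi_star eps eps0s k \<omega>)) \<le> Q
                               \<and> ereal (G N (Fi eps (int k) \<omega>)) > Q}
        / measure M {\<omega>\<in>space M. ereal (G N (Fi eps (int k) \<omega>)) > Q})
      ` ({0<..alpha} \<times> {n..}))"

definition TAS :: "'w measure \<Rightarrow> (int \<Rightarrow> 'w \<Rightarrow> 'e) \<Rightarrow> ('w \<Rightarrow> 'e)
    \<Rightarrow> (nat \<Rightarrow> (nat \<Rightarrow> 'e) \<Rightarrow> real) \<Rightarrow> real \<Rightarrow> bool" where
  "TAS M eps eps0s G q \<longleftrightarrow>
     Lim (at_right 0) (\<lambda>alpha. lim (\<lambda>n.
        \<Sum>k. ennreal (theta M eps eps0s G n alpha k powr (1 / q)))) < \<infinity>"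

definition psi :: "real \<Rightarrow> real \<Rightarrow> real" where
  "psi a u = a - (if u \<le> 0 then 1 else 0)"

definition Tvec :: "(nat \<Rightarrow> nat \<Rightarrow> real^'p) \<Rightarrow> (2 \<Rightarrow> nat \<Rightarrow> real)
    \<Rightarrow> (2 \<Rightarrow> nat \<Rightarrow> nat \<Rightarrow> real) \<Rightarrow> (2 \<Rightarrow> nat \<Rightarrow> (nat \<Rightarrow> 'e) \<Rightarrow> real)
    \<Rightarrow> (int \<Rightarrow> 'w \<Rightarrow> 'e) \<Rightarrow> nat \<Rightarrow> 'w \<Rightarrow> real^(2 \<times> 'p)" where
  "Tvec x alpha gam G eps n \<omega> = (\<chi> lj. let l = fst lj; j = snd lj in (1 / sqrt (real n)) *
     (\<Sum>i\<in>{1..n}. (alpha l n * (1 - alpha l n)) powr (-1/2)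
        * psi (1 - alpha l n) (gam l n i * G l n (Fi eps (int i) \<omega>)) * zvec x n i $ j))"

definition Gamma_n :: "'w measure \<Rightarrow> ('w \<Rightarrow> real^'m) \<Rightarrow> real^'m^'m" where
  "Gamma_n M T = (\<chi> a b. integral\<^sup>L M (\<lambda>\<omega>. T \<omega> $ a * T \<omega> $ b))"

definition std_normal_vec :: "(real^'m) measure" where
  "std_normal_vec = density lborel
     (\<lambda>x. ennreal ((2 * pi) powr (- real CARD('m) / 2) * exp (- (norm x)\<^sup>2 / 2)))"

definition conv_distr :: "'w measure \<Rightarrow> (nat \<Rightarrow> 'w \<Rightarrow> real^'m) \<Rightarrow> (real^'m) measure \<Rightarrow> bool" where
  "conv_distr M X mu \<longleftrightarrow>
     (\<forall>f :: real^'m \<Rightarrow> real. continuous_on UNIV f \<and> bounded (range f) \<longrightarrow>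
        (\<lambda>n. integral\<^sup>L M (\<lambda>\<omega>. f (X n \<omega>))) \<longlonglongrightarrow> integral\<^sup>L mu f)"

end

theory Submission
  imports Defs
begin

text \<open>For a fixed \<open>n\<close> every \<open>\<F>\<^sub>i\<close>, \<open>i \<le> n\<close>, is a shift of the single i.i.d. sequence \<open>\<F>\<^sub>n\<close>,
  so \<open>u \<bullet> T\<^sub>n\<close> is a weighted sum of shifts of bounded functions on a sequence space. Averaging
  out all innovations older than lag \<open>k\<close> splits each summand into increments. At a fixed lag, the
  increments attached to different times are orthogonal, and their quadratic norm is controlled by the
  exceedance probability of the coupled process, hence by
  \<open>\<alpha>\<^sub>n \<theta>(k) \<le> \<alpha>\<^sub>n \<theta>(k)\<^bsup>2/q\<^esup>\<close>. Summability of \<open>\<theta>(k)\<^bsup>1/q\<^esup>\<close> bounds \<open>\<Gamma>\<^sub>n\<close>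
  and makes truncation at a large lag \<open>m\<close> uniformly harmless. The truncated sum is \<open>m\<close>-dependent:
  deleting gaps of length \<open>m\<close> between long blocks leaves independent block sums, which are uniformly
  small because \<open>max |z\<^sub>i\<^sub>,\<^sub>n| = o((n \<alpha>\<^sub>n)\<^bsup>1/2\<^esup>)\<close>, so that their characteristic function is
  nearly Gaussian. Gaussian smoothing passes from characteristic functions to weak convergence.\<close>

section \<open>Square roots of positive semidefinite matrices\<close>

text \<open>The matrices \<open>Gamma_n\<close> need not converge. The limit theorem is therefore
  proved without a limiting variance: the characteristic function of a linear form, minus
  \<open>exp (- s / 2)\<close> with \<open>s\<close> the second moment of that same form, tends to
  zero along directions that may change with \<open>n\<close>. In the direction
  \<open>R n *v w\<close> the second moment is exactly the squared norm of \<open>w\<close>. The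
  frequency is absorbed in the direction. The second obstacle is that the exceedance probability
  \<open>alpha l n\<close> vanishes while the summands carry its inverse square root. Every norm
  bound must then supply a factor \<open>sqrt (alpha l n)\<close>. The coupling gives it: an
  increment at lag \<open>k\<close> has squared norm at most twice the probability that the process
  exceeds and its copy does not, that is, at most twice \<open>alpha l n\<close> times theta.
  Pythagoras is used over times, the triangle inequality over lags, so it is the square roots of
  theta that have to be summed. As theta is at most \<open>1\<close> and \<open>2 \<le> q\<close>,
  they are at most the powers \<open>1 / q\<close>.\<close>

lemma symmetric_dot:
  fixes A :: "real^'n^'n" assumes "transpose A = A"
  shows "(A *v v) \<bullet> w = v \<bullet> (A *v w)"
  by (metis assms dot_lmul_matrix vector_transpose_matrix)

lemma psd_matD: assumes "psd_mat A"
  shows "transpose A = A" "0 \<le> v \<bullet> (A *v v)" "(A *v v) \<bullet> w = v \<bullet> (A *v w)"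
  using assms unfolding psd_mat_def by (auto intro: symmetric_dot)

text \<open>The form attains its minimum on the unit sphere of \<open>S\<close> by compactness. The
  first variation at the minimiser in the direction of the residual \<open>r\<close> is proportional
  to the squared norm of \<open>r\<close>, and it must vanish. Invariance of \<open>S\<close> is
  what keeps \<open>r\<close> an admissible direction.\<close>

lemma Rayleigh_min:
  fixes A :: "real^'n^'n"
  assumes sym: "transpose A = A" and S: "subspace S" "S \<noteq> {0}" and inv: "\<And>v. v \<in> S \<Longrightarrow> A *v v \<in> S"
  obtains w c where "w \<in> S" "norm w = 1" "A *v w = c *\<^sub>R w" "\<And>v. v \<in> S \<Longrightarrow> c * (v \<bullet> v) \<le> v \<bullet> (A *v v)"
proof -
  let ?K = "sphere 0 1 \<inter> S"
  have "closed S" using S(1) by (rule closed_subspace)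
  then have "compact ?K" by (intro compact_Int_closed) auto
  moreover obtain u where u: "u \<in> S" "u \<noteq> 0" using S subspace_0 by blast
  then have "(1 / norm u) *\<^sub>R u \<in> ?K" using S(1) by (auto intro: subspace_scale)
  then have "?K \<noteq> {}" by blast
  moreover have "continuous_on ?K (\<lambda>v. v \<bullet> (A *v v))"
    by (intro continuous_intros matrix_vector_mult_linear_continuous_on)
  ultimately obtain w where w: "w \<in> ?K" and min: "\<And>v. v \<in> ?K \<Longrightarrow> w \<bullet> (A *v w) \<le> v \<bullet> (A *v v)"
    using continuous_attains_inf[of ?K "\<lambda>v. v \<bullet> (A *v v)"] by blast
  define c where "c = w \<bullet> (A *v w)"
  have wS: "w \<in> S" "norm w = 1" using w by auto
  have q: "c * (v \<bullet> v) \<le> v \<bullet> (A *v v)" if "v \<in> S" for v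
  proof (cases "v = 0")
    case False
    then have "(1 / norm v) *\<^sub>R v \<in> ?K" using S(1) that by (auto intro: subspace_scale)
    from min[OF this] False show ?thesis
      by (simp add: c_def[symmetric] matrix_vector_mult_scaleR field_simps dot_square_norm power2_eq_square)
  qed simp
  have "A *v w = c *\<^sub>R w"
  proof -
    define r where "r = A *v w - c *\<^sub>R w"
    define Q where "Q = r \<bullet> (A *v r) - c * (r \<bullet> r)"
    have Aw: "A *v w = r + c *\<^sub>R w" by (simp add: r_def)
    have rS: "r \<in> S" unfolding r_def using wS inv S(1) by (intro subspace_diff subspace_scale) auto
    have ww: "w \<bullet> w = 1" using wS(2) by (simp add: dot_square_norm)
    have wAr: "w \<bullet> (A *v r) = r \<bullet> r + c * (w \<bullet> r)"
      using symmetric_dot[OF sym, of w r] by (simp add: Aw inner_add_left)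
    have wr: "w \<bullet> r = 0" using ww by (simp add: r_def inner_diff_right c_def)
    have pos: "0 \<le> 2 * t * (r \<bullet> r) + t\<^sup>2 * Q" for t
    proof -
      have "(w + t *\<^sub>R r) \<bullet> (A *v (w + t *\<^sub>R r)) - c * ((w + t *\<^sub>R r) \<bullet> (w + t *\<^sub>R r)) = 2 * t * (r \<bullet> r) + t\<^sup>2 * Q"
        unfolding matrix_vector_right_distrib matrix_vector_mult_scaleR Q_def
        by (simp add: Aw wAr ww wr inner_add_left inner_add_right inner_commute[of r w] algebra_simps power2_eq_square)
      moreover have "w + t *\<^sub>R r \<in> S" using rS wS(1) S(1) by (auto simp: subspace_add subspace_scale)
      ultimately show ?thesis using q[of "w + t *\<^sub>R r"] by simp
    qed
    have "r \<bullet> r = 0"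
    proof (rule ccontr)
      assume "r \<bullet> r \<noteq> 0"
      then have R: "0 < r \<bullet> r" by (simp add: inner_gt_zero_iff)
      have Qn: "0 \<le> Q" using q[OF rS] by (simp add: Q_def)
      \<comment> \<open>A negative \<open>t\<close> of this size lets the linear term win: the
        polynomial becomes \<open>t * (r \<bullet> r) - t\<^sup>2\<close>, which is negative. The
        summand \<open>1\<close> covers \<open>Q = 0\<close>.\<close>
      define t where "t = - (r \<bullet> r) / (1 + Q)"
      have "t * (1 + Q) = - (r \<bullet> r)" unfolding t_def using Qn by simp
      then have tQ: "t * Q = - (r \<bullet> r) - t" by (simp add: algebra_simps)
      have "2 * t * (r \<bullet> r) + t\<^sup>2 * Q = 2 * t * (r \<bullet> r) + t * (t * Q)" by (simp add: power2_eq_square)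
      also have "\<dots> = t * (r \<bullet> r) - t\<^sup>2" unfolding tQ by (simp add: power2_eq_square algebra_simps)
      finally have eq: "2 * t * (r \<bullet> r) + t\<^sup>2 * Q = t * (r \<bullet> r) - t\<^sup>2" .
      have "t < 0" unfolding t_def using R Qn by (simp add: field_simps)
      then have "t * (r \<bullet> r) - t\<^sup>2 < 0" using R by (smt (verit) mult_neg_pos zero_le_power2)
      then show False using pos[of t] eq by simp
    qed
    then have "r = 0" by simp
    then show ?thesis by (simp add: r_def)
  qed
  with wS q show ?thesis by (intro that)
qed

text \<open>Invariant subspaces are treated, rather than the whole space, to permit induction on the
  dimension: after one eigenvector is split off, symmetry makes its orthogonal complement inside
  \<open>S\<close> invariant again.\<close>

lemma symmetric_eigenbasis:
  fixes A :: "real^'n^'n"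
  assumes sym: "transpose A = A"
  shows "subspace S \<Longrightarrow> (\<And>v. v \<in> S \<Longrightarrow> A *v v \<in> S) \<Longrightarrow>
    \<exists>B. finite B \<and> B \<subseteq> S \<and> pairwise orthogonal B \<and> (\<forall>b\<in>B. norm b = 1 \<and> (\<exists>c. A *v b = c *\<^sub>R b)) \<and> S \<subseteq> span B"
proof (induction "dim S" arbitrary: S rule: less_induct)
  case less
  show ?case
  proof (cases "S = {0}")
    case True
    then show ?thesis by (intro exI[of _ "{}"]) auto
  next
    case False
    obtain w c where w: "w \<in> S" "norm w = 1" "A *v w = c *\<^sub>R w"
      by (rule Rayleigh_min[OF sym less.prems(1) False less.prems(2)])
    let ?T = "S \<inter> {v. w \<bullet> v = 0}"
    have T: "subspace ?T" using less.prems(1) by (intro subspace_inter subspace_hyperplane)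
    have ww: "w \<bullet> w = 1" using w(2) by (simp add: dot_square_norm)
    have "w \<notin> ?T" using ww by auto
    then have "?T \<subset> S" using w(1) by blast
    then have "dim ?T < dim S"
      using T less.prems(1) by (intro dim_psubset) (simp add: span_eq_iff[THEN iffD2])
    moreover have "A *v v \<in> ?T" if "v \<in> ?T" for v
      using that less.prems(2) symmetric_dot[OF sym, of w v] w(3) by auto
    ultimately obtain B where B: "finite B" "B \<subseteq> ?T" "pairwise orthogonal B"
      "\<forall>b\<in>B. norm b = 1 \<and> (\<exists>c. A *v b = c *\<^sub>R b)" "?T \<subseteq> span B"
      using less.hyps[OF _ T] by blast
    have "S \<subseteq> span (insert w B)"
    proof
      fix v assume v: "v \<in> S"
      have "v - (w \<bullet> v) *\<^sub>R w \<in> ?T"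
        using v w(1) ww less.prems(1) by (auto simp: subspace_diff subspace_scale inner_diff_right)
      with B(5) have "v - (w \<bullet> v) *\<^sub>R w \<in> span B" by blast
      then show "v \<in> span (insert w B)" by (auto simp: span_insert)
    qed
    moreover have "pairwise orthogonal (insert w B)"
      using B(2,3) by (auto simp: pairwise_insert orthogonal_def inner_commute)
    ultimately show ?thesis
      using B w by (intro exI[of _ "insert w B"]) auto
  qed
qed

lemma symmetric_orthonormal_eigenbasis:
  fixes A :: "real^'n^'n"
  assumes sym: "transpose A = A"
  obtains B c where "finite B" "\<And>b b'. b \<in> B \<Longrightarrow> b' \<in> B \<Longrightarrow> b \<bullet> b' = (if b = b' then 1 else 0)"
    "\<And>b. b \<in> B \<Longrightarrow> A *v b = c b *\<^sub>R b" "span B = UNIV"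
proof -
  obtain B where B: "finite B" "pairwise orthogonal B"
      "\<forall>b\<in>B. norm b = 1 \<and> (\<exists>c. A *v b = c *\<^sub>R b)" "UNIV \<subseteq> span B"
    using symmetric_eigenbasis[OF sym, of UNIV] by auto
  then obtain c where "\<And>b. b \<in> B \<Longrightarrow> A *v b = c b *\<^sub>R b" by metis
  moreover have "b \<bullet> b' = (if b = b' then 1 else 0)" if "b \<in> B" "b' \<in> B" for b b'
    using B that by (auto simp: pairwise_def orthogonal_def dot_square_norm)
  ultimately show ?thesis using B by (intro that[of B c]) auto
qed

lemma outer_mult: "outer u w *v v = (w \<bullet> v) *\<^sub>R u"
  by (simp add: outer_def vec_eq_iff matrix_vector_mult_def inner_vec_def sum_distrib_right mult_ac sum_distrib_left)

lemma matrix_eq_on_span: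
  fixes A C :: "real^'n^'m"
  assumes "span B = UNIV" "\<And>b. b \<in> B \<Longrightarrow> A *v b = C *v b"
  shows "A = C"
proof -
  have "A *v v = C *v v" for v
    by (rule linear_eq_on_span[of "(*v) A" "(*v) C" B]) (use assms in auto)
  then show ?thesis by (simp add: matrix_eq)
qed

text \<open>On an eigenvector \<open>b\<close> of \<open>C\<close> the residual \<open>?r\<close> is
  mapped by \<open>B\<close> to \<open>- c b\<close> times itself, which a positive semidefinite
  \<open>B\<close> allows for \<open>c b > 0\<close> only if \<open>?r\<close> vanishes. For
  \<open>c b = 0\<close> the norm of \<open>B *v b\<close> is zero directly. Uniqueness is what
  gives the definite description in \<open>psd_sqrt\<close> a meaning.\<close>

lemma psd_sqrt_unique:
  fixes B C :: "real^'n^'n"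
  assumes B: "psd_mat B" and C: "psd_mat C" and eq: "B ** B = C ** C"
  shows "B = C"
proof -
  obtain E c where E: "\<And>b. b \<in> E \<Longrightarrow> C *v b = c b *\<^sub>R b" "span E = UNIV"
    "\<And>b b'. b \<in> E \<Longrightarrow> b' \<in> E \<Longrightarrow> b \<bullet> b' = (if b = b' then 1 else 0)"
    by (rule symmetric_orthonormal_eigenbasis[OF psd_matD(1)[OF C]]) blast
  show ?thesis
  proof (rule matrix_eq_on_span[OF E(2)])
    fix b assume b: "b \<in> E"
    have bb: "b \<bullet> b = 1" using E(3)[OF b b] by simp
    have c: "0 \<le> c b" using psd_matD(2)[OF C, of b] E(1)[OF b] bb by simp
    have BB: "B *v (B *v b) = (c b * c b) *\<^sub>R b"
      using eq E(1)[OF b] by (simp add: matrix_vector_mul_assoc) (simp add: matrix_vector_mul_assoc[symmetric] matrix_vector_mult_scaleR)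
    let ?r = "B *v b - c b *\<^sub>R b"
    have r: "B *v ?r = - (c b *\<^sub>R ?r)"
      using BB by (simp add: matrix_vector_mult_diff_distrib matrix_vector_mult_scaleR algebra_simps)
    have "?r = 0"
    proof (cases "c b = 0")
      case True
      then have "(B *v b) \<bullet> (B *v b) = 0" using psd_matD(3)[OF B, of b "B *v b"] BB by simp
      then show ?thesis using True by simp
    next
      case False
      have "0 \<le> ?r \<bullet> (B *v ?r)" by (rule psd_matD(2)[OF B])
      then have "c b * (?r \<bullet> ?r) \<le> 0" unfolding r by simp
      with False c have "?r \<bullet> ?r \<le> 0" by (simp add: mult_le_0_iff)
      then show ?thesis by (metis inner_ge_zero inner_eq_zero_iff order_antisym)
    qed
    then show "B *v b = C *v b" using E(1)[OF b] by simp
  qed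
qed

lemma psd_sqrt_exists:
  fixes A :: "real^'n^'n"
  assumes A: "psd_mat A" shows "\<exists>B. psd_mat B \<and> B ** B = A"
proof -
  obtain E c where E: "finite E" "\<And>b b'. b \<in> E \<Longrightarrow> b' \<in> E \<Longrightarrow> b \<bullet> b' = (if b = b' then 1 else 0)"
    "\<And>b. b \<in> E \<Longrightarrow> A *v b = c b *\<^sub>R b" "span E = UNIV"
    by (rule symmetric_orthonormal_eigenbasis[OF psd_matD(1)[OF A]]) blast
  have c: "0 \<le> c b" if "b \<in> E" for b
    using psd_matD(2)[OF A, of b] E(3)[OF that] E(2)[OF that that] by simp
  define B where "B = (\<Sum>b\<in>E. sqrt (c b) *\<^sub>R outer b b)"
  have Bv: "B *v v = (\<Sum>b\<in>E. (sqrt (c b) * (b \<bullet> v)) *\<^sub>R b)" for v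
    unfolding B_def
    by (induction E rule: infinite_finite_induct)
      (simp_all add: matrix_vector_mult_add_rdistrib scaleR_matrix_vector_assoc[symmetric] outer_mult)
  have Bb: "B *v b = sqrt (c b) *\<^sub>R b" if "b \<in> E" for b
  proof -
    have "B *v b = (\<Sum>b'\<in>E. if b' = b then sqrt (c b) *\<^sub>R b else 0)"
      unfolding Bv by (rule sum.cong) (use E(2)[OF _ that] in auto)
    then show ?thesis using E(1) that by simp
  qed
  have "transpose B = B"
    unfolding B_def by (simp add: vec_eq_iff transpose_def outer_def sum_component mult_ac)
  moreover have "0 \<le> v \<bullet> (B *v v)" for v
  proof -
    have "v \<bullet> (B *v v) = (\<Sum>b\<in>E. sqrt (c b) * (b \<bullet> v)\<^sup>2)"
      unfolding Bv by (simp add: inner_sum_right inner_commute power2_eq_square mult.assoc)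
    also have "0 \<le> \<dots>" by (intro sum_nonneg mult_nonneg_nonneg) (auto intro: c)
    finally show ?thesis .
  qed
  moreover have "B ** B = A"
    by (rule matrix_eq_on_span[OF E(4)])
      (simp add: matrix_vector_mul_assoc[symmetric] Bb matrix_vector_mult_scaleR E(3) c)
  ultimately show ?thesis unfolding psd_mat_def by blast
qed

lemma psd_sqrt:
  assumes "psd_mat (A :: real^'n^'n)"
  shows "psd_mat (psd_sqrt A)" "psd_sqrt A ** psd_sqrt A = A"
proof -
  have "\<exists>!B. psd_mat B \<and> B ** B = A"
    using psd_sqrt_exists[OF assms] psd_sqrt_unique by blast
  from theI'[OF this] show "psd_mat (psd_sqrt A)" "psd_sqrt A ** psd_sqrt A = A"
    unfolding psd_sqrt_def by auto
qed

lemma matrix_inv_both: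
  fixes A :: "real^'n^'n"
  assumes "invertible A"
  shows "A ** matrix_inv A = mat 1" "matrix_inv A ** A = mat 1"
  using someI_ex[of "\<lambda>A'. A ** A' = mat 1 \<and> A' ** A = mat 1"] assms
  unfolding invertible_def matrix_inv_def by blast+

lemma psd_mat_inverse:
  fixes A :: "real^'n^'n"
  assumes A: "psd_mat A" "invertible A"
  shows "psd_mat (matrix_inv A)"
proof -
  note i = matrix_inv_both[OF A(2)]
  have "transpose (matrix_inv A) ** A = mat 1"
    using arg_cong[OF i(1), of transpose] psd_matD(1)[OF A(1)] by (simp add: matrix_transpose_mul transpose_mat)
  then have t: "transpose (matrix_inv A) = matrix_inv A"
    using i(1) by (metis matrix_mul_assoc matrix_mul_lid matrix_mul_rid)
  have "0 \<le> v \<bullet> (matrix_inv A *v v)" for v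
  proof -
    have "A *v (matrix_inv A *v v) = v" using i by (simp add: matrix_vector_mul_assoc)
    then show ?thesis using psd_matD(2)[OF A(1), of "matrix_inv A *v v"] by (simp add: inner_commute)
  qed
  with t show ?thesis unfolding psd_mat_def by blast
qed

text \<open>Applied to \<open>Sigma_n\<close> this normalises the design vectors; applied to
  \<open>Gamma_n\<close> it gives the standardised sum unit variance in every direction.\<close>

lemma inv_sqrt_sandwich:
  fixes A :: "real^'n^'n"
  assumes A: "psd_mat A" "invertible A"
  defines "R \<equiv> psd_sqrt (matrix_inv A)"
  shows "psd_mat R" "R ** A ** R = mat 1" "R ** R = matrix_inv A"
proof -
  note i = matrix_inv_both[OF A(2)]
  note P = psd_mat_inverse[OF A]
  show R: "psd_mat R" and RR: "R ** R = matrix_inv A"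
    using psd_sqrt[OF P] by (auto simp: R_def)
  \<comment> \<open>For square matrices the right inverse \<open>R ** A\<close> of \<open>R\<close>
    is also a left inverse, so \<open>R\<close> need not be shown to commute with
    \<open>A\<close>.\<close>
  have "R ** (R ** A) = mat 1" using i(2) RR by (simp add: matrix_mul_assoc)
  then show "R ** A ** R = mat 1" by (simp add: matrix_left_right_inverse)
qed

text \<open>The minimum of the Rayleigh quotient is attained at an eigenvector, hence is itself an
  eigenvalue.\<close>

lemma eigvals_lower_bound:
  fixes A :: "real^'n^'n"
  assumes "transpose A = A" "\<And>ev. ev \<in> eigvals A \<Longrightarrow> c \<le> ev"
  shows "c * (v \<bullet> v) \<le> v \<bullet> (A *v v)"
proof -
  have "axis undefined 1 \<noteq> (0 :: real^'n)" by (simp add: axis_eq_0_iff)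
  then have ne: "(UNIV :: (real^'n) set) \<noteq> {0}" by blast
  obtain w d where w: "w \<in> UNIV" "norm w = 1" "A *v w = d *\<^sub>R w"
      "\<And>v. v \<in> UNIV \<Longrightarrow> d * (v \<bullet> v) \<le> v \<bullet> (A *v v)"
    by (rule Rayleigh_min[OF assms(1) subspace_UNIV ne UNIV_I]) (rule that)
  then have "w \<noteq> 0" by auto
  with w have "d \<in> eigvals A" unfolding eigvals_def by blast
  then have "c * (v \<bullet> v) \<le> d * (v \<bullet> v)" by (intro mult_right_mono assms) auto
  with w(4)[OF UNIV_I, of v] show ?thesis by linarith
qed

lemma invertible_if_pos:
  fixes A :: "real^'n^'n"
  assumes "0 < c" "\<And>v. c * (v \<bullet> v) \<le> v \<bullet> (A *v v)"
  shows "invertible A"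
proof -
  have "v = 0" if "A *v v = 0" for v
    using assms(2)[of v] that assms(1) by (simp add: mult_le_0_iff) (metis inner_gt_zero_iff leD)
  then show ?thesis by (simp add: matrix_left_invertible_ker invertible_left_inverse)
qed

section \<open>Bounded measurable functions in the quadratic mean\<close>

text \<open>The bound is demanded at every point, even off the space, instead of almost everywhere.
  The class is then closed under sums, products and measurable substitutions without any null sets,
  and consists of integrable functions for every finite measure.\<close>

definition bmf :: "'a measure \<Rightarrow> ('a \<Rightarrow> 'b::{banach,second_countable_topology}) \<Rightarrow> bool" where
  "bmf N f \<longleftrightarrow> f \<in> borel_measurable N \<and> (\<exists>B. \<forall>x. norm (f x) \<le> B)"

lemma bmfI: "f \<in> borel_measurable N \<Longrightarrow> (\<And>x. norm (f x) \<le> B) \<Longrightarrow> bmf N f"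
  unfolding bmf_def by blast

lemma bmf_measurable: "bmf N f \<Longrightarrow> f \<in> borel_measurable N"
  by (simp add: bmf_def)

lemma bmfE: assumes "bmf N f" obtains B where "0 \<le> B" "\<And>x. norm (f x) \<le> B"
  using assms unfolding bmf_def by (meson norm_ge_zero order.trans)

lemma bmf_integrable: "finite_measure N \<Longrightarrow> bmf N f \<Longrightarrow> integrable N f"
  unfolding bmf_def by (auto intro: finite_measure.integrable_const_bound)

lemma bmf_const [simp]: "bmf N (\<lambda>x. c)"
  by (rule bmfI[of _ _ "norm c"]) auto

lemma bmf_add: assumes "bmf N f" "bmf N g" shows "bmf N (\<lambda>x. f x + g x)"
proof -
  obtain B where B: "\<And>x. norm (f x) \<le> B" by (rule bmfE[OF assms(1)]) blast
  obtain C where C: "\<And>x. norm (g x) \<le> C" by (rule bmfE[OF assms(2)]) blast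
  show ?thesis
    using assms[THEN bmf_measurable] norm_triangle_mono[OF B C] by (intro bmfI[of _ _ "B + C"]) auto
qed

lemma bmf_minus: assumes "bmf N f" shows "bmf N (\<lambda>x. - f x)"
  using assms unfolding bmf_def by auto

lemma bmf_diff: assumes "bmf N f" "bmf N g" shows "bmf N (\<lambda>x. f x - g x)"
  using bmf_add[OF assms(1) bmf_minus[OF assms(2)]] by simp

lemma bmf_mult:
  fixes f g :: "'a \<Rightarrow> 'b::{banach,second_countable_topology,real_normed_algebra}"
  assumes "bmf N f" "bmf N g" shows "bmf N (\<lambda>x. f x * g x)"
proof -
  obtain B where B: "\<And>x. norm (f x) \<le> B" "0 \<le> B" by (rule bmfE[OF assms(1)]) blast
  obtain C where C: "\<And>x. norm (g x) \<le> C" "0 \<le> C" by (rule bmfE[OF assms(2)]) blast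
  have "norm (f x * g x) \<le> B * C" for x
    by (rule order_trans[OF norm_mult_ineq mult_mono[OF B(1) C(1)]]) (use B C in auto)
  then show ?thesis
    using assms[THEN bmf_measurable] by (intro bmfI[of _ _ "B * C"]) auto
qed

lemma bmf_sum: "(\<And>i. i \<in> I \<Longrightarrow> bmf N (f i)) \<Longrightarrow> bmf N (\<lambda>x. \<Sum>i\<in>I. f i x)"
  by (induction I rule: infinite_finite_induct) (auto intro!: bmf_add)

lemma bmf_prod:
  fixes f :: "'i \<Rightarrow> 'a \<Rightarrow> 'b::{banach,second_countable_topology,real_normed_field}"
  shows "(\<And>i. i \<in> I \<Longrightarrow> bmf N (f i)) \<Longrightarrow> bmf N (\<lambda>x. \<Prod>i\<in>I. f i x)"
  by (induction I rule: infinite_finite_induct) (auto intro!: bmf_mult)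

lemma bmf_power:
  fixes f :: "'a \<Rightarrow> 'b::{banach,second_countable_topology,real_normed_field}"
  shows "bmf N f \<Longrightarrow> bmf N (\<lambda>x. f x ^ k)"
  by (induction k) (auto intro!: bmf_mult)

lemma bmf_abs: "bmf N (f :: _ \<Rightarrow> real) \<Longrightarrow> bmf N (\<lambda>x. \<bar>f x\<bar>)"
  unfolding bmf_def by auto

lemma bmf_comp: "bmf N f \<Longrightarrow> h \<in> measurable L N \<Longrightarrow> bmf L (\<lambda>x. f (h x))"
  unfolding bmf_def by (auto intro: measurable_compose)

lemma bmf_iexp: "bmf N f \<Longrightarrow> bmf N (\<lambda>x. iexp (c * f x))"
  by (rule bmfI[of _ _ 1]) (auto dest: bmf_measurable)

lemma bmf_indicator: "A \<in> sets N \<Longrightarrow> bmf N (indicator A :: _ \<Rightarrow> real)"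
  by (rule bmfI[of _ _ 1]) (auto simp: indicator_def)

lemmas bmf_intros = bmf_const bmf_add bmf_minus bmf_diff bmf_mult bmf_sum bmf_power
  bmf_abs bmf_iexp

definition l2 :: "'a measure \<Rightarrow> ('a \<Rightarrow> real) \<Rightarrow> real" where
  "l2 N f = sqrt (\<integral>x. (f x)\<^sup>2 \<partial>N)"

lemma l2_nonneg [simp]: "0 \<le> l2 N f"
  by (simp add: l2_def)

lemma l2_sq: "(l2 N f)\<^sup>2 = (\<integral>x. (f x)\<^sup>2 \<partial>N)"
  by (simp add: l2_def)

context prob_space begin

lemma integrable_bmf: "bmf M f \<Longrightarrow> integrable M f"
  by (rule bmf_integrable[OF finite_measure_axioms])

lemma l2_Cauchy_Schwarz:
  assumes "bmf M f" "bmf M g"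
  shows "\<bar>\<integral>x. f x * g x \<partial>M\<bar> \<le> l2 M f * l2 M g"
proof -
  note I [simp] = integrable_bmf
  let ?a = "\<integral>x. (f x)\<^sup>2 \<partial>M" and ?b = "\<integral>x. f x * g x \<partial>M" and ?c = "\<integral>x. (g x)\<^sup>2 \<partial>M"
  have q: "0 \<le> ?a * t\<^sup>2 + 2 * t * ?b + ?c" for t
  proof -
    have "0 \<le> (\<integral>x. (t * f x + g x)\<^sup>2 \<partial>M)" by simp
    also have "\<dots> = (\<integral>x. t\<^sup>2 * (f x)\<^sup>2 + 2 * t * (f x * g x) + (g x)\<^sup>2 \<partial>M)"
      by (intro Bochner_Integration.integral_cong) (auto simp: power2_eq_square algebra_simps)
    also have "\<dots> = ?a * t\<^sup>2 + 2 * t * ?b + ?c"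
      using assms by (simp add: bmf_intros)
    finally show ?thesis .
  qed
  have "?b\<^sup>2 \<le> ?a * ?c"
  proof (cases "?a = 0")
    case True
    have "?b = 0"
    proof (rule ccontr)
      assume "?b \<noteq> 0"
      \<comment> \<open>With \<open>?a = 0\<close> the polynomial is affine in \<open>t\<close>, and
        this argument gives it the value \<open>-1\<close>.\<close>
      with q[of "- (?c + 1) / (2 * ?b)"] True show False by (simp add: field_simps)
    qed
    then show ?thesis by simp
  next
    case False
    have "0 \<le> ?a" by simp
    with False have "0 < ?a" by linarith
    with q[of "- ?b / ?a"] show ?thesis
      by (simp add: field_simps power2_eq_square)
  qed
  then have "sqrt (?b\<^sup>2) \<le> sqrt (?a * ?c)" by (rule real_sqrt_le_mono)
  then show ?thesis by (simp add: l2_def real_sqrt_mult)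
qed

lemma l2_triangle:
  assumes "bmf M f" "bmf M g"
  shows "l2 M (\<lambda>x. f x + g x) \<le> l2 M f + l2 M g"
proof -
  note I [simp] = integrable_bmf
  have "(l2 M (\<lambda>x. f x + g x))\<^sup>2 = (\<integral>x. (f x)\<^sup>2 + 2 * (f x * g x) + (g x)\<^sup>2 \<partial>M)"
    unfolding l2_sq by (intro Bochner_Integration.integral_cong) (auto simp: power2_eq_square algebra_simps)
  also have "\<dots> = (l2 M f)\<^sup>2 + 2 * (\<integral>x. f x * g x \<partial>M) + (l2 M g)\<^sup>2"
    using assms by (simp add: bmf_intros l2_sq)
  also have "\<dots> \<le> (l2 M f + l2 M g)\<^sup>2"
    using l2_Cauchy_Schwarz[OF assms] by (simp add: power2_eq_square algebra_simps)
  finally show ?thesis by (rule power2_le_imp_le) simp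
qed

lemma l2_sum:
  "(\<And>i. i \<in> I \<Longrightarrow> bmf M (f i)) \<Longrightarrow> l2 M (\<lambda>x. \<Sum>i\<in>I. f i x) \<le> (\<Sum>i\<in>I. l2 M (f i))"
proof (induction I rule: infinite_finite_induct)
  case (insert i I)
  have "l2 M (\<lambda>x. \<Sum>i\<in>insert i I. f i x) = l2 M (\<lambda>x. f i x + (\<Sum>i\<in>I. f i x))"
    using insert by simp
  also have "\<dots> \<le> l2 M (f i) + l2 M (\<lambda>x. \<Sum>i\<in>I. f i x)"
    by (intro l2_triangle bmf_intros) (use insert in auto)
  finally show ?case using insert by force
qed (auto simp: l2_def)

lemma l2_scale: "l2 M (\<lambda>x. c * f x) = \<bar>c\<bar> * l2 M f"
  by (simp add: l2_def power_mult_distrib real_sqrt_mult)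

lemma l2_uminus: "l2 M (\<lambda>x. - f x) = l2 M f"
  by (simp add: l2_def)

lemma l2_abs_diff:
  assumes "bmf M f" "bmf M g"
  shows "\<bar>l2 M f - l2 M g\<bar> \<le> l2 M (\<lambda>x. f x - g x)"
  using l2_triangle[of g "\<lambda>x. f x - g x"] l2_triangle[of f "\<lambda>x. - (f x - g x)"] assms
    l2_uminus[of "\<lambda>x. f x - g x"]
  by (simp add: bmf_intros)

lemma l1_le_l2: assumes "bmf M f" shows "(\<integral>x. \<bar>f x\<bar> \<partial>M) \<le> l2 M f"
  using l2_Cauchy_Schwarz[of "\<lambda>x. \<bar>f x\<bar>" "\<lambda>x. 1"] assms
  by (simp add: bmf_intros l2_def prob_space)

lemma sq_integral_le:
  assumes "bmf M f" shows "(\<integral>x. f x \<partial>M)\<^sup>2 \<le> (\<integral>x. (f x :: real)\<^sup>2 \<partial>M)"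
proof -
  have "\<bar>\<integral>x. f x \<partial>M\<bar> \<le> l2 M f"
    using l2_Cauchy_Schwarz[of f "\<lambda>x. 1"] assms by (simp add: l2_def prob_space)
  from power_mono[OF this, of 2] show ?thesis by (simp add: l2_sq)
qed

end

section \<open>Projections and increments of functions on a sequence space\<close>

definition seq_shift :: "nat \<Rightarrow> (nat \<Rightarrow> 'a) \<Rightarrow> nat \<Rightarrow> 'a" where
  "seq_shift i s = (\<lambda>j. s (i + j))"

lemma seq_shift_apply [simp]: "seq_shift i s j = s (i + j)"
  by (simp add: seq_shift_def)

context sequence_space begin

text \<open>Conditional expectation given the coordinates below \<open>m\<close>. In the application coordinate \<open>j\<close>
  is the innovation at lag \<open>j\<close>.\<close>
definition proj :: "nat \<Rightarrow> ((nat \<Rightarrow> 'a) \<Rightarrow> real) \<Rightarrow> (nat \<Rightarrow> 'a) \<Rightarrow> real" where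
  "proj m g s = (\<integral>t. g (comb_seq m s t) \<partial>S)"

lemma measurable_seq_shift [measurable]: "seq_shift i \<in> measurable S S"
  unfolding seq_shift_def
  by (rule measurable_PiM_single') (auto simp: space_PiM)

lemma measurable_comb_left: "s \<in> space S \<Longrightarrow> comb_seq m s \<in> measurable S S"
  using measurable_compose[OF measurable_Pair1' measurable_comb_seq[of m]] by fastforce

text \<open>Splicing an independent tail onto the first \<open>m\<close> coordinates preserves the
  product law. Together with Fubini this replaces conditional expectations and abstract independence
  in all that follows.\<close>

lemma integral_comb:
  fixes f :: "(nat \<Rightarrow> 'a) \<Rightarrow> 'b::{banach,second_countable_topology}"
  assumes "bmf S f"
  shows "(\<integral>s. f s \<partial>S) = (\<integral>s. (\<integral>t. f (comb_seq m s t) \<partial>S) \<partial>S)"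
    and "(\<integral>s. f s \<partial>S) = (\<integral>t. (\<integral>s. f (comb_seq m s t) \<partial>S) \<partial>S)"
proof -
  interpret PP: pair_prob_space S S ..
  have meas: "(\<lambda>(s,t). comb_seq m s t) \<in> measurable (S \<Otimes>\<^sub>M S) S" by (rule measurable_comb_seq)
  have "bmf (S \<Otimes>\<^sub>M S) (\<lambda>x. f ((\<lambda>(s,t). comb_seq m s t) x))"
    by (rule bmf_comp[OF assms meas])
  then have int: "integrable (S \<Otimes>\<^sub>M S) (\<lambda>(s,t). f (comb_seq m s t))"
    by (intro bmf_integrable) (auto simp: split_beta' intro: PP.finite_measure_axioms)
  have "(\<integral>s. f s \<partial>S) = (\<integral>s. f s \<partial>distr (S \<Otimes>\<^sub>M S) S (\<lambda>(s,t). comb_seq m s t))"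
    by (simp add: PiM_comb_seq)
  also have "\<dots> = (\<integral>x. (\<lambda>(s,t). f (comb_seq m s t)) x \<partial>(S \<Otimes>\<^sub>M S))"
    by (subst integral_distr[OF meas bmf_measurable[OF assms]]) (simp add: split_beta')
  finally have *: "(\<integral>s. f s \<partial>S) = \<dots>" .
  show "(\<integral>s. f s \<partial>S) = (\<integral>s. (\<integral>t. f (comb_seq m s t) \<partial>S) \<partial>S)"
    unfolding * using PP.integral_fst'[OF int] by simp
  show "(\<integral>s. f s \<partial>S) = (\<integral>t. (\<integral>s. f (comb_seq m s t) \<partial>S) \<partial>S)"
    unfolding * using PP.integral_snd[of "\<lambda>s t. f (comb_seq m s t)"] int by simp
qed

lemma proj_bound:
  assumes "bmf S g" and B: "\<And>x. norm (g x) \<le> B" shows "norm (proj m g s) \<le> B"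
proof (cases "integrable S (\<lambda>t. g (comb_seq m s t))")
  case True
  have "norm (proj m g s) \<le> (\<integral>t. norm (g (comb_seq m s t)) \<partial>S)"
    unfolding proj_def by (rule integral_norm_bound)
  also have "\<dots> \<le> (\<integral>t. B \<partial>S)"
    by (rule integral_mono) (use True B in \<open>auto intro: integrable_norm\<close>)
  finally show ?thesis by (simp add: P.prob_space)
next
  case False
  \<comment> \<open>Off the space the section of \<open>g\<close> may fail to be integrable; its
    integral is then \<open>0\<close> by default, so the bound holds at every \<open>s\<close>, as
    \<open>bmf\<close> requires.\<close>
  have "0 \<le> B" using B norm_ge_zero order_trans by blast
  with False show ?thesis by (simp add: proj_def not_integrable_integral_eq)
qed

lemma bmf_proj: assumes "bmf S g" shows "bmf S (proj m g)"
proof -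
  obtain B where B: "\<And>x. norm (g x) \<le> B" by (rule bmfE[OF assms]) blast
  have [measurable]: "g \<in> borel_measurable S" using assms by (rule bmf_measurable)
  have "(\<lambda>x. g ((\<lambda>(s,t). comb_seq m s t) x)) \<in> borel_measurable (S \<Otimes>\<^sub>M S)"
    by (rule measurable_compose[OF measurable_comb_seq]) simp
  then have [measurable]: "(\<lambda>(s,t). g (comb_seq m s t)) \<in> borel_measurable (S \<Otimes>\<^sub>M S)"
    by (simp add: split_beta')
  have "proj m g \<in> borel_measurable S"
    unfolding proj_def[abs_def] by measurable
  then show ?thesis using proj_bound[OF assms B] by (intro bmfI)
qed

text \<open>Dependence on the coordinates before \<open>c\<close>, and in \<open>dep_above\<close>
  on those from \<open>c\<close> onwards, is stated pointwise on all sequences rather than as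
  measurability for a sub-sigma-algebra. It can then be checked by rewriting spliced
  sequences.\<close>

definition dep_below :: "nat \<Rightarrow> ((nat \<Rightarrow> 'a) \<Rightarrow> 'b) \<Rightarrow> bool" where
  "dep_below c F \<longleftrightarrow> (\<forall>s t. (\<forall>j<c. s j = t j) \<longrightarrow> F s = F t)"

definition dep_above :: "nat \<Rightarrow> ((nat \<Rightarrow> 'a) \<Rightarrow> 'b) \<Rightarrow> bool" where
  "dep_above c F \<longleftrightarrow> (\<forall>s t. (\<forall>j\<ge>c. s j = t j) \<longrightarrow> F s = F t)"

lemma dep_belowD: "dep_below c F \<Longrightarrow> (\<And>j. j < c \<Longrightarrow> s j = t j) \<Longrightarrow> F s = F t"
  unfolding dep_below_def by blast

lemma dep_aboveD: "dep_above c F \<Longrightarrow> (\<And>j. c \<le> j \<Longrightarrow> s j = t j) \<Longrightarrow> F s = F t"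
  unfolding dep_above_def by blast

lemma dep_below_comb: "dep_below c F \<Longrightarrow> c \<le> m \<Longrightarrow> F (comb_seq m s t) = F s"
  by (erule dep_belowD) (auto simp: comb_seq_def)

lemma dep_below_proj: "dep_below m (proj m g)"
  unfolding dep_below_def proj_def
  by (intro allI impI Bochner_Integration.integral_cong refl arg_cong[of _ _ g]) (auto simp: comb_seq_def)

lemma dep_below_mono: "dep_below c F \<Longrightarrow> c \<le> d \<Longrightarrow> dep_below d F"
  unfolding dep_below_def by (meson order.strict_trans2)

text \<open>In a sequence spliced at \<open>c\<close> the first factor sees only the head
  \<open>s\<close> and the second only the tail \<open>t\<close>, so the double integral splits. The
  fixed \<open>s0\<close> merely fills the head that \<open>H\<close> ignores.\<close>

lemma integral_indep:
  fixes F H :: "(nat \<Rightarrow> 'a) \<Rightarrow> 'b::{banach,second_countable_topology,real_normed_field}"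
  assumes "bmf S F" "bmf S H" "dep_below c F" "dep_above c H"
  shows "(\<integral>s. F s * H s \<partial>S) = (\<integral>s. F s \<partial>S) * (\<integral>s. H s \<partial>S)"
proof -
  obtain s0 where s0: "s0 \<in> space S" using not_empty by blast
  have F: "F (comb_seq c s t) = F s" for s t
    by (rule dep_belowD[OF assms(3)]) (simp add: comb_seq_def)
  have H: "H (comb_seq c s t) = H (comb_seq c s0 t)" for s t
    by (rule dep_aboveD[OF assms(4)]) (simp add: comb_seq_def)
  have "(\<integral>s. F s * H s \<partial>S) = (\<integral>s. (\<integral>t. F (comb_seq c s t) * H (comb_seq c s t) \<partial>S) \<partial>S)"
    by (rule integral_comb(1)) (intro bmf_intros assms)
  also have "\<dots> = (\<integral>s. (\<integral>t. F s * H (comb_seq c s0 t) \<partial>S) \<partial>S)"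
    by (subst F, subst H, rule refl)
  also have "\<dots> = (\<integral>s. F s \<partial>S) * (\<integral>t. H (comb_seq c s0 t) \<partial>S)" by simp
  also have "(\<integral>t. H (comb_seq c s0 t) \<partial>S) = (\<integral>s. (\<integral>t. H (comb_seq c s t) \<partial>S) \<partial>S)"
    by (subst (2) H) (simp add: P.prob_space)
  also have "\<dots> = (\<integral>s. H s \<partial>S)" by (rule integral_comb(1)[symmetric, OF assms(2)])
  finally show ?thesis .
qed

text \<open>Splice at coordinate \<open>i\<close>: what the shift leaves is exactly the fresh tail,
  which has the original law.\<close>

lemma integral_shift:
  fixes F :: "(nat \<Rightarrow> 'a) \<Rightarrow> 'b::{banach,second_countable_topology}"
  assumes "bmf S F"
  shows "(\<integral>s. F (seq_shift i s) \<partial>S) = (\<integral>s. F s \<partial>S)"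
proof -
  have "(\<integral>s. F (seq_shift i s) \<partial>S) = (\<integral>s. (\<integral>t. F (seq_shift i (comb_seq i s t)) \<partial>S) \<partial>S)"
    by (rule integral_comb(1)[OF bmf_comp[OF assms]]) simp
  also have "\<dots> = (\<integral>s. (\<integral>t. F t \<partial>S) \<partial>S)"
    by (intro Bochner_Integration.integral_cong refl arg_cong[of _ _ F]) (auto simp: comb_seq_def)
  also have "\<dots> = (\<integral>s. F s \<partial>S)"
    by (simp add: P.prob_space)
  finally show ?thesis .
qed

lemma l2_shift: assumes "bmf S F" shows "l2 S (\<lambda>s. F (seq_shift i s)) = l2 S F"
  unfolding l2_def by (subst integral_shift) (auto intro!: bmf_intros assms)

lemma proj_0: "proj 0 g s = (\<integral>t. g t \<partial>S)"
  by (simp add: proj_def comb_seq_def[abs_def])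

lemma integral_proj: assumes "bmf S g" shows "(\<integral>s. proj m g s \<partial>S) = (\<integral>s. g s \<partial>S)"
  unfolding proj_def by (rule integral_comb(1)[OF assms, symmetric])

lemma comb_seq_assoc: "j \<le> k \<Longrightarrow> comb_seq k (comb_seq j s t) u = comb_seq j s (comb_seq (k - j) t u)"
  by (auto simp: comb_seq_def fun_eq_iff)

text \<open>The tower property, here a pointwise identity on the space; membership of
  \<open>s\<close> serves the measurability of \<open>comb_seq j s\<close>.\<close>

lemma proj_proj:
  assumes "bmf S g" "j \<le> k" "s \<in> space S" shows "proj j (proj k g) s = proj j g s"
proof -
  have b: "bmf S (\<lambda>t. g (comb_seq j s t))"
    by (rule bmf_comp[OF assms(1) measurable_comb_left[OF assms(3)]])
  have "proj j (proj k g) s = (\<integral>t. (\<integral>u. g (comb_seq j s (comb_seq (k - j) t u)) \<partial>S) \<partial>S)"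
    unfolding proj_def by (simp add: comb_seq_assoc assms(2))
  also have "\<dots> = (\<integral>t. g (comb_seq j s t) \<partial>S)"
    by (rule integral_comb(1)[OF b, symmetric])
  finally show ?thesis by (simp add: proj_def)
qed

lemma proj_diff:
  assumes "bmf S f" "bmf S g" "s \<in> space S"
  shows "proj m (\<lambda>s. f s - g s) s = proj m f s - proj m g s"
  unfolding proj_def
  by (intro Bochner_Integration.integral_diff bmf_integrable bmf_comp[OF assms(1)] bmf_comp[OF assms(2)]
      measurable_comb_left assms finite_measure_axioms)

lemma l2_proj_le: assumes "bmf S g" shows "l2 S (proj m g) \<le> l2 S g"
proof -
  have "(\<integral>s. (proj m g s)\<^sup>2 \<partial>S) \<le> (\<integral>s. (\<integral>t. (g (comb_seq m s t))\<^sup>2 \<partial>S) \<partial>S)"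
  proof (rule integral_mono)
    show "integrable S (\<lambda>s. (proj m g s)\<^sup>2)"
      by (intro bmf_integrable bmf_intros bmf_proj assms finite_measure_axioms)
    have "bmf S (proj m (\<lambda>s. (g s)\<^sup>2))" by (intro bmf_proj bmf_intros assms)
    then show "integrable S (\<lambda>s. \<integral>t. (g (comb_seq m s t))\<^sup>2 \<partial>S)"
      unfolding proj_def[abs_def] by (intro bmf_integrable finite_measure_axioms)
    fix s assume "s \<in> space S"
    then show "(proj m g s)\<^sup>2 \<le> (\<integral>t. (g (comb_seq m s t))\<^sup>2 \<partial>S)"
      unfolding proj_def by (intro P.sq_integral_le bmf_comp[OF assms] measurable_comb_left)
  qed
  also have "\<dots> = (\<integral>s. (g s)\<^sup>2 \<partial>S)"
    by (rule integral_comb(1)[symmetric]) (intro bmf_intros assms)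
  finally show ?thesis unfolding l2_def by simp
qed

text \<open>What coordinate \<open>k\<close> adds to the knowledge of coordinates \<open>0\<close>
  to \<open>k - 1\<close>. The filtration starts at the present and grows into the past, unlike the
  usual one of a causal process.\<close>

definition incr :: "nat \<Rightarrow> ((nat \<Rightarrow> 'a) \<Rightarrow> real) \<Rightarrow> (nat \<Rightarrow> 'a) \<Rightarrow> real" where
  "incr k g s = proj (Suc k) g s - proj k g s"

lemma bmf_incr: "bmf S g \<Longrightarrow> bmf S (incr k g)"
  unfolding incr_def[abs_def] by (intro bmf_intros bmf_proj)

lemma dep_below_incr: "dep_below (Suc k) (incr k g)"
  using dep_below_proj[of "Suc k" g] dep_below_mono[OF dep_below_proj[of k g], of "Suc k"]
  unfolding dep_below_def incr_def by (metis le_Suc_eq order_refl)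

lemma proj_incr: assumes "bmf S g" "s \<in> space S" shows "proj k (incr k g) s = 0"
  unfolding incr_def[abs_def] using assms by (simp add: proj_diff bmf_proj proj_proj)

text \<open>Coordinate \<open>i' + k\<close> enters only the later factor, and averaging over it gives \<open>0\<close>.\<close>
lemma incr_orthogonal:
  assumes g: "bmf S g" and "i < i'"
  shows "(\<integral>s. incr k g (seq_shift i s) * incr k g (seq_shift i' s) \<partial>S) = 0"
proof -
  have 1: "incr k g (seq_shift i (comb_seq (i' + k) s t)) = incr k g (seq_shift i s)" for s t
    by (rule dep_belowD[OF dep_below_incr]) (use \<open>i < i'\<close> in \<open>auto simp: comb_seq_def\<close>)
  have 2: "seq_shift i' (comb_seq (i' + k) s t) = comb_seq k (seq_shift i' s) t" for s t :: "nat \<Rightarrow> 'a"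
    by (auto simp: comb_seq_def fun_eq_iff)
  have "(\<integral>s. incr k g (seq_shift i s) * incr k g (seq_shift i' s) \<partial>S) =
    (\<integral>s. (\<integral>t. incr k g (seq_shift i (comb_seq (i' + k) s t)) * incr k g (seq_shift i' (comb_seq (i' + k) s t)) \<partial>S) \<partial>S)"
    by (rule integral_comb(1), rule bmf_mult; rule bmf_comp[OF bmf_incr[OF g]]; simp)
  also have "\<dots> = (\<integral>s. incr k g (seq_shift i s) * proj k (incr k g) (seq_shift i' s) \<partial>S)"
    by (simp add: 1 2 proj_def)
  also have "\<dots> = (\<integral>s. 0 \<partial>S)"
    by (intro Bochner_Integration.integral_cong refl)
      (use measurable_space[OF measurable_seq_shift] in \<open>auto simp: proj_incr[OF g]\<close>)
  finally show ?thesis by simp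
qed

lemma l2_incr_sum:
  assumes g: "bmf S g" and "finite I"
  shows "l2 S (\<lambda>s. \<Sum>i\<in>I. a i * incr k g (seq_shift i s)) = sqrt (\<Sum>i\<in>I. (a i)\<^sup>2) * l2 S (incr k g)"
proof -
  let ?r = "\<lambda>i s. incr k g (seq_shift i s)"
  have b: "bmf S (?r i)" for i by (rule bmf_comp[OF bmf_incr[OF g]]) simp
  note I = P.integrable_bmf
  have "(\<integral>s. (\<Sum>i\<in>I. a i * ?r i s)\<^sup>2 \<partial>S) = (\<integral>s. (\<Sum>i\<in>I. \<Sum>j\<in>I. (a i * a j) * (?r i s * ?r j s)) \<partial>S)"
    by (intro Bochner_Integration.integral_cong)
       (auto simp: power2_eq_square sum_product algebra_simps intro!: sum.cong)
  also have "\<dots> = (\<Sum>i\<in>I. \<Sum>j\<in>I. (a i * a j) * (\<integral>s. ?r i s * ?r j s \<partial>S))"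
    by (simp add: I b bmf_intros)
  also have "\<dots> = (\<Sum>i\<in>I. \<Sum>j\<in>I. (a i * a j) * (if i = j then (l2 S (incr k g))\<^sup>2 else 0))"
  proof (intro sum.cong refl)
    fix i j
    have "(\<integral>s. ?r i s * ?r j s \<partial>S) = (if i = j then (l2 S (incr k g))\<^sup>2 else 0)"
    proof (cases "i = j")
      case True
      then show ?thesis
        using l2_shift[OF bmf_incr[OF g, of k], of i] unfolding l2_def by (simp add: power2_eq_square)
    next
      case False
      then consider "i < j" | "j < i" by linarith
      then show ?thesis
        using incr_orthogonal[OF g, of i j k] incr_orthogonal[OF g, of j i k] False
        by cases (auto simp: mult.commute)
    qed
    then show "(a i * a j) * (\<integral>s. ?r i s * ?r j s \<partial>S) = (a i * a j) * (if i = j then (l2 S (incr k g))\<^sup>2 else 0)"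
      by simp
  qed
  also have "\<dots> = (\<Sum>i\<in>I. (a i)\<^sup>2) * (l2 S (incr k g))\<^sup>2"
    using \<open>finite I\<close> by (simp add: sum_distrib_right if_distrib[of "\<lambda>x. _ * x"] power2_eq_square cong: if_cong)
  finally show ?thesis
    by (subst l2_def) (simp add: real_sqrt_mult)
qed

text \<open>The order of summation matters. Telescope over lags, exchange the sums, then use
  orthogonality over times inside each lag and the triangle inequality only over lags. The weights
  thus enter through their quadratic norm; the triangle inequality over times would cost the sum of
  their absolute values.\<close>

lemma l2_proj_sum:
  assumes g: "bmf S g" and "finite I" and "m \<le> K"
  shows "l2 S (\<lambda>s. \<Sum>i\<in>I. a i * (proj K g (seq_shift i s) - proj m g (seq_shift i s)))
     \<le> sqrt (\<Sum>i\<in>I. (a i)\<^sup>2) * (\<Sum>k=m..<K. l2 S (incr k g))"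
proof -
  have tel: "proj K g s - proj m g s = (\<Sum>k=m..<K. incr k g s)" for s
    unfolding incr_def using sum_Suc_diff'[OF \<open>m \<le> K\<close>, of "\<lambda>k. proj k g s"] by simp
  have "l2 S (\<lambda>s. \<Sum>i\<in>I. a i * (proj K g (seq_shift i s) - proj m g (seq_shift i s)))
     = l2 S (\<lambda>s. \<Sum>k=m..<K. \<Sum>i\<in>I. a i * incr k g (seq_shift i s))"
    by (subst sum.swap) (simp add: tel sum_distrib_left)
  also have "\<dots> \<le> (\<Sum>k=m..<K. l2 S (\<lambda>s. \<Sum>i\<in>I. a i * incr k g (seq_shift i s)))"
    by (intro P.l2_sum bmf_sum bmf_mult bmf_const bmf_comp[OF bmf_incr[OF g]]) simp
  also have "\<dots> = sqrt (\<Sum>i\<in>I. (a i)\<^sup>2) * (\<Sum>k=m..<K. l2 S (incr k g))"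
    by (simp add: l2_incr_sum[OF g \<open>finite I\<close>] sum_distrib_left)
  finally show ?thesis .
qed

lemma l2_tail_sum:
  assumes g: "bmf S g" and "finite I"
    and lim: "(\<lambda>K. l2 S (\<lambda>s. g s - proj K g s)) \<longlonglongrightarrow> 0"
    and rho: "\<And>k. l2 S (incr k g) \<le> v * \<rho> k" "summable \<rho>" "0 \<le> v" "\<And>k. 0 \<le> \<rho> k"
  shows "l2 S (\<lambda>s. \<Sum>i\<in>I. a i * (g (seq_shift i s) - proj m g (seq_shift i s)))
     \<le> sqrt (\<Sum>i\<in>I. (a i)\<^sup>2) * (v * (\<Sum>k. \<rho> (k + m)))"
proof -
  let ?D = "\<lambda>s. \<Sum>i\<in>I. a i * (g (seq_shift i s) - proj m g (seq_shift i s))"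
  let ?A = "sqrt (\<Sum>i\<in>I. (a i)\<^sup>2)"
  have bg: "bmf S (\<lambda>s. g (seq_shift i s))" for i by (rule bmf_comp[OF g]) simp
  have bp: "bmf S (\<lambda>s. proj K g (seq_shift i s))" for i K by (rule bmf_comp[OF bmf_proj[OF g]]) simp
  \<comment> \<open>The first term uses the crude triangle inequality over times. This is harmless
    because \<open>I\<close> is fixed when \<open>K\<close> tends to infinity.\<close>
  have key: "l2 S ?D
    \<le> (\<Sum>i\<in>I. \<bar>a i\<bar> * l2 S (\<lambda>s. g s - proj K g s)) + ?A * (v * (\<Sum>k. \<rho> (k + m)))" if "m \<le> K" for K
  proof -
    have "l2 S ?D
      = l2 S (\<lambda>s. (\<Sum>i\<in>I. a i * (g (seq_shift i s) - proj K g (seq_shift i s)))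
          + (\<Sum>i\<in>I. a i * (proj K g (seq_shift i s) - proj m g (seq_shift i s))))"
      by (simp add: sum.distrib[symmetric] algebra_simps)
    also have "\<dots> \<le> l2 S (\<lambda>s. \<Sum>i\<in>I. a i * (g (seq_shift i s) - proj K g (seq_shift i s)))
        + l2 S (\<lambda>s. \<Sum>i\<in>I. a i * (proj K g (seq_shift i s) - proj m g (seq_shift i s)))"
      by (intro P.l2_triangle bmf_intros bg bp)
    also have "l2 S (\<lambda>s. \<Sum>i\<in>I. a i * (g (seq_shift i s) - proj K g (seq_shift i s)))
        \<le> (\<Sum>i\<in>I. l2 S (\<lambda>s. a i * (g (seq_shift i s) - proj K g (seq_shift i s))))"
      by (intro P.l2_sum bmf_intros bg bp)
    also have "\<dots> = (\<Sum>i\<in>I. \<bar>a i\<bar> * l2 S (\<lambda>s. g s - proj K g s))"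
      using l2_shift[of "\<lambda>s. g s - proj K g s"]
      by (simp add: P.l2_scale bmf_intros g bmf_proj)
    also have "l2 S (\<lambda>s. \<Sum>i\<in>I. a i * (proj K g (seq_shift i s) - proj m g (seq_shift i s)))
        \<le> ?A * (\<Sum>k=m..<K. l2 S (incr k g))"
      by (rule l2_proj_sum) fact+
    also have "(\<Sum>k=m..<K. l2 S (incr k g)) \<le> (\<Sum>k=m..<K. v * \<rho> k)"
      by (intro sum_mono rho)
    also have "\<dots> = v * (\<Sum>k<K-m. \<rho> (k + m))"
      using that sum.shift_bounds_nat_ivl[of \<rho> 0 m "K - m"]
      by (simp add: sum_distrib_left[symmetric] atLeast0LessThan)
    also have "(\<Sum>k<K-m. \<rho> (k + m)) \<le> (\<Sum>k. \<rho> (k + m))"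
      using rho by (intro sum_le_suminf) (auto simp: summable_iff_shift)
    finally show ?thesis using rho(3) by (simp add: mult_left_mono sum_nonneg del: seq_shift_apply)
  qed
  have "(\<lambda>K. (\<Sum>i\<in>I. \<bar>a i\<bar> * l2 S (\<lambda>s. g s - proj K g s)) + ?A * (v * (\<Sum>k. \<rho> (k + m))))
    \<longlonglongrightarrow> (\<Sum>i\<in>I. \<bar>a i\<bar> * 0) + ?A * (v * (\<Sum>k. \<rho> (k + m)))"
    by (intro tendsto_intros lim)
  then show ?thesis
    using key by (intro LIMSEQ_le_const) (auto simp del: seq_shift_apply)
qed

end

section \<open>Approximation by finitely many coordinates, and the coupling inequality\<close>

definition seq_del :: "nat \<Rightarrow> (nat \<Rightarrow> 'a) \<Rightarrow> nat \<Rightarrow> 'a" where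
  "seq_del i w = (\<lambda>j. w (if j < i then j else Suc j))"

context sequence_space begin

text \<open>The sets that can be approximated form a Dynkin system containing the product algebra.
  Allowing arbitrary bounded \<open>h\<close> instead of indicators makes the closure steps linear:
  \<open>1 - h\<close> for complements and finite sums for disjoint unions.\<close>

lemma cylinder_approx:
  assumes "A \<in> sets S" "0 < e"
  shows "\<exists>h m. bmf S h \<and> dep_below m h \<and> l2 S (\<lambda>s. indicator A s - h s) < e"
proof -
  define good where "good A \<longleftrightarrow> (\<forall>e>0. \<exists>h m. bmf S h \<and> dep_below m h \<and> l2 S (\<lambda>s. indicator A s - h s) < e)"
    for A :: "(nat \<Rightarrow> 'a) set"
  let ?P = "prod_algebra UNIV (\<lambda>_::nat. M)"
  have sub: "?P \<subseteq> Pow (PiE UNIV (\<lambda>_. space M))" by (rule prod_algebra_sets_into_space)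
  have sS: "sets S = sigma_sets (PiE UNIV (\<lambda>_. space M)) ?P"
    by (rule sets_PiM)
  have spS: "space S = PiE UNIV (\<lambda>_. space M)" by (rule space_PiM)
  have cong: "l2 S f = l2 S g" if "\<And>s. s \<in> space S \<Longrightarrow> f s = g s" for f g
    unfolding l2_def using that by (auto cong: Bochner_Integration.integral_cong)
  have "A \<in> sigma_sets (PiE UNIV (\<lambda>_. space M)) ?P" using assms(1) sS by simp
  then have "good A"
  proof (induction A rule: sigma_sets_induct_disjoint[OF Int_stable_prod_algebra sub, consumes 1, case_names basic empty compl union])
    case (basic A)
    then obtain J X where A: "A = prod_emb UNIV (\<lambda>_. M) J (\<Pi>\<^sub>E j\<in>J. X j)" "finite J"
      "\<And>i. i \<in> J \<Longrightarrow> X i \<in> sets M" by (elim prod_algebraE) blast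
    define h :: "(nat \<Rightarrow> 'a) \<Rightarrow> real" where "h s = (\<Prod>j\<in>J. indicator (X j) (s j))" for s
    have "bmf S h" unfolding h_def[abs_def]
    proof (rule bmf_prod)
      fix j assume "j \<in> J"
      show "bmf S (\<lambda>s. indicator (X j) (s j) :: real)"
        by (rule bmf_comp[OF bmf_indicator[OF A(3)[OF \<open>j \<in> J\<close>]]]) measurable
    qed
    moreover have "dep_below (Suc (Max (insert 0 J))) h"
      unfolding h_def[abs_def] dep_below_def using A(2) by (auto intro!: prod.cong simp: less_Suc_eq_le Max_ge)
    moreover have "l2 S (\<lambda>s. indicator A s - h s) = l2 S (\<lambda>s. 0)"
    proof (rule cong)
      fix s assume "s \<in> space S"
      then have "s \<in> A \<longleftrightarrow> (\<forall>j\<in>J. s j \<in> X j)"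
        by (auto simp: A(1) prod_emb_def spS PiE_iff)
      then show "indicator A s - h s = 0"
        using A(2) by (auto simp: h_def indicator_def prod_zero_iff)
    qed
    moreover have "l2 S (\<lambda>s. 0) = 0" by (simp add: l2_def)
    ultimately have "bmf S h \<and> dep_below (Suc (Max (insert 0 J))) h \<and> l2 S (\<lambda>s. indicator A s - h s) < e"
      if "0 < e" for e using that by linarith
    then show ?case unfolding good_def by blast
  next
    case empty
    have "bmf S (\<lambda>s. 0::real) \<and> dep_below 0 (\<lambda>s. 0::real) \<and> l2 S (\<lambda>s. indicator {} s - 0) < e"
      if "0 < e" for e using that by (simp add: dep_below_def l2_def)
    then show ?case unfolding good_def by blast
  next
    case (compl A)
    show ?case unfolding good_def
    proof (intro allI impI)
      fix e :: real assume "0 < e"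
      with compl obtain h m where h: "bmf S h" "dep_below m h" "l2 S (\<lambda>s. indicator A s - h s) < e"
        unfolding good_def by blast
      have "l2 S (\<lambda>s. indicator (PiE UNIV (\<lambda>_. space M) - A) s - (1 - h s)) = l2 S (\<lambda>s. - (indicator A s - h s))"
        by (rule cong) (auto simp: spS indicator_def)
      then have "l2 S (\<lambda>s. indicator (PiE UNIV (\<lambda>_. space M) - A) s - (1 - h s)) < e"
        using h(3) by (simp only: P.l2_uminus)
      moreover have "dep_below m (\<lambda>s. 1 - h s)" using h(2) unfolding dep_below_def by metis
      ultimately show "\<exists>h m. bmf S h \<and> dep_below m h \<and>
          l2 S (\<lambda>s. indicator (PiE UNIV (\<lambda>_. space M) - A) s - h s) < e"
        using bmf_diff[OF bmf_const h(1), of 1] by blast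
    qed
  next
    case (union A)
    have Am [measurable]: "A i \<in> sets S" for i using union(2) sS by blast
    show ?case unfolding good_def
    proof (intro allI impI)
      fix e :: real assume e: "0 < e"
      have sm: "(\<lambda>i. P.prob (A i)) sums P.prob (\<Union>i. A i)"
        using union(1) by (intro P.finite_measure_UNION) auto
      have "(\<lambda>n. sqrt (P.prob (\<Union>i. A i) - (\<Sum>i<n. P.prob (A i)))) \<longlonglongrightarrow> sqrt (P.prob (\<Union>i. A i) - P.prob (\<Union>i. A i))"
        using sm unfolding sums_def by (intro tendsto_intros)
      then have "eventually (\<lambda>n. sqrt (P.prob (\<Union>i. A i) - (\<Sum>i<n. P.prob (A i))) < e / 2) sequentially"
        using e by (intro order_tendstoD) auto
      then obtain n where n: "sqrt (P.prob (\<Union>i. A i) - (\<Sum>i<n. P.prob (A i))) < e / 2"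
        by (auto simp: eventually_sequentially)
      \<comment> \<open>One half of \<open>e\<close> pays for the sets beyond \<open>n\<close>, the
        other is shared among the first \<open>n\<close> approximations; \<open>n + 1\<close> avoids
        division by zero.\<close>
      have e': "0 < e / (2 * (real n + 1))" using e by simp
      have "\<forall>i. \<exists>h m. bmf S h \<and> dep_below m h \<and> l2 S (\<lambda>s. indicator (A i) s - h s) < e / (2 * (real n + 1))"
        using union(3) e' unfolding good_def by blast
      then obtain h m where h: "\<And>i. bmf S (h i)" "\<And>i. dep_below (m i) (h i)"
        "\<And>i. l2 S (\<lambda>s. indicator (A i) s - h i s) < e / (2 * (real n + 1))" by metis
      let ?h = "\<lambda>s. \<Sum>i<n. h i s"
      let ?R = "(\<Union>i. A i) - (\<Union>i<n. A i)"
      have "dep_below (Max (insert 0 (m ` {..<n}))) ?h"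
        unfolding dep_below_def
      proof (intro allI impI sum.cong refl)
        fix s t :: "nat \<Rightarrow> 'a" and i assume *: "\<forall>j<Max (insert 0 (m ` {..<n})). s j = t j" "i \<in> {..<n}"
        then have "m i \<le> Max (insert 0 (m ` {..<n}))" by (intro Max_ge) auto
        with *(1) show "h i s = h i t" by (intro dep_belowD[OF h(2)]) (metis less_le_trans)
      qed
      moreover have "bmf S ?h" by (intro bmf_intros h)
      moreover have "l2 S (\<lambda>s. indicator (\<Union>i. A i) s - ?h s) < e"
      proof -
        have fin: "(\<Sum>i<n. indicator (A i) s) = (indicator (\<Union>i<n. A i) s :: real)" for s
          using union(1) by (intro indicator_UN_disjoint[symmetric]) (auto intro: disjoint_family_on_mono)
        have ind: "indicator (\<Union>i. A i) s - (\<Sum>i<n. indicator (A i) s) = (indicator ?R s :: real)" for s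
          unfolding fin by (auto simp: indicator_def)
        have "l2 S (\<lambda>s. indicator (\<Union>i. A i) s - ?h s)
          = l2 S (\<lambda>s. indicator ?R s + (\<Sum>i<n. indicator (A i) s - h i s))"
          unfolding ind[symmetric] by (simp add: sum_subtractf)
        also have "\<dots> \<le> l2 S (indicator ?R) + l2 S (\<lambda>s. \<Sum>i<n. indicator (A i) s - h i s)"
          by (intro P.l2_triangle bmf_intros bmf_indicator h) measurable
        also have "l2 S (\<lambda>s. \<Sum>i<n. indicator (A i) s - h i s) \<le> (\<Sum>i<n. l2 S (\<lambda>s. indicator (A i) s - h i s))"
          by (intro P.l2_sum bmf_intros bmf_indicator h) measurable
        also have "\<dots> \<le> (\<Sum>i<n. e / (2 * (real n + 1)))" by (intro sum_mono less_imp_le h)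
        also have "\<dots> \<le> e / 2" using e by (simp add: field_simps)
        also have "l2 S (indicator ?R) = sqrt (P.prob ?R)"
        proof -
          have "(\<lambda>s. (indicator ?R s :: real)\<^sup>2) = indicator ?R" by (auto simp: fun_eq_iff indicator_def)
          then show ?thesis unfolding l2_def by simp
        qed
        also have "P.prob ?R = P.prob (\<Union>i. A i) - P.prob (\<Union>i<n. A i)"
          by (rule P.finite_measure_Diff) auto
        also have "P.prob (\<Union>i<n. A i) = (\<Sum>i<n. P.prob (A i))"
          using union(1) by (intro P.finite_measure_finite_Union) (auto intro: disjoint_family_on_mono)
        finally show ?thesis using n by simp
      qed
      ultimately show "\<exists>h m. bmf S h \<and> dep_below m h \<and> l2 S (\<lambda>s. indicator (\<Union>i. A i) s - h s) < e"
        by blast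
    qed
  qed
  then show ?thesis using assms(2) unfolding good_def by blast
qed

text \<open>A function of the first \<open>m\<close> coordinates is fixed by all projections with
  \<open>m \<le> K\<close>, and projections contract the norm. So the projection error is at most
  twice the error of approximating by such a function, and no martingale convergence is
  involved.\<close>

lemma l2_proj_tendsto:
  assumes A: "A \<in> sets S"
  shows "(\<lambda>K. l2 S (\<lambda>s. (indicator A s - c) - proj K (\<lambda>s. indicator A s - c) s)) \<longlonglongrightarrow> 0"
proof (rule LIMSEQ_I)
  let ?g = "\<lambda>s. indicator A s - c :: real"
  fix e :: real assume "0 < e"
  then obtain h m where h: "bmf S h" "dep_below m h" "l2 S (\<lambda>s. indicator A s - h s) < e / 2"
    using cylinder_approx[OF A, of "e / 2"] by auto
  have g: "bmf S ?g" by (intro bmf_intros bmf_indicator A)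
  let ?h = "\<lambda>s. h s - c"
  have h': "bmf S ?h" by (intro bmf_intros h)
  have d: "bmf S (\<lambda>s. ?g s - ?h s)" by (intro bmf_intros g h')
  have "l2 S (\<lambda>s. ?g s - proj K ?g s) < e" if "m \<le> K" for K
  proof -
    have ph: "proj K ?h s = ?h s" for s
      using dep_below_comb[OF h(2) that] by (simp add: proj_def P.prob_space)
    have "l2 S (\<lambda>s. ?g s - proj K ?g s) = l2 S (\<lambda>s. (?g s - ?h s) + - proj K (\<lambda>s. ?g s - ?h s) s)"
    proof -
      have "?g s - proj K ?g s = (?g s - ?h s) + - proj K (\<lambda>s. ?g s - ?h s) s" if "s \<in> space S" for s
        unfolding proj_diff[OF g h' that] ph by simp
      then show ?thesis
        unfolding l2_def by (intro arg_cong[of _ _ sqrt] Bochner_Integration.integral_cong) (auto simp only:)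
    qed
    also have "\<dots> \<le> l2 S (\<lambda>s. ?g s - ?h s) + l2 S (proj K (\<lambda>s. ?g s - ?h s))"
      unfolding P.l2_uminus[of "proj K (\<lambda>s. ?g s - ?h s)", symmetric]
      by (intro P.l2_triangle bmf_intros d bmf_proj)
    also have "\<dots> \<le> 2 * l2 S (\<lambda>s. ?g s - ?h s)" using l2_proj_le[OF d, of K] by simp
    finally show ?thesis using h(3) by simp
  qed
  then show "\<exists>no. \<forall>n\<ge>no. norm (l2 S (\<lambda>s. ?g s - proj n ?g s) - 0) < e" by auto
qed

lemma measurable_seq_del [measurable]: "seq_del i \<in> measurable S S"
  unfolding seq_del_def
  by (rule measurable_PiM_single') (auto simp: space_PiM)

text \<open>Deleting coordinate \<open>k\<close> or \<open>k + 1\<close> produces two sequences that differ only in an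
  independent copy of coordinate \<open>k\<close>.\<close>
lemma l2_incr_le:
  assumes g: "bmf S g"
  shows "(l2 S (incr k g))\<^sup>2 \<le> (\<integral>w. (g (seq_del (Suc k) w) - g (seq_del k w))\<^sup>2 \<partial>S)"
proof -
  let ?D = "\<lambda>w. g (seq_del (Suc k) w) - g (seq_del k w)"
  have D: "bmf S ?D" by (intro bmf_intros bmf_comp[OF g] measurable_seq_del)
  have eq: "incr k g s = proj (Suc k) ?D s" if s: "s \<in> space S" for s
  proof -
    have b: "bmf S (\<lambda>t. g (comb_seq m s t))" for m
      by (rule bmf_comp[OF g measurable_comb_left[OF s]])
    have bc: "bmf S (\<lambda>t. g (seq_del m (comb_seq (Suc k) s t)))" for m
      by (rule bmf_comp[OF bmf_comp[OF g measurable_seq_del] measurable_comb_left[OF s]])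
    \<comment> \<open>The spliced sequence keeps coordinates \<open>0\<close> to \<open>k\<close> of
      \<open>s\<close>. Deleting position \<open>Suc k\<close> drops the first fresh coordinate, so
      coordinate \<open>k\<close> survives; deleting position \<open>k\<close> drops it and a fresh
      one takes its place. Averaging over the tail therefore yields the two projections whose
      difference is the increment.\<close>
    have 1: "seq_del (Suc k) (comb_seq (Suc k) s t) = comb_seq (Suc k) s (seq_shift 1 t)" for t
      by (auto simp: seq_del_def comb_seq_def fun_eq_iff intro!: arg_cong[of _ _ t])
    have 2: "seq_del k (comb_seq (Suc k) s t) = comb_seq k s t" for t
      by (auto simp: seq_del_def comb_seq_def fun_eq_iff)
    have "proj (Suc k) ?D s = (\<integral>t. g (seq_del (Suc k) (comb_seq (Suc k) s t)) \<partial>S)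
        - (\<integral>t. g (seq_del k (comb_seq (Suc k) s t)) \<partial>S)"
      unfolding proj_def
      by (intro Bochner_Integration.integral_diff bmf_integrable bc finite_measure_axioms)
    also have "\<dots> = (\<integral>t. g (comb_seq (Suc k) s (seq_shift 1 t)) \<partial>S) - (\<integral>t. g (comb_seq k s t) \<partial>S)"
      unfolding 1 2 ..
    also have "(\<integral>t. g (comb_seq (Suc k) s (seq_shift 1 t)) \<partial>S) = (\<integral>t. g (comb_seq (Suc k) s t) \<partial>S)"
      by (rule integral_shift[OF b])
    finally show ?thesis by (simp add: incr_def proj_def)
  qed
  have "(l2 S (incr k g))\<^sup>2 = (l2 S (proj (Suc k) ?D))\<^sup>2"
    unfolding l2_sq using eq by (auto intro!: Bochner_Integration.integral_cong)
  also have "\<dots> \<le> (l2 S ?D)\<^sup>2"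
    by (intro power_mono l2_proj_le D) simp
  finally show ?thesis by (simp add: l2_sq)
qed

end

section \<open>Characteristic functions of bounded variables compared with Gaussian ones\<close>

abbreviation (input) gauss_gap :: "'a measure \<Rightarrow> ('a \<Rightarrow> real) \<Rightarrow> complex" where
  "gauss_gap N X \<equiv> (\<integral>x. iexp (X x) \<partial>N) - complex_of_real (exp (- ((l2 N X)\<^sup>2) / 2))"

lemma norm_exp_minus_le:
  assumes "0 \<le> (y::real)" shows "\<bar>exp (- y) - (1 - y)\<bar> \<le> y\<^sup>2 / 2"
proof -
  have 1: "1 - y \<le> exp (- y)" using exp_ge_add_one_self[of "-y"] by simp
  have "exp (- y) \<le> 1 - y + y\<^sup>2 / 2"
  proof -
    let ?f = "\<lambda>y::real. 1 - y + y\<^sup>2 / 2 - exp (- y)"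
    have "?f 0 \<le> ?f y"
    proof (rule DERIV_nonneg_imp_nondecreasing[OF assms])
      fix x :: real
      have "(?f has_real_derivative (x - 1 + exp (- x))) (at x)"
        by (auto intro!: derivative_eq_intros)
      moreover have "0 \<le> x - 1 + exp (- x)" using exp_ge_add_one_self[of "-x"] by simp
      ultimately show "\<exists>y. (?f has_real_derivative y) (at x) \<and> 0 \<le> y" by blast
    qed
    then show ?thesis by simp
  qed
  with 1 show ?thesis by simp
qed

lemma norm_integral_le:
  fixes f :: "'a \<Rightarrow> 'b::{banach,second_countable_topology}"
  assumes "integrable N f" "integrable N g" "\<And>x. norm (f x) \<le> g x"
  shows "norm (\<integral>x. f x \<partial>N) \<le> (\<integral>x. g x \<partial>N)"
  by (rule order_trans[OF integral_norm_bound integral_mono]) (use assms in auto)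

context prob_space begin

text \<open>The third-order Taylor remainder gives \<open>\<kappa> / 6\<close> after one factor of
  the cube is bounded by \<open>\<kappa>\<close>. Replacing \<open>1 - v / 2\<close> by its
  exponential costs half the square of \<open>v / 2\<close>, and
  \<open>v \<le> \<kappa>\<^sup>2\<close> turns this into \<open>\<kappa>\<^sup>2 / 8\<close>. A
  factor \<open>v\<close>, the second moment, is kept outside so that the bounds of many blocks add
  up to the total variance.\<close>

lemma char_bounded_approx:
  assumes X: "bmf M X" and b: "\<And>x. \<bar>X x\<bar> \<le> \<kappa>" and mean: "(\<integral>x. X x \<partial>M) = 0"
  shows "cmod (gauss_gap M X) \<le> (l2 M X)\<^sup>2 * (\<kappa> / 6 + \<kappa>\<^sup>2 / 8)"
proof -
  let ?v = "(l2 M X)\<^sup>2"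
  note I = integrable_bmf
  have k: "0 \<le> \<kappa>" using b[of undefined] by linarith
  have e: "bmf M (\<lambda>x. iexp (X x))" using bmf_iexp[OF X, of 1] by simp
  have c: "bmf M (\<lambda>x. complex_of_real (f x))" if "bmf M f" for f
    using that unfolding bmf_def by auto
  have s2: "bmf M (\<lambda>x. (X x)\<^sup>2 / 2)"
    using bmf_mult[OF bmf_power[OF X, of 2] bmf_const, of "1/2"] by simp
  have c1: "bmf M (\<lambda>x. complex_of_real (1 - (X x)\<^sup>2 / 2))"
    by (rule c[OF bmf_diff[OF bmf_const s2]])
  have c2: "bmf M (\<lambda>x. complex_of_real (X x))" by (rule c[OF X])
  have "(\<integral>x. complex_of_real (1 - (X x)\<^sup>2 / 2) + \<i> * complex_of_real (X x) \<partial>M) = complex_of_real (1 - ?v / 2)"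
  proof -
    have "(\<integral>x. complex_of_real (1 - (X x)\<^sup>2 / 2) + \<i> * complex_of_real (X x) \<partial>M)
      = (\<integral>x. complex_of_real (1 - (X x)\<^sup>2 / 2) \<partial>M) + \<i> * (\<integral>x. complex_of_real (X x) \<partial>M)"
      using c1 c2 by (subst Bochner_Integration.integral_add) (auto intro!: I bmf_intros)
    also have "\<dots> = complex_of_real (\<integral>x. 1 - (X x)\<^sup>2 / 2 \<partial>M)"
      unfolding integral_complex_of_real mean by simp
    also have "(\<integral>x. 1 - (X x)\<^sup>2 / 2 \<partial>M) = 1 - ?v / 2"
      unfolding l2_sq by (subst Bochner_Integration.integral_diff) (auto intro: I[OF s2] simp: prob_space)
    finally show ?thesis .
  qed
  then have "(\<integral>x. iexp (X x) \<partial>M) - complex_of_real (1 - ?v / 2)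
    = (\<integral>x. iexp (X x) - (complex_of_real (1 - (X x)\<^sup>2 / 2) + \<i> * complex_of_real (X x)) \<partial>M)"
    by (subst Bochner_Integration.integral_diff) (auto intro!: I[OF e] I[OF bmf_add[OF c1 bmf_mult[OF bmf_const c2]]] simp del: of_real_diff)
  also have "cmod \<dots> \<le> (\<integral>x. (X x)\<^sup>2 * (\<kappa> / 6) \<partial>M)"
  proof (rule norm_integral_le)
    show "integrable M (\<lambda>x. iexp (X x) - (complex_of_real (1 - (X x)\<^sup>2 / 2) + \<i> * complex_of_real (X x)))"
      by (rule I[OF bmf_diff[OF e bmf_add[OF c1 bmf_mult[OF bmf_const c2]]]])
    show "integrable M (\<lambda>x. (X x)\<^sup>2 * (\<kappa> / 6))"
      by (rule I[OF bmf_mult[OF bmf_power[OF X] bmf_const]])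
    fix x
    have "cmod (iexp (X x) - (\<Sum>k\<le>2. (\<i> * X x)^k / fact k)) \<le> \<bar>X x\<bar>^(Suc 2) / fact (Suc 2)"
      by (rule iexp_approx1)
    also have "(\<Sum>k\<le>2. (\<i> * X x)^k / fact k) = complex_of_real (1 - (X x)\<^sup>2 / 2) + \<i> * complex_of_real (X x)"
      by (simp add: numeral_2_eq_2 power2_eq_square algebra_simps)
    also have "\<bar>X x\<bar>^(Suc 2) / fact (Suc 2) = (X x)\<^sup>2 * (\<bar>X x\<bar> / 6)"
      by (simp add: numeral_3_eq_3 fact_numeral power2_eq_square)
    also have "\<dots> \<le> (X x)\<^sup>2 * (\<kappa> / 6)" using b[of x] by (intro mult_left_mono) auto
    finally show "cmod (iexp (X x) - (complex_of_real (1 - (X x)\<^sup>2 / 2) + \<i> * complex_of_real (X x))) \<le> (X x)\<^sup>2 * (\<kappa> / 6)" .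
  qed
  also have "\<dots> = ?v * (\<kappa> / 6)" by (simp add: l2_sq)
  finally have 1: "cmod ((\<integral>x. iexp (X x) \<partial>M) - complex_of_real (1 - ?v / 2)) \<le> ?v * (\<kappa> / 6)" .
  have "?v \<le> (\<integral>x. \<kappa>\<^sup>2 \<partial>M)"
    unfolding l2_sq by (intro integral_mono I[OF bmf_power[OF X]] I[OF bmf_const]) (metis b abs_le_square_iff abs_of_nonneg k)
  then have v: "?v \<le> \<kappa>\<^sup>2" by (simp add: prob_space)
  have "\<bar>exp (- (?v / 2)) - (1 - ?v / 2)\<bar> \<le> (?v / 2)\<^sup>2 / 2"
    by (rule norm_exp_minus_le) simp
  also have "\<dots> = ?v * ?v / 8" by (simp add: power2_eq_square)
  also have "\<dots> \<le> ?v * \<kappa>\<^sup>2 / 8" using v by (intro divide_right_mono mult_left_mono) auto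
  finally have 2: "cmod (complex_of_real (1 - ?v / 2) - complex_of_real (exp (- ?v / 2))) \<le> ?v * \<kappa>\<^sup>2 / 8"
    unfolding of_real_diff[symmetric] norm_of_real by (simp add: abs_minus_commute)
  show ?thesis
    using norm_triangle_mono[OF 1 2] by (simp add: algebra_simps)
qed

text \<open>Both halves of the gap are Lipschitz in the quadratic mean: \<open>iexp\<close> has
  Lipschitz constant \<open>1\<close>, and so has \<open>exp (- x)\<close> on the nonnegative reals,
  where the difference of squares of the two norms is factorised.\<close>

lemma char_close:
  assumes U: "bmf M U" and W: "bmf M W"
  shows "cmod (gauss_gap M U)
    \<le> cmod (gauss_gap M W)
      + l2 M (\<lambda>x. U x - W x) * (1 + (l2 M U + l2 M W) / 2)"
proof -
  let ?d = "l2 M (\<lambda>x. U x - W x)"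
  note I = integrable_bmf
  have e: "bmf M (\<lambda>x. iexp (X x))" if "bmf M X" for X using bmf_iexp[OF that, of 1] by simp
  have "(\<integral>x. iexp (U x) \<partial>M) - (\<integral>x. iexp (W x) \<partial>M) = (\<integral>x. iexp (U x) - iexp (W x) \<partial>M)"
    by (rule Bochner_Integration.integral_diff[symmetric, OF I[OF e[OF U]] I[OF e[OF W]]])
  also have "cmod \<dots> \<le> (\<integral>x. \<bar>U x - W x\<bar> \<partial>M)"
  proof (rule norm_integral_le)
    show "integrable M (\<lambda>x. iexp (U x) - iexp (W x))" by (rule I[OF bmf_diff[OF e[OF U] e[OF W]]])
    show "integrable M (\<lambda>x. \<bar>U x - W x\<bar>)" by (rule I[OF bmf_abs[OF bmf_diff[OF U W]]])
    fix x
    have "cmod (iexp (U x) - iexp (W x)) = cmod (iexp (W x) * (iexp (U x - W x) - 1))"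
      by (simp add: algebra_simps exp_add[symmetric])
    also have "\<dots> = cmod (iexp (U x - W x) - (\<Sum>k\<le>0. (\<i> * complex_of_real (U x - W x))^k / fact k))"
      by (simp add: norm_mult)
    also have "\<dots> \<le> \<bar>U x - W x\<bar>" using iexp_approx1[of "U x - W x" 0] by simp
    finally show "cmod (iexp (U x) - iexp (W x)) \<le> \<bar>U x - W x\<bar>" .
  qed
  also have "\<dots> \<le> ?d" by (intro l1_le_l2 bmf_intros U W)
  finally have 1: "cmod ((\<integral>x. iexp (U x) \<partial>M) - (\<integral>x. iexp (W x) \<partial>M)) \<le> ?d" .
  have lip: "\<bar>exp (- x) - exp (- y)\<bar> \<le> \<bar>x - y\<bar>" if "0 \<le> x" "0 \<le> y" for x y :: real
  proof -
    have *: "exp (- x) - exp (- y) \<le> y - x" if "0 \<le> x" "x \<le> y" for x y :: real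
    proof -
      have "exp (- x) - exp (- y) = exp (- x) * (1 - exp (- (y - x)))"
        by (simp add: algebra_simps exp_add[symmetric])
      also have "\<dots> \<le> 1 * (1 - exp (- (y - x)))" using that by (intro mult_right_mono) auto
      also have "\<dots> \<le> y - x" using exp_ge_add_one_self[of "x - y"] by (simp del: exp_ge_add_one_self)
      finally show ?thesis .
    qed
    show ?thesis using *[of x y] *[of y x] that by (cases "x \<le> y") auto
  qed
  have "\<bar>exp (- ((l2 M W)\<^sup>2 / 2)) - exp (- ((l2 M U)\<^sup>2 / 2))\<bar> \<le> \<bar>(l2 M W)\<^sup>2 / 2 - (l2 M U)\<^sup>2 / 2\<bar>"
    by (rule lip) auto
  also have "\<dots> = \<bar>l2 M U - l2 M W\<bar> * ((l2 M U + l2 M W) / 2)"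
  proof -
    have *: "(l2 M W)\<^sup>2 / 2 - (l2 M U)\<^sup>2 / 2 = (l2 M W - l2 M U) * ((l2 M U + l2 M W) / 2)"
      by (simp add: power2_eq_square field_simps)
    show ?thesis unfolding * abs_mult by (simp add: abs_minus_commute)
  qed
  also have "\<dots> \<le> ?d * ((l2 M U + l2 M W) / 2)"
    by (intro mult_right_mono l2_abs_diff U W) simp
  finally have 2: "cmod (complex_of_real (exp (- ((l2 M W)\<^sup>2) / 2)) - complex_of_real (exp (- ((l2 M U)\<^sup>2) / 2))) \<le> ?d * ((l2 M U + l2 M W) / 2)"
    unfolding of_real_diff[symmetric] norm_of_real by simp
  have "gauss_gap M U
    = (gauss_gap M W)
     + (((\<integral>x. iexp (U x) \<partial>M) - (\<integral>x. iexp (W x) \<partial>M))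
     + (complex_of_real (exp (- ((l2 M W)\<^sup>2) / 2)) - complex_of_real (exp (- ((l2 M U)\<^sup>2) / 2))))"
    by simp
  also have "cmod \<dots> \<le> cmod (gauss_gap M W)
     + (?d + ?d * ((l2 M U + l2 M W) / 2))"
    by (rule norm_triangle_mono[OF order_refl norm_triangle_mono[OF 1 2]])
  finally show ?thesis by (simp only: distrib_left mult_1_right)
qed

end

section \<open>A central limit theorem for weighted sums of shifts\<close>

text \<open>Over one full period of offsets every residue is met exactly once. In the block
  construction this says that each index falls into a gap for exactly \<open>m\<close> of the
  \<open>p\<close> offsets.\<close>

lemma card_mod_offset:
  assumes "m \<le> (p::nat)" "0 < p"
  shows "card {k\<in>{..<p}. (i + k) mod p < m} = m"
proof -
  let ?f = "\<lambda>k. (i + k) mod p"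
  have inj: "inj_on ?f {..<p}"
  proof (rule linorder_inj_onI)
    fix k l assume kl: "k < l" "k \<in> {..<p}" "l \<in> {..<p}"
    show "(i + k) mod p \<noteq> (i + l) mod p"
    proof
      assume "(i + k) mod p = (i + l) mod p"
      then have "p dvd (i + l) - (i + k)"
        using kl by (metis mod_eq_dvd_iff_nat add_le_cancel_left less_imp_le_nat)
      then have "p dvd l - k" by simp
      then show False using kl by (auto dest: dvd_imp_le)
    qed
  qed auto
  have im: "?f ` {..<p} = {..<p}"
    using assms by (intro card_subset_eq) (auto simp: card_image[OF inj])
  have "?f ` {k\<in>{..<p}. ?f k < m} = ?f ` {..<p} \<inter> {..<m}" by auto
  also have "\<dots> = {..<m}" unfolding im using assms(1) by auto
  finally have "?f ` {k\<in>{..<p}. ?f k < m} = {..<m}" .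
  moreover have "inj_on ?f {k\<in>{..<p}. ?f k < m}" using inj by (rule inj_on_subset) auto
  ultimately show ?thesis by (metis card_image card_lessThan)
qed

context sequence_space begin

lemma dep_below_sum: "(\<And>i. i \<in> I \<Longrightarrow> dep_below c (f i)) \<Longrightarrow> dep_below c (\<lambda>s. \<Sum>i\<in>I. f i s)"
  unfolding dep_below_def by (blast intro: sum.cong)

lemma dep_above_sum: "(\<And>i. i \<in> I \<Longrightarrow> dep_above c (f i)) \<Longrightarrow> dep_above c (\<lambda>s. \<Sum>i\<in>I. f i s)"
  unfolding dep_above_def by (blast intro: sum.cong)

lemma dep_below_fun: "dep_below c f \<Longrightarrow> dep_below c (\<lambda>s. F (f s))"
  unfolding dep_below_def by metis

lemma dep_above_fun: "dep_above c f \<Longrightarrow> dep_above c (\<lambda>s. F (f s))"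
  unfolding dep_above_def by metis

lemma dep_below_shift: "dep_below m f \<Longrightarrow> i + m \<le> c \<Longrightarrow> dep_below c (\<lambda>s. f (seq_shift i s))"
  unfolding dep_below_def by simp

lemma dep_above_shift: "c \<le> i \<Longrightarrow> dep_above c (\<lambda>s. f (seq_shift i s))"
  unfolding dep_above_def by (intro allI impI arg_cong[of _ _ f]) (auto simp: fun_eq_iff)

text \<open>The variable \<open>X q\<close> lives on the coordinates from \<open>c q\<close> up to,
  but excluding, \<open>c (Suc q)\<close>. The partial sum of earlier blocks and the next block thus
  use disjoint coordinates, and both claims follow by adding one block at a time.\<close>

lemma block_sums:
  assumes X: "\<And>q. bmf S (X q)" and mono: "mono c"
    and below: "\<And>q. dep_below (c (Suc q)) (X q)" and above: "\<And>q. dep_above (c q) (X q)"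
    and mean: "\<And>q. (\<integral>s. X q s \<partial>S) = 0"
  shows "(\<integral>s. iexp (\<Sum>q<Q. X q s) \<partial>S) = (\<Prod>q<Q. \<integral>s. iexp (X q s) \<partial>S)"
    and "(l2 S (\<lambda>s. \<Sum>q<Q. X q s))\<^sup>2 = (\<Sum>q<Q. (l2 S (X q))\<^sup>2)"
proof -
  have e: "bmf S (\<lambda>x. iexp (f x))" if "bmf S f" for f using bmf_iexp[OF that, of 1] by simp
  note I = P.integrable_bmf
  have sb: "bmf S (\<lambda>s. \<Sum>q<Q. X q s)" for Q by (intro bmf_sum X)
  have sd: "dep_below (c Q) (\<lambda>s. \<Sum>q<Q. X q s)" for Q
  proof (rule dep_below_sum)
    fix q assume "q \<in> {..<Q}"
    then have "c (Suc q) \<le> c Q" by (intro monoD[OF mono]) auto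
    then show "dep_below (c Q) (X q)" by (rule dep_below_mono[OF below])
  qed
  show "(\<integral>s. iexp (\<Sum>q<Q. X q s) \<partial>S) = (\<Prod>q<Q. \<integral>s. iexp (X q s) \<partial>S)"
  proof (induction Q)
    case (Suc Q)
    have "(\<integral>s. iexp (\<Sum>q<Suc Q. X q s) \<partial>S) = (\<integral>s. iexp (\<Sum>q<Q. X q s) * iexp (X Q s) \<partial>S)"
      by (simp add: exp_add[symmetric] distrib_left)
    also have "\<dots> = (\<integral>s. iexp (\<Sum>q<Q. X q s) \<partial>S) * (\<integral>s. iexp (X Q s) \<partial>S)"
      by (rule integral_indep[OF e[OF sb] e[OF X] dep_below_fun[OF sd] dep_above_fun[OF above]])
    finally show ?case unfolding Suc.IH by simp
  qed (simp add: P.prob_space)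
  show "(l2 S (\<lambda>s. \<Sum>q<Q. X q s))\<^sup>2 = (\<Sum>q<Q. (l2 S (X q))\<^sup>2)"
  proof (induction Q)
    case (Suc Q)
    let ?Y = "\<lambda>s. \<Sum>q<Q. X q s"
    have "(l2 S (\<lambda>s. \<Sum>q<Suc Q. X q s))\<^sup>2 = (\<integral>s. (?Y s)\<^sup>2 + (2 * (?Y s * X Q s) + (X Q s)\<^sup>2) \<partial>S)"
      unfolding l2_sq by (intro Bochner_Integration.integral_cong) (auto simp: power2_eq_square algebra_simps)
    also have "\<dots> = (l2 S ?Y)\<^sup>2 + (2 * (\<integral>s. ?Y s * X Q s \<partial>S) + (l2 S (X Q))\<^sup>2)"
      unfolding l2_sq
      using I[OF bmf_power[OF sb]] I[OF bmf_power[OF X]] I[OF bmf_mult[OF sb X]] by simp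
    also have "(\<integral>s. ?Y s * X Q s \<partial>S) = (\<integral>s. ?Y s \<partial>S) * (\<integral>s. X Q s \<partial>S)"
      by (rule integral_indep[OF sb X sd above])
    finally show ?case by (simp add: Suc mean)
  qed (simp add: l2_def)
qed

text \<open>Characteristic function and Gaussian target both factorise over the blocks. All factors
  have modulus at most \<open>1\<close>, so the difference of the products is at most the sum of the
  differences.\<close>

lemma clt_blocks:
  fixes Q :: nat
  assumes X: "\<And>q. bmf S (X q)" and mono: "mono c"
    and below: "\<And>q. dep_below (c (Suc q)) (X q)" and above: "\<And>q. dep_above (c q) (X q)"
    and mean: "\<And>q. (\<integral>s. X q s \<partial>S) = 0" and bound: "\<And>q s. \<bar>X q s\<bar> \<le> \<kappa>"
  defines "W \<equiv> (\<lambda>s. \<Sum>q<Q. X q s)"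
  shows "cmod (gauss_gap S W) \<le> (l2 S W)\<^sup>2 * (\<kappa> / 6 + \<kappa>\<^sup>2 / 8)"
proof -
  have B: "(\<integral>s. iexp (W s) \<partial>S) = (\<Prod>q<Q. \<integral>s. iexp (X q s) \<partial>S)"
    "(l2 S W)\<^sup>2 = (\<Sum>q<Q. (l2 S (X q))\<^sup>2)"
    unfolding W_def by (rule block_sums[where X = X and c = c, OF X mono below above mean])+
  let ?g = "\<lambda>q. complex_of_real (exp (- ((l2 S (X q))\<^sup>2) / 2))"
  have "exp (- ((l2 S W)\<^sup>2) / 2) = (\<Prod>q<Q. exp (- ((l2 S (X q))\<^sup>2) / 2))"
    unfolding B(2) by (simp add: exp_sum[symmetric] sum_divide_distrib sum_negf)
  then have g: "complex_of_real (exp (- ((l2 S W)\<^sup>2) / 2)) = (\<Prod>q<Q. ?g q)"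
    by simp
  have "cmod (gauss_gap S W)
    = cmod ((\<Prod>q<Q. \<integral>s. iexp (X q s) \<partial>S) - (\<Prod>q<Q. ?g q))"
    unfolding g B(1) ..
  also have "\<dots> \<le> (\<Sum>q<Q. cmod ((\<integral>s. iexp (X q s) \<partial>S) - ?g q))"
  proof (rule norm_prod_diff)
    fix q
    have e: "bmf S (\<lambda>s. iexp (X q s))" using bmf_iexp[OF X, of 1] by simp
    have "cmod (\<integral>s. iexp (X q s) \<partial>S) \<le> (\<integral>s. 1 \<partial>S)"
      by (rule norm_integral_le) (auto intro!: P.integrable_bmf[OF e])
    then show "cmod (\<integral>s. iexp (X q s) \<partial>S) \<le> 1" by (simp add: P.prob_space)
    show "cmod (?g q) \<le> 1" unfolding norm_of_real by simp
  qed
  also have "\<dots> \<le> (\<Sum>q<Q. (l2 S (X q))\<^sup>2 * (\<kappa> / 6 + \<kappa>\<^sup>2 / 8))"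
    by (rule sum_mono) (rule P.char_bounded_approx[OF X bound mean])
  also have "\<dots> = (l2 S W)\<^sup>2 * (\<kappa> / 6 + \<kappa>\<^sup>2 / 8)"
    by (simp only: B(2) sum_distrib_right)
  finally show ?thesis .
qed

text \<open>The block offset is chosen by averaging, so that the deleted gaps carry at most the proportion
  \<open>m / p\<close> of the total weight \<open>\<Sum>b\<close>.\<close>
lemma clt_m_dependent:
  assumes h: "\<And>i. bmf S (h i)" and dep: "\<And>i. dep_below m (h i)"
    and mean: "\<And>i. (\<integral>s. h i s \<partial>S) = 0" and bound: "\<And>i s. i < n \<Longrightarrow> \<bar>h i s\<bar> \<le> \<eta>" and "0 \<le> \<eta>"
    and b: "\<And>i. 0 \<le> b i" and p: "m < p"
    and norm: "\<And>I. I \<subseteq> {..<n} \<Longrightarrow> l2 S (\<lambda>s. \<Sum>i\<in>I. h i (seq_shift i s)) \<le> C * sqrt (\<Sum>i\<in>I. b i)" and "0 \<le> C"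
  obtains W where "bmf S W"
    "l2 S (\<lambda>s. (\<Sum>i<n. h i (seq_shift i s)) - W s) \<le> C * sqrt (real m / real p * (\<Sum>i<n. b i))"
    "l2 S W \<le> C * sqrt (\<Sum>i<n. b i)"
    "cmod (gauss_gap S W) \<le> (l2 S W)\<^sup>2 * (real p * \<eta> / 6 + (real p * \<eta>)\<^sup>2 / 8)"
proof -
  define gap where "gap k = {i\<in>{..<n}. (i + k) mod p < m}" for k
  have "(\<Sum>k<p. \<Sum>i\<in>gap k. b i) = (\<Sum>k<p. \<Sum>i<n. if (i + k) mod p < m then b i else 0)"
    unfolding gap_def by (intro sum.cong refl sum.inter_filter) auto
  also have "\<dots> = (\<Sum>i<n. \<Sum>k<p. if (i + k) mod p < m then b i else 0)" by (rule sum.swap)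
  also have "\<dots> = (\<Sum>i<n. real m * b i)"
  proof (intro sum.cong refl)
    fix i
    have "(\<Sum>k<p. if (i + k) mod p < m then b i else 0) = (\<Sum>k\<in>{k\<in>{..<p}. (i + k) mod p < m}. b i)"
      by (intro sum.inter_filter[symmetric]) auto
    also have "\<dots> = real m * b i" using card_mod_offset[of m p i] p by simp
    finally show "(\<Sum>k<p. if (i + k) mod p < m then b i else 0) = real m * b i" .
  qed
  finally have tot: "(\<Sum>k<p. \<Sum>i\<in>gap k. b i) = real m * (\<Sum>i<n. b i)" by (simp add: sum_distrib_left)
  have "\<exists>k<p. (\<Sum>i\<in>gap k. b i) \<le> real m / real p * (\<Sum>i<n. b i)"
  proof (rule ccontr)
    assume "\<not> ?thesis"
    then have "(\<Sum>k<p. real m / real p * (\<Sum>i<n. b i)) < (\<Sum>k<p. \<Sum>i\<in>gap k. b i)"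
      using p by (intro sum_strict_mono) (auto simp: not_le)
    then show False using tot p by simp
  qed
  then obtain k where k: "k < p" "(\<Sum>i\<in>gap k. b i) \<le> real m / real p * (\<Sum>i<n. b i)" by blast
  define J where "J = {i\<in>{..<n}. m \<le> (i + k) mod p}"
  define X where "X q s = (\<Sum>i\<in>{i\<in>J. (i + k) div p = q}. h i (seq_shift i s))" for q s
  \<comment> \<open>Kept indices of block \<open>q\<close> start at position \<open>c q\<close>,
    just after the gap. The last of them looks ahead fewer than \<open>m\<close> coordinates, which
    ends inside the following gap, before \<open>c (Suc q)\<close>. Subtraction truncated at
    \<open>0\<close> only affects \<open>q = 0\<close>, where it is harmless.\<close>
  define c where "c q = q * p + m - k" for q
  \<comment> \<open>Every block number is at most \<open>i + k\<close>, hence below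
    \<open>n + p\<close>; the surplus blocks are empty sums.\<close>
  define W where "W s = (\<Sum>q<n+p. X q s)" for s
  have fJ: "finite J" unfolding J_def by simp
  have hs: "bmf S (\<lambda>s. h i (seq_shift i s))" for i by (rule bmf_comp[OF h measurable_seq_shift])
  have W: "W s = (\<Sum>i\<in>J. h i (seq_shift i s))" for s
    unfolding W_def X_def
  proof (rule sum.group[OF fJ])
    have "(i + k) div p < n + p" if "i < n" for i
      using that k(1) by (intro le_less_trans[OF div_le_dividend]) auto
    then show "(\<lambda>i. (i + k) div p) ` J \<subseteq> {..<n + p}" by (auto simp: J_def)
  qed simp
  have X: "bmf S (X q)" for q unfolding X_def[abs_def] by (rule bmf_sum) (rule hs)
  have mn: "mono c" unfolding c_def by (intro monoI diff_le_mono add_right_mono mult_le_mono1)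
  have below: "dep_below (c (Suc q)) (X q)" for q
    unfolding X_def[abs_def]
  proof (intro dep_below_sum dep_below_shift[OF dep])
    fix i assume "i \<in> {i\<in>J. (i + k) div p = q}"
    then have "i + k < Suc q * p" using dividend_less_div_times[of p "i + k"] p by auto
    then show "i + m \<le> c (Suc q)" by (simp add: c_def)
  qed
  have above: "dep_above (c q) (X q)" for q
    unfolding X_def[abs_def]
  proof (intro dep_above_sum dep_above_shift)
    fix i assume "i \<in> {i\<in>J. (i + k) div p = q}"
    then have "q * p + m \<le> i + k" using div_mult_mod_eq[of "i + k" p] by (auto simp: J_def)
    then show "c q \<le> i" by (simp add: c_def)
  qed
  have mh: "(\<integral>s. h i (seq_shift i s) \<partial>S) = 0" for i
    using integral_shift[OF h, of i i] mean[of i] by simp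
  have mX: "(\<integral>s. X q s \<partial>S) = 0" for q
  proof -
    have "(\<integral>s. X q s \<partial>S) = (\<Sum>i\<in>{i\<in>J. (i + k) div p = q}. \<integral>s. h i (seq_shift i s) \<partial>S)"
      unfolding X_def by (rule Bochner_Integration.integral_sum[OF P.integrable_bmf[OF hs]])
    then show ?thesis by (simp only: mh sum.neutral_const)
  qed
  have bX: "\<bar>X q s\<bar> \<le> real p * \<eta>" for q s
  proof -
    let ?I = "{i\<in>J. (i + k) div p = q}"
    have "\<bar>X q s\<bar> \<le> (\<Sum>i\<in>?I. \<bar>h i (seq_shift i s)\<bar>)" unfolding X_def by (rule sum_abs)
    also have "\<dots> \<le> (\<Sum>i\<in>?I. \<eta>)" by (intro sum_mono bound) (auto simp: J_def)
    also have "\<dots> = real (card ?I) * \<eta>" by simp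
    also have "card ?I \<le> card {q * p..<q * p + p}"
    proof (rule card_inj_on_le[where f = "\<lambda>i. i + k"])
      show "(\<lambda>i. i + k) ` ?I \<subseteq> {q * p..<q * p + p}"
      proof
        fix y assume "y \<in> (\<lambda>i. i + k) ` ?I"
        then obtain i where i: "y = i + k" "(i + k) div p = q" by auto
        then have "y < p + q * p" using dividend_less_div_times[of p "i + k"] p by simp
        moreover have "q * p \<le> y" using i by (metis div_times_less_eq_dividend)
        ultimately show "y \<in> {q * p..<q * p + p}" by simp
      qed
    qed auto
    finally show ?thesis using \<open>0 \<le> \<eta>\<close> by (simp add: mult_right_mono)
  qed
  have W': "W = (\<lambda>s. \<Sum>i\<in>J. h i (seq_shift i s))" by (rule ext) (rule W)
  have "bmf S W" unfolding W' by (rule bmf_sum) (rule hs)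
  moreover have "l2 S (\<lambda>s. (\<Sum>i<n. h i (seq_shift i s)) - W s) \<le> C * sqrt (real m / real p * (\<Sum>i<n. b i))"
  proof -
    have "(\<Sum>i<n. h i (seq_shift i s)) - W s = (\<Sum>i\<in>gap k. h i (seq_shift i s))" for s
    proof -
      have un: "{..<n} = J \<union> gap k" and "J \<inter> gap k = {}" "finite (gap k)"
        unfolding J_def gap_def by auto
      then have "(\<Sum>i<n. h i (seq_shift i s)) = W s + (\<Sum>i\<in>gap k. h i (seq_shift i s))"
        unfolding W un using fJ by (intro sum.union_disjoint)
      then show ?thesis by simp
    qed
    then have "l2 S (\<lambda>s. (\<Sum>i<n. h i (seq_shift i s)) - W s) \<le> C * sqrt (\<Sum>i\<in>gap k. b i)"
      using norm[of "gap k"] by (simp add: gap_def subset_iff del: seq_shift_apply)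
    also have "\<dots> \<le> C * sqrt (real m / real p * (\<Sum>i<n. b i))"
      using k(2) \<open>0 \<le> C\<close> by (intro mult_left_mono real_sqrt_le_mono)
    finally show ?thesis .
  qed
  moreover have "l2 S W \<le> C * sqrt (\<Sum>i<n. b i)"
  proof -
    have "l2 S W \<le> C * sqrt (\<Sum>i\<in>J. b i)" unfolding W' by (rule norm) (auto simp: J_def)
    also have "\<dots> \<le> C * sqrt (\<Sum>i<n. b i)"
      using \<open>0 \<le> C\<close> b by (intro mult_left_mono real_sqrt_le_mono sum_mono2) (auto simp: J_def)
    finally show ?thesis .
  qed
  moreover have "cmod (gauss_gap S W) \<le> (l2 S W)\<^sup>2 * (real p * \<eta> / 6 + (real p * \<eta>)\<^sup>2 / 8)"
    unfolding W_def[abs_def] by (rule clt_blocks[where X = X and c = c and Q = "n + p", OF X mn below above mX bX])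
  ultimately show ?thesis using that by blast
qed

end

section \<open>The quantitative limit theorem and its version for arrays\<close>

context sequence_space begin

text \<open>The second bound collects three errors. The term with
  \<open>real p * (L * \<eta>)\<close> is the Taylor error of blocks of at most \<open>p\<close>
  summands, each at most \<open>L * \<eta>\<close>. The tail of \<open>\<rho>\<close> comes from
  truncating the dependence at lag \<open>m\<close>, and \<open>m / p\<close> from deleting the
  gaps; these two are multiplied by the Lipschitz factor of \<open>char_close\<close>. Only
  \<open>n\<close>-free quantities occur, given \<open>A\<close> and \<open>\<eta>\<close>. In the
  application \<open>v l\<close> is the square root of the exceedance probability, and
  \<open>A\<close> expresses that it cancels the normalisation hidden in the weights.\<close>

lemma clt_bound:
  fixes g :: "'l::finite \<Rightarrow> (nat \<Rightarrow> 'a) \<Rightarrow> real" and a :: "'l \<Rightarrow> nat \<Rightarrow> real"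
  assumes g: "\<And>l. bmf S (g l)" and bound: "\<And>l s. \<bar>g l s\<bar> \<le> 1"
    and mean: "\<And>l. (\<integral>s. g l s \<partial>S) = 0"
    and lim: "\<And>l. (\<lambda>K. l2 S (\<lambda>s. g l s - proj K (g l) s)) \<longlonglongrightarrow> 0"
    and rho: "\<And>l k. l2 S (incr k (g l)) \<le> v l * \<rho> k" "summable \<rho>" "\<And>k. 0 \<le> \<rho> k" "\<And>l. 0 \<le> v l"
    and A: "\<And>l. (v l)\<^sup>2 * (\<Sum>i<n. (a l i)\<^sup>2) \<le> A"
  defines "U \<equiv> (\<lambda>s. \<Sum>l\<in>UNIV. \<Sum>i<n. a l i * g l (seq_shift i s))"
    and "L \<equiv> real CARD('l)" and "R \<equiv> \<Sum>k. \<rho> k"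
  shows "l2 S U \<le> L * (sqrt A * R)"
    and "\<lbrakk>\<And>l i. i < n \<Longrightarrow> \<bar>a l i\<bar> \<le> \<eta>; 0 \<le> \<eta>; m < p\<rbrakk> \<Longrightarrow>
      cmod (gauss_gap S U)
      \<le> (L * R * sqrt (L * A))\<^sup>2 * (real p * (L * \<eta>) / 6 + (real p * (L * \<eta>))\<^sup>2 / 8)
        + (L * (sqrt A * (\<Sum>k. \<rho> (k + m))) + L * R * sqrt (real m / real p * (L * A)))
          * (1 + (L * (sqrt A * R) + L * R * sqrt (L * A)) / 2)"
proof -
  let ?d = "\<lambda>m l s. \<Sum>i<n. a l i * (g l (seq_shift i s) - proj m (g l) (seq_shift i s))"
    and ?e = "\<lambda>m I l s. \<Sum>i\<in>I. a l i * (proj m (g l) (seq_shift i s) - proj 0 (g l) (seq_shift i s))"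
  let ?b1 = "\<lambda>p \<eta>. (L * R * sqrt (L * A))\<^sup>2 * (real p * (L * \<eta>) / 6 + (real p * (L * \<eta>))\<^sup>2 / 8)"
    and ?b2 = "\<lambda>m p. (L * (sqrt A * (\<Sum>k. \<rho> (k + m))) + L * R * sqrt (real m / real p * (L * A)))
          * (1 + (L * (sqrt A * R) + L * R * sqrt (L * A)) / 2)"
  have gs: "bmf S (\<lambda>s. g l (seq_shift i s))" for l i by (rule bmf_comp[OF g measurable_seq_shift])
  have ps: "bmf S (\<lambda>s. proj m (g l) (seq_shift i s))" for l i m by (rule bmf_comp[OF bmf_proj[OF g] measurable_seq_shift])
  \<comment> \<open>By centring, truncation at lag \<open>0\<close> leaves nothing. Hence
    \<open>part\<close> at \<open>0\<close> already bounds the full sum, and partial sums of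
    truncated terms can be written as differences of two projections.\<close>
  have p0: "proj 0 (g l) s = 0" for l s by (simp add: proj_0 mean)
  have L: "0 \<le> L" unfolding L_def by simp
  have R: "0 \<le> R" unfolding R_def by (intro suminf_nonneg rho)
  have part: "l2 S (\<lambda>s. \<Sum>l\<in>UNIV. ?d m l s)
    \<le> L * (sqrt A * (\<Sum>k. \<rho> (k + m)))" for m
  proof -
    have t: "0 \<le> (\<Sum>k. \<rho> (k + m))"
      using rho by (intro suminf_nonneg) (auto simp: summable_iff_shift)
    have "l2 S (\<lambda>s. \<Sum>l\<in>UNIV. ?d m l s)
      \<le> (\<Sum>l\<in>UNIV. l2 S (\<lambda>s. ?d m l s))"
      by (intro P.l2_sum bmf_sum bmf_mult bmf_const bmf_diff gs ps)
    also have "\<dots> \<le> (\<Sum>l\<in>(UNIV::'l set). sqrt A * (\<Sum>k. \<rho> (k + m)))"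
    proof (rule sum_mono)
      fix l
      have "l2 S (\<lambda>s. ?d m l s)
        \<le> sqrt (\<Sum>i<n. (a l i)\<^sup>2) * (v l * (\<Sum>k. \<rho> (k + m)))"
        by (rule l2_tail_sum[OF g _ lim rho(1,2,4,3)]) simp
      also have "\<dots> = sqrt ((v l)\<^sup>2 * (\<Sum>i<n. (a l i)\<^sup>2)) * (\<Sum>k. \<rho> (k + m))"
        using rho(4)[of l] by (simp add: real_sqrt_mult)
      also have "\<dots> \<le> sqrt A * (\<Sum>k. \<rho> (k + m))"
        by (intro mult_right_mono real_sqrt_le_mono A t)
      finally show "l2 S (\<lambda>s. ?d m l s)
        \<le> sqrt A * (\<Sum>k. \<rho> (k + m))" .
    qed
    also have "\<dots> = L * (sqrt A * (\<Sum>k. \<rho> (k + m)))" by (simp add: L_def)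
    finally show ?thesis .
  qed
  show lU: "l2 S U \<le> L * (sqrt A * R)"
    using part[of 0] by (simp add: p0 U_def R_def del: seq_shift_apply)
  assume \<eta>: "\<And>l i. i < n \<Longrightarrow> \<bar>a l i\<bar> \<le> \<eta>" "0 \<le> \<eta>" and "m < p"
  define h where "h i s = (\<Sum>l\<in>UNIV. a l i * proj m (g l) s)" for i s
  \<comment> \<open>One weight per time, dominating that of every component \<open>l\<close>, lets a
    single square root control the truncated sum over any index set, as the choice of the gaps
    demands.\<close>
  define b where "b i = (\<Sum>l\<in>UNIV. (v l)\<^sup>2 * (a l i)\<^sup>2)" for i
  have b0: "0 \<le> b i" for i unfolding b_def by (intro sum_nonneg) simp
  have bA: "(\<Sum>i<n. b i) \<le> L * A"
  proof -
    have "(\<Sum>i<n. b i) = (\<Sum>l\<in>UNIV. (v l)\<^sup>2 * (\<Sum>i<n. (a l i)\<^sup>2))"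
      unfolding b_def by (subst sum.swap) (simp add: sum_distrib_left)
    also have "\<dots> \<le> (\<Sum>l\<in>(UNIV::'l set). A)" by (intro sum_mono A)
    finally show ?thesis by (simp add: L_def)
  qed
  have norm: "l2 S (\<lambda>s. \<Sum>i\<in>I. h i (seq_shift i s)) \<le> L * R * sqrt (\<Sum>i\<in>I. b i)" if I: "I \<subseteq> {..<n}" for I
  proof -
    have fI: "finite I" using I by (rule finite_subset) simp
    have "l2 S (\<lambda>s. \<Sum>i\<in>I. h i (seq_shift i s))
      = l2 S (\<lambda>s. \<Sum>l\<in>UNIV. ?e m I l s)"
      unfolding h_def p0 by (subst sum.swap) simp
    also have "\<dots> \<le> (\<Sum>l\<in>UNIV. l2 S (\<lambda>s. ?e m I l s))"
      by (intro P.l2_sum bmf_sum bmf_mult bmf_const bmf_diff ps)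
    also have "\<dots> \<le> (\<Sum>l\<in>(UNIV::'l set). R * sqrt (\<Sum>i\<in>I. b i))"
    proof (rule sum_mono)
      fix l
      have "l2 S (\<lambda>s. ?e m I l s)
        \<le> sqrt (\<Sum>i\<in>I. (a l i)\<^sup>2) * (\<Sum>k=0..<m. l2 S (incr k (g l)))"
        by (rule l2_proj_sum[OF g fI]) simp
      also have "(\<Sum>k=0..<m. l2 S (incr k (g l))) \<le> (\<Sum>k=0..<m. v l * \<rho> k)"
        by (intro sum_mono rho)
      also have "\<dots> = v l * (\<Sum>k<m. \<rho> k)" by (simp add: sum_distrib_left atLeast0LessThan)
      also have "(\<Sum>k<m. \<rho> k) \<le> R" unfolding R_def by (intro sum_le_suminf rho) auto
      also have "sqrt (\<Sum>i\<in>I. (a l i)\<^sup>2) * (v l * R) = R * sqrt (\<Sum>i\<in>I. (v l)\<^sup>2 * (a l i)\<^sup>2)"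
        using rho(4)[of l] by (simp add: real_sqrt_mult flip: sum_distrib_left)
      also have "\<dots> \<le> R * sqrt (\<Sum>i\<in>I. b i)"
      proof (intro mult_left_mono real_sqrt_le_mono sum_mono R)
        fix i show "(v l)\<^sup>2 * (a l i)\<^sup>2 \<le> b i"
          unfolding b_def by (rule member_le_sum[of l UNIV "\<lambda>l. (v l)\<^sup>2 * (a l i)\<^sup>2"]) auto
      qed
      finally show "l2 S (\<lambda>s. ?e m I l s)
        \<le> R * sqrt (\<Sum>i\<in>I. b i)"
        using rho(4)[of l] by (simp add: mult_left_mono sum_nonneg del: seq_shift_apply)
    qed
    also have "\<dots> = L * R * sqrt (\<Sum>i\<in>I. b i)" by (simp add: L_def)
    finally show ?thesis .
  qed
  have bh: "bmf S (h i)" for i unfolding h_def[abs_def] by (intro bmf_sum bmf_mult bmf_const bmf_proj g)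
  have dh: "dep_below m (h i)" for i
    unfolding h_def[abs_def] dep_below_def
    by (intro allI impI sum.cong refl arg_cong[where f = "(*) _"] dep_belowD[OF dep_below_proj]) auto
  have mh: "(\<integral>s. h i s \<partial>S) = 0" for i
    unfolding h_def
    by (subst Bochner_Integration.integral_sum)
      (auto intro!: P.integrable_bmf[OF bmf_proj[OF g]] simp: integral_proj[OF g] mean)
  have hb: "\<bar>h i s\<bar> \<le> L * \<eta>" if "i < n" for i s
  proof -
    have "\<bar>h i s\<bar> \<le> (\<Sum>l\<in>UNIV. \<bar>a l i * proj m (g l) s\<bar>)" unfolding h_def by (rule sum_abs)
    also have "\<dots> \<le> (\<Sum>l\<in>(UNIV::'l set). \<eta>)"
    proof (rule sum_mono)
      fix l
      have "\<bar>proj m (g l) s\<bar> \<le> 1" using proj_bound[OF g, of l 1 m s] bound by simp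
      then have "\<bar>a l i\<bar> * \<bar>proj m (g l) s\<bar> \<le> \<eta> * 1"
        by (intro mult_mono \<eta> that) (auto intro: \<eta>)
      then show "\<bar>a l i * proj m (g l) s\<bar> \<le> \<eta>" by (simp add: abs_mult)
    qed
    finally show ?thesis by (simp add: L_def)
  qed
  let ?V = "\<lambda>s. \<Sum>i<n. h i (seq_shift i s)"
  obtain W where W: "bmf S W"
    "l2 S (\<lambda>s. ?V s - W s) \<le> L * R * sqrt (real m / real p * (\<Sum>i<n. b i))"
    "l2 S W \<le> L * R * sqrt (\<Sum>i<n. b i)"
    "cmod (gauss_gap S W) \<le> (l2 S W)\<^sup>2 * (real p * (L * \<eta>) / 6 + (real p * (L * \<eta>))\<^sup>2 / 8)"
    by (rule clt_m_dependent[of h m n "L * \<eta>" b p "L * R", OF bh dh mh hb _ b0 \<open>m < p\<close> norm])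
      (auto intro!: mult_nonneg_nonneg L R \<eta> simp del: seq_shift_apply)
  have LR: "0 \<le> L * R" using L R by simp
  have bU: "bmf S U" unfolding U_def by (intro bmf_sum bmf_mult bmf_const gs)
  have bV: "bmf S ?V" by (intro bmf_sum bmf_comp[OF bh measurable_seq_shift])
  have lW: "l2 S W \<le> L * R * sqrt (L * A)"
    by (rule order_trans[OF W(3)]) (intro mult_left_mono real_sqrt_le_mono bA LR)
  have d: "l2 S (\<lambda>s. U s - W s) \<le> L * (sqrt A * (\<Sum>k. \<rho> (k + m))) + L * R * sqrt (real m / real p * (L * A))"
  proof -
    have UV: "U s - ?V s = (\<Sum>l\<in>UNIV. ?d m l s)" for s
    proof -
      have "?V s = (\<Sum>l\<in>UNIV. \<Sum>i<n. a l i * proj m (g l) (seq_shift i s))"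
        unfolding h_def by (rule sum.swap)
      then show ?thesis unfolding U_def by (simp add: sum_subtractf right_diff_distrib del: seq_shift_apply)
    qed
    have "l2 S (\<lambda>s. U s - W s) = l2 S (\<lambda>s. (U s - ?V s) + (?V s - W s))" by simp
    also have "\<dots> \<le> l2 S (\<lambda>s. U s - ?V s) + l2 S (\<lambda>s. ?V s - W s)"
      by (intro P.l2_triangle bmf_diff bU bV W(1))
    also have "l2 S (\<lambda>s. U s - ?V s) \<le> L * (sqrt A * (\<Sum>k. \<rho> (k + m)))"
      unfolding UV by (rule part)
    also have "l2 S (\<lambda>s. ?V s - W s) \<le> L * R * sqrt (real m / real p * (L * A))"
      by (rule order_trans[OF W(2)]) (intro mult_left_mono real_sqrt_le_mono bA LR, simp)
    finally show ?thesis by simp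
  qed
  have "cmod (gauss_gap S U)
    \<le> cmod (gauss_gap S W)
      + l2 S (\<lambda>s. U s - W s) * (1 + (l2 S U + l2 S W) / 2)"
    by (rule P.char_close[OF bU W(1)])
  also have "\<dots> \<le> ?b1 p \<eta>
    + ?b2 m p"
  proof (rule add_mono)
    show "cmod (gauss_gap S W)
      \<le> ?b1 p \<eta>"
      using L \<eta>(2) by (intro order_trans[OF W(4)] mult_right_mono power_mono lW) auto
    show "l2 S (\<lambda>s. U s - W s) * (1 + (l2 S U + l2 S W) / 2)
      \<le> ?b2 m p"
      using d lU lW by (intro mult_mono) (auto intro: order_trans[OF l2_nonneg])
  qed
  finally show "cmod (gauss_gap S U)
      \<le> ?b1 p \<eta>
        + ?b2 m p" .
qed

text \<open>The parameters are fixed in the order \<open>m\<close>, \<open>p\<close>,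
  \<open>\<eta>\<close>: first the dependence tail is made small, then the proportion of gaps for
  that \<open>m\<close>, then the summands relative to the block length \<open>p\<close>. Only
  afterwards is \<open>n\<close> taken large. The factor \<open>D\<close> depends on none of
  them.\<close>

lemma clt_array:
  fixes g :: "nat \<Rightarrow> 'l::finite \<Rightarrow> (nat \<Rightarrow> 'a) \<Rightarrow> real" and a :: "nat \<Rightarrow> 'l \<Rightarrow> nat \<Rightarrow> real"
  assumes g: "\<And>n l. bmf S (g n l)" and bound: "\<And>n l s. \<bar>g n l s\<bar> \<le> 1"
    and mean: "\<forall>\<^sub>F n in sequentially. \<forall>l. (\<integral>s. g n l s \<partial>S) = 0"
    and lim: "\<And>n l. (\<lambda>K. l2 S (\<lambda>s. g n l s - proj K (g n l) s)) \<longlonglongrightarrow> 0"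
    and rho: "\<forall>\<^sub>F n in sequentially. \<forall>l k. l2 S (incr k (g n l)) \<le> v n l * \<rho> k"
    and \<rho>: "summable \<rho>" "\<And>k. 0 \<le> \<rho> k" and v: "\<And>n l. 0 \<le> v n l"
    and A: "\<forall>\<^sub>F n in sequentially. \<forall>l. (v n l)\<^sup>2 * (\<Sum>i<n. (a n l i)\<^sup>2) \<le> A"
    and small: "\<And>\<eta>. 0 < \<eta> \<Longrightarrow> \<forall>\<^sub>F n in sequentially. \<forall>l. \<forall>i<n. \<bar>a n l i\<bar> \<le> \<eta>"
  defines "U \<equiv> (\<lambda>n s. \<Sum>l\<in>UNIV. \<Sum>i<n. a n l i * g n l (seq_shift i s))"
  shows "(\<lambda>n. gauss_gap S (U n)) \<longlonglongrightarrow> 0"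
proof (rule tendstoI)
  fix e :: real assume e: "0 < e"
  define L where "L = real CARD('l)"
  define R where "R = (\<Sum>k. \<rho> k)"
  define D where "D = 1 + (L * (sqrt A * R) + L * R * sqrt (L * A)) / 2"
  have "(\<lambda>m. R - (\<Sum>k<m. \<rho> k)) \<longlonglongrightarrow> R - R"
    unfolding R_def by (intro tendsto_intros summable_LIMSEQ \<rho>)
  then have tail: "(\<lambda>m. \<Sum>k. \<rho> (k + m)) \<longlonglongrightarrow> 0"
    by (simp add: R_def suminf_minus_initial_segment[OF \<rho>(1)])
  have "(\<lambda>m. L * (sqrt A * (\<Sum>k. \<rho> (k + m))) * D) \<longlonglongrightarrow> L * (sqrt A * 0) * D"
    by (intro tendsto_intros tail)
  then have "\<forall>\<^sub>F m in sequentially. L * (sqrt A * (\<Sum>k. \<rho> (k + m))) * D < e / 3"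
    using e by (intro order_tendstoD) auto
  then obtain m where m: "L * (sqrt A * (\<Sum>k. \<rho> (k + m))) * D < e / 3"
    by (auto simp: eventually_sequentially)
  have "(\<lambda>p. L * R * sqrt (real m / real p * (L * A)) * D) \<longlonglongrightarrow> L * R * sqrt (0 * (L * A)) * D"
    by (intro tendsto_intros lim_const_over_n)
  then have "\<forall>\<^sub>F p in sequentially. L * R * sqrt (real m / real p * (L * A)) * D < e / 3"
    using e by (intro order_tendstoD) auto
  then have "\<forall>\<^sub>F p in sequentially. m < p \<and> L * R * sqrt (real m / real p * (L * A)) * D < e / 3"
    by (intro eventually_conj eventually_gt_at_top)
  then obtain p where p: "m < p" "L * R * sqrt (real m / real p * (L * A)) * D < e / 3"
    by (auto simp: eventually_sequentially)
  let ?F = "\<lambda>\<eta>. (L * R * sqrt (L * A))\<^sup>2 * (real p * (L * \<eta>) / 6 + (real p * (L * \<eta>))\<^sup>2 / 8)"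
  have "(?F \<longlongrightarrow> (L * R * sqrt (L * A))\<^sup>2 * (real p * (L * 0) / 6 + (real p * (L * 0))\<^sup>2 / 8)) (at_right 0)"
    by (intro tendsto_intros) auto
  then have "\<forall>\<^sub>F \<eta> in at_right 0. ?F \<eta> < e / 3"
    using e by (intro order_tendstoD) auto
  then have "\<forall>\<^sub>F \<eta> in at_right (0::real). 0 < \<eta> \<and> ?F \<eta> < e / 3"
    by (intro eventually_conj eventually_at_right_less)
  then obtain \<eta> where \<eta>: "0 < \<eta>" "?F \<eta> < e / 3"
    using eventually_happens'[OF trivial_limit_at_right_real] by blast
  show "\<forall>\<^sub>F n in sequentially. dist (gauss_gap S (U n)) 0 < e"
    using mean rho A small[OF \<eta>(1)]
  proof eventually_elim
    case (elim n)
    have "cmod (gauss_gap S (U n))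
      \<le> ?F \<eta> + (L * (sqrt A * (\<Sum>k. \<rho> (k + m))) + L * R * sqrt (real m / real p * (L * A))) * D"
      unfolding U_def L_def R_def D_def
      by (rule clt_bound(2)[where v = "v n" and \<rho> = \<rho>, OF g bound _ lim _ \<rho> v])
        (use elim \<eta>(1) p(1) in auto)
    also have "\<dots> < e" using m p(2) \<eta>(2) unfolding distrib_right[of _ _ D] by linarith
    finally show ?case by simp
  qed
qed

end

section \<open>Characteristic functions and weak convergence in several dimensions\<close>

text \<open>\<open>lborel\<close> is the image of a product measure over \<open>Basis\<close>, which
  reduces the multivariate normal density and its characteristic function to one dimension.\<close>

lemma lborel_integral_prod:
  fixes h :: "'a::euclidean_space \<Rightarrow> real \<Rightarrow> 'b::{real_normed_field,banach,second_countable_topology}"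
  assumes h: "\<And>b. b \<in> Basis \<Longrightarrow> integrable lborel (h b)"
  shows "integrable lborel (\<lambda>x. \<Prod>b\<in>Basis. h b (x \<bullet> b))"
    and "(\<integral>x. (\<Prod>b\<in>Basis. h b (x \<bullet> b)) \<partial>lborel) = (\<Prod>b\<in>Basis. \<integral>x. h b x \<partial>lborel)"
proof -
  interpret product_sigma_finite "\<lambda>_::'a. lborel :: real measure" ..
  let ?T = "\<lambda>f::'a \<Rightarrow> real. \<Sum>b\<in>Basis. f b *\<^sub>R b"
  let ?P = "\<Pi>\<^sub>M b\<in>(Basis :: 'a set). (lborel :: real measure)"
  have T [measurable]: "?T \<in> measurable ?P borel" by measurable
  have ip: "?T f \<bullet> b = f b" if "b \<in> Basis" for f b
    using that by (simp add: inner_sum_left inner_Basis if_distrib[of "\<lambda>x. _ * x"] cong: if_cong)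
  have hm [measurable]: "h b \<in> borel_measurable borel" if "b \<in> Basis" for b
    using borel_measurable_integrable[OF h[OF that]] by simp
  have m: "(\<lambda>x::'a. \<Prod>b\<in>Basis. h b (x \<bullet> b)) \<in> borel_measurable borel"
    by (rule borel_measurable_prod) (auto intro!: measurable_compose[OF _ hm])
  have eq: "(\<lambda>f. \<Prod>b\<in>Basis. h b (?T f \<bullet> b)) = (\<lambda>f. \<Prod>b\<in>Basis. h b (f b))"
    by (intro ext prod.cong refl) (simp add: ip)
  have "integrable ?P (\<lambda>f. \<Prod>b\<in>Basis. h b (f b))"
    by (rule product_integrable_prod) (use h in auto)
  then show "integrable lborel (\<lambda>x. \<Prod>b\<in>Basis. h b (x \<bullet> b))"
    by (subst lborel_eq, subst integrable_distr_eq[OF T m]) (simp only: eq)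
  have "(\<integral>x. (\<Prod>b\<in>Basis. h b (x \<bullet> b)) \<partial>lborel) = (\<integral>f. (\<Prod>b\<in>Basis. h b (f b)) \<partial>?P)"
    by (subst lborel_eq, subst integral_distr[OF T m]) (simp only: eq)
  also have "\<dots> = (\<Prod>b\<in>Basis. \<integral>x. h b x \<partial>lborel)"
    by (rule product_integral_prod) (use h in auto)
  finally show "(\<integral>x. (\<Prod>b\<in>Basis. h b (x \<bullet> b)) \<partial>lborel) = (\<Prod>b\<in>Basis. \<integral>x. h b x \<partial>lborel)" .
qed

lemma norm_sq_Basis: "(norm (x::'a::euclidean_space))\<^sup>2 = (\<Sum>b\<in>Basis. (x \<bullet> b)\<^sup>2)"
  unfolding power2_norm_eq_inner euclidean_inner[of x x] by (simp add: power2_eq_square)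

lemma std_normal_density_prod:
  fixes x :: "'a::euclidean_space"
  shows "(2 * pi) powr (- real DIM('a) / 2) * exp (- (norm x)\<^sup>2 / 2) = (\<Prod>b\<in>Basis. std_normal_density (x \<bullet> b))"
proof -
  have "(\<Prod>b\<in>(Basis::'a set). std_normal_density (x \<bullet> b)) = (1 / sqrt (2 * pi)) ^ DIM('a) * exp (\<Sum>b\<in>Basis. - (x \<bullet> b)\<^sup>2 / 2)"
    unfolding std_normal_density_def prod.distrib exp_sum[OF finite_Basis] prod_constant ..
  also have "(\<Sum>b\<in>Basis. - (x \<bullet> b)\<^sup>2 / 2) = - (norm x)\<^sup>2 / 2"
    by (simp add: norm_sq_Basis sum_divide_distrib[symmetric] sum_negf)
  also have "(1 / sqrt (2 * pi)) ^ DIM('a) = (2 * pi) powr (- real DIM('a) / 2)"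
  proof -
    have "1 / sqrt (2 * pi) = (2 * pi) powr (- 1 / 2)"
      by (simp add: powr_minus powr_half_sqrt inverse_eq_divide)
    then have "(1 / sqrt (2 * pi)) ^ DIM('a) = ((2 * pi) powr (- 1 / 2)) powr (real DIM('a))"
      by (simp add: powr_realpow)
    then show ?thesis by (simp add: powr_powr)
  qed
  finally show ?thesis by simp
qed

lemma char_std_normal_1d:
  "integrable lborel (\<lambda>x. std_normal_density x *\<^sub>R iexp (t * x))"
  "(\<integral>x. std_normal_density x *\<^sub>R iexp (t * x) \<partial>lborel) = exp (- (t\<^sup>2) / 2)"
proof -
  interpret prob_space std_normal_distribution by (rule prob_space_normal_density) simp
  have "integrable std_normal_distribution (\<lambda>x. iexp (t * x))"
    by (rule integrable_const_bound[of _ 1]) auto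
  then show "integrable lborel (\<lambda>x. std_normal_density x *\<^sub>R iexp (t * x))"
    by (subst (asm) integrable_density) auto
  have "char std_normal_distribution t = (\<integral>x. std_normal_density x *\<^sub>R iexp (t * x) \<partial>lborel)"
    unfolding char_def by (subst integral_density) auto
  then show "(\<integral>x. std_normal_density x *\<^sub>R iexp (t * x) \<partial>lborel) = exp (- (t\<^sup>2) / 2)"
    by (simp add: char_std_normal_distribution)
qed

abbreviation gauss_const :: "'m::finite itself \<Rightarrow> real" where
  "gauss_const _ \<equiv> (2 * pi) powr (- real CARD('m) / 2)"

lemma std_normal_vec_density_prod:
  fixes x :: "real^'m"
  shows "gauss_const TYPE('m) * exp (- (norm x)\<^sup>2 / 2) = (\<Prod>b\<in>Basis. std_normal_density (x \<bullet> b))"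
  using std_normal_density_prod[of x] by simp

lemma sets_std_normal_vec [simp, measurable_cong]: "sets std_normal_vec = sets borel"
  and space_std_normal_vec [simp]: "space std_normal_vec = UNIV"
  by (simp_all add: std_normal_vec_def)

lemma integral_std_normal_vec:
  fixes h :: "real^'m \<Rightarrow> 'b::{banach,second_countable_topology}"
  assumes "h \<in> borel_measurable borel"
  shows "(\<integral>x. h x \<partial>std_normal_vec) =
    (\<integral>x. (gauss_const TYPE('m) * exp (- (norm x)\<^sup>2 / 2)) *\<^sub>R h x \<partial>lborel)"
  unfolding std_normal_vec_def using assms by (subst integral_density) auto

lemma prob_space_std_normal_vec: "prob_space (std_normal_vec :: (real^'m) measure)"
proof
  have i: "integrable lborel std_normal_density" "(\<integral>x. std_normal_density x \<partial>lborel) = 1"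
    using integrable_normal_density[of 1 0] integral_normal_density[of 1 0] by simp_all
  have "(\<integral>\<^sup>+x. ennreal (gauss_const TYPE('m) * exp (- (norm x)\<^sup>2 / 2)) \<partial>(lborel :: (real^'m) measure)) =
    ennreal (\<integral>x. gauss_const TYPE('m) * exp (- (norm x)\<^sup>2 / 2) \<partial>(lborel :: (real^'m) measure))"
    unfolding std_normal_vec_density_prod
    by (intro nn_integral_eq_integral lborel_integral_prod(1) i AE_I2 prod_nonneg) simp
  also have "(\<integral>x. gauss_const TYPE('m) * exp (- (norm x)\<^sup>2 / 2) \<partial>(lborel :: (real^'m) measure)) = 1"
    unfolding std_normal_vec_density_prod lborel_integral_prod(2)[OF i(1)] i(2) by simp
  finally show "emeasure (std_normal_vec :: (real^'m) measure) (space std_normal_vec) = 1"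
    unfolding std_normal_vec_def by (simp add: emeasure_density)
qed

lemma char_std_normal_vec:
  "(\<integral>x. iexp (v \<bullet> x) \<partial>(std_normal_vec :: (real^'m) measure)) = exp (- (norm v)\<^sup>2 / 2)"
proof -
  have m: "(\<lambda>x. iexp (v \<bullet> x)) \<in> borel_measurable borel" by measurable
  have "(\<integral>x. iexp (v \<bullet> x) \<partial>(std_normal_vec :: (real^'m) measure))
    = (\<integral>x. (\<Prod>b\<in>Basis. std_normal_density (x \<bullet> b)) *\<^sub>R iexp (v \<bullet> x) \<partial>lborel)"
    unfolding integral_std_normal_vec[OF m] std_normal_vec_density_prod ..
  also have "\<dots> = (\<integral>x. (\<Prod>b\<in>Basis. std_normal_density (x \<bullet> b) *\<^sub>R iexp ((v \<bullet> b) * (x \<bullet> b))) \<partial>lborel)"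
  proof (intro Bochner_Integration.integral_cong refl)
    fix x :: "real^'m"
    have "iexp (v \<bullet> x) = (\<Prod>b\<in>Basis. iexp ((v \<bullet> b) * (x \<bullet> b)))"
      by (simp add: euclidean_inner[of v x] sum_distrib_left exp_sum)
    then show "(\<Prod>b\<in>Basis. std_normal_density (x \<bullet> b)) *\<^sub>R iexp (v \<bullet> x)
      = (\<Prod>b\<in>Basis. std_normal_density (x \<bullet> b) *\<^sub>R iexp ((v \<bullet> b) * (x \<bullet> b)))"
      by (simp add: scaleR_conv_of_real prod.distrib)
  qed
  also have "\<dots> = (\<Prod>b\<in>Basis. \<integral>y. std_normal_density y *\<^sub>R iexp ((v \<bullet> b) * y) \<partial>lborel)"
    by (rule lborel_integral_prod(2)) (rule char_std_normal_1d(1))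
  also have "\<dots> = (\<Prod>b\<in>Basis. complex_of_real (exp (- ((v \<bullet> b)\<^sup>2) / 2)))"
    by (simp only: char_std_normal_1d(2))
  also have "\<dots> = complex_of_real (exp (\<Sum>b\<in>Basis. - ((v \<bullet> b)\<^sup>2) / 2))"
    by (simp add: exp_sum)
  also have "(\<Sum>b\<in>Basis. - ((v \<bullet> b)\<^sup>2) / 2) = - (norm v)\<^sup>2 / 2"
    by (simp add: norm_sq_Basis sum_divide_distrib[symmetric] sum_negf)
  finally show ?thesis .
qed

section \<open>Gaussian smoothing and the continuity theorem\<close>

lemma bmf_Fubini:
  fixes f :: "'a \<Rightarrow> 'b \<Rightarrow> 'c::{banach,second_countable_topology}"
  assumes "finite_measure M" "finite_measure N"
    and f: "(\<lambda>(x, y). f x y) \<in> borel_measurable (M \<Otimes>\<^sub>M N)" "\<And>x y. norm (f x y) \<le> B"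
  shows "(\<integral>y. (\<integral>x. f x y \<partial>M) \<partial>N) = (\<integral>x. (\<integral>y. f x y \<partial>N) \<partial>M)"
proof -
  interpret M: finite_measure M by fact
  interpret N: finite_measure N by fact
  interpret pair_sigma_finite M N ..
  have "integrable (M \<Otimes>\<^sub>M N) (\<lambda>(x, y). f x y)"
    using f by (intro bmf_integrable finite_measure_pair_measure assms bmfI[of _ _ B]) auto
  then show ?thesis by (rule Fubini_integral)
qed

lemma lborel_integral_affine:
  fixes g :: "'a::euclidean_space \<Rightarrow> 'b::{banach,second_countable_topology}"
  assumes [measurable]: "g \<in> borel_measurable borel" and "c \<noteq> 0"
  shows "(\<integral>y. g y \<partial>lborel) = \<bar>c\<bar> ^ DIM('a) *\<^sub>R (\<integral>x. g (t + c *\<^sub>R x) \<partial>lborel)"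
  by (subst lborel_affine[OF \<open>c \<noteq> 0\<close>, of t], subst integral_density)
    (auto simp: integral_distr)

lemma tight_vec:
  assumes "prob_space \<mu>" "sets \<mu> = sets (borel :: (real^'m) measure)"
  shows "(\<lambda>k::nat. measure \<mu> {x. real k < norm x}) \<longlonglongrightarrow> 0"
proof -
  interpret prob_space \<mu> by fact
  have [measurable_cong]: "sets \<mu> = sets borel" by fact
  have sp: "space \<mu> = UNIV" using sets_eq_imp_space_eq[OF assms(2)] by simp
  have "{x. real k < norm x} \<in> sets \<mu>" for k
  proof -
    have "{x \<in> space \<mu>. real k < norm x} \<in> sets \<mu>" by measurable
    then show ?thesis using sp by simp
  qed
  then have "(\<lambda>k::nat. measure \<mu> {x. real k < norm x}) \<longlonglongrightarrow> measure \<mu> (\<Inter>k. {x. real k < norm x})"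
    by (intro finite_Lim_measure_decseq) (auto simp: decseq_def)
  also have "(\<Inter>k. {x::real^'m. real k < norm x}) = {}"
    by (auto intro: less_asym reals_Archimedean2) (metis less_asym reals_Archimedean2)
  finally show ?thesis by simp
qed

text \<open>Outside an event of small Gaussian probability the displacement stays below the modulus
  of uniform continuity of \<open>f\<close>; on that event boundedness suffices.\<close>

lemma smoothing_close:
  fixes f :: "real^'m \<Rightarrow> real"
  assumes unif: "uniformly_continuous_on UNIV f" and B: "\<And>x. \<bar>f x\<bar> \<le> B" and e: "0 < e"
  shows "\<exists>\<sigma>>0. \<forall>x. \<bar>(\<integral>u. f (x + \<sigma> *\<^sub>R u) \<partial>std_normal_vec) - f x\<bar> \<le> e"
proof -
  interpret N: prob_space "std_normal_vec :: (real^'m) measure" by (rule prob_space_std_normal_vec)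
  have [measurable]: "f \<in> borel_measurable borel"
    by (intro borel_measurable_continuous_onI uniformly_continuous_imp_continuous unif)
  have B0: "0 \<le> B" using B[of 0] by linarith
  obtain d where d: "0 < d" "\<And>x y. dist y x < d \<Longrightarrow> dist (f y) (f x) < e / 2"
    using unif e unfolding uniformly_continuous_on_def by (metis UNIV_I half_gt_zero)
  \<comment> \<open>The exceptional event costs \<open>2 * B\<close> times its probability, hence at
    most \<open>e / 2\<close>; \<open>B + 1\<close> avoids dividing by zero.\<close>
  have "0 < e / (4 * (B + 1))" using e B0 by simp
  from order_tendstoD(2)[OF tight_vec[OF prob_space_std_normal_vec sets_std_normal_vec] this]
  obtain k0 :: nat where k0: "\<And>k. k0 \<le> k \<Longrightarrow> measure (std_normal_vec :: (real^'m) measure) {x. real k < norm x} < e / (4 * (B + 1))"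
    by (auto simp: eventually_sequentially)
  define k where "k = Suc k0"
  \<comment> \<open>For \<open>norm u \<le> k\<close> the displacement is at most
    \<open>d / 2\<close>, hence strictly below \<open>d\<close>.\<close>
  define \<sigma> where "\<sigma> = d / (2 * real k)"
  have k: "0 < real k" "measure (std_normal_vec :: (real^'m) measure) {x. real k < norm x} < e / (4 * (B + 1))"
    using k0[of k] by (auto simp: k_def)
  have \<sigma>: "0 < \<sigma>" using d(1) k(1) by (simp add: \<sigma>_def)
  let ?I = "indicator {u::real^'m. real k < norm u} :: _ \<Rightarrow> real"
  have [measurable]: "{u::real^'m. real k < norm u} \<in> sets borel" by measurable
  have "\<bar>(\<integral>u. f (x + \<sigma> *\<^sub>R u) \<partial>std_normal_vec) - f x\<bar> \<le> e" for x
  proof -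
    have bf: "bmf std_normal_vec (\<lambda>u. f (x + \<sigma> *\<^sub>R u))" by (rule bmfI[of _ _ B]) (use B in auto)
    have bI: "bmf std_normal_vec ?I" by (rule bmf_indicator) simp
    note I = N.integrable_bmf
    have "(\<integral>u. f (x + \<sigma> *\<^sub>R u) \<partial>std_normal_vec) - f x = (\<integral>u. f (x + \<sigma> *\<^sub>R u) - f x \<partial>std_normal_vec)"
      using I[OF bf] N.prob_space by simp
    also have "norm \<dots> \<le> (\<integral>u. e / 2 + 2 * B * ?I u \<partial>std_normal_vec)"
    proof (rule norm_integral_le[OF I[OF bmf_diff[OF bf bmf_const]] I[OF bmf_add[OF bmf_const bmf_mult[OF bmf_const bI]]]])
      fix u :: "real^'m"
      show "norm (f (x + \<sigma> *\<^sub>R u) - f x) \<le> e / 2 + 2 * B * ?I u"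
      proof (cases "real k < norm u")
        case True
        then show ?thesis using B[of x] B[of "x + \<sigma> *\<^sub>R u"] e by (simp add: indicator_def)
      next
        case False
        then have "\<sigma> * norm u \<le> \<sigma> * real k" using \<sigma> by (intro mult_left_mono) auto
        also have "\<dots> < d" using d(1) k(1) by (simp add: \<sigma>_def)
        finally have "dist (x + \<sigma> *\<^sub>R u) x < d" using \<sigma> by (simp add: dist_norm)
        from d(2)[OF this] False show ?thesis by (simp add: dist_real_def)
      qed
    qed
    also have "\<dots> = e / 2 + 2 * B * measure (std_normal_vec :: (real^'m) measure) {x. real k < norm x}"
      using I[OF bI] N.prob_space by simp
    also have "\<dots> \<le> e / 2 + 2 * B * (e / (4 * (B + 1)))"
      using k(2) B0 by (intro add_left_mono mult_left_mono) auto
    also have "\<dots> \<le> e" using B0 e by (simp add: field_simps)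
    finally show ?thesis by simp
  qed
  with \<sigma> show ?thesis by blast
qed

lemma compact_support_uniformly_continuous:
  fixes f :: "'a::euclidean_space \<Rightarrow> real"
  assumes cont: "continuous_on UNIV f" and supp: "\<And>x. r < norm x \<Longrightarrow> f x = 0"
  shows "uniformly_continuous_on UNIV f"
proof -
  have u: "uniformly_continuous_on (cball 0 (r + 1)) f"
    by (intro compact_uniformly_continuous continuous_on_subset[OF cont]) auto
  show ?thesis unfolding uniformly_continuous_on_def
  proof (intro allI impI)
    fix e :: real assume e: "0 < e"
    obtain d where d: "0 < d" "\<And>x y. norm x \<le> r + 1 \<Longrightarrow> norm y \<le> r + 1 \<Longrightarrow> dist y x < d \<Longrightarrow> dist (f y) (f x) < e"
      using u e unfolding uniformly_continuous_on_def by (auto simp: dist_norm)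
    \<comment> \<open>If one point lies outside radius \<open>r + 1\<close>, then both lie outside
      radius \<open>r\<close>, where \<open>f\<close> vanishes; this explains the cap
      \<open>1\<close>.\<close>
    have "dist (f y) (f x) < e" if "dist y x < min d 1" for x y
    proof (cases "norm x \<le> r + 1 \<and> norm y \<le> r + 1")
      case True
      then show ?thesis using d(2) that by simp
    next
      case False
      have "\<bar>norm y - norm x\<bar> \<le> dist y x" unfolding dist_norm by (rule norm_triangle_ineq3)
      with False that have "r < norm x" "r < norm y" by auto
      then show ?thesis using e by (simp add: supp)
    qed
    then show "\<exists>d>0. \<forall>x\<in>UNIV. \<forall>x'\<in>UNIV. dist x' x < d \<longrightarrow> dist (f x') (f x) < e"
      using d(1) by (intro exI[of _ "min d 1"]) auto
  qed
qed

text \<open>The setting of Levy's continuity theorem with the limit law given in advance. Tightness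
  of the sequence can then be inherited from the limit instead of being extracted from
  characteristic functions near the origin.\<close>

locale char_convergence =
  fixes \<nu> :: "nat \<Rightarrow> (real^'m) measure" and \<nu>' :: "(real^'m) measure"
  assumes prob: "\<And>n. prob_space (\<nu> n)" "prob_space \<nu>'"
    and sets: "\<And>n. sets (\<nu> n) = sets borel" "sets \<nu>' = sets borel"
    and char: "\<And>v. (\<lambda>n. \<integral>x. iexp (v \<bullet> x) \<partial>\<nu> n) \<longlonglongrightarrow> (\<integral>x. iexp (v \<bullet> x) \<partial>\<nu>')"
begin

abbreviation (input) N :: "(real^'m) measure" where "N \<equiv> std_normal_vec"

abbreviation (input) kern :: "real \<Rightarrow> real^'m \<Rightarrow> real^'m \<Rightarrow> real" where
  "kern \<sigma> x y \<equiv> exp (- (norm ((1 / \<sigma>) *\<^sub>R (y - x)))\<^sup>2 / 2)"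

text \<open>The Gaussian kernel is itself the characteristic function of a Gaussian vector
  \<open>u\<close>, evaluated at the scaled difference of \<open>y\<close> and \<open>x\<close>.
  Exchanging integrals expresses the smoothed density through the characteristic function of
  \<open>\<mu>\<close> alone, so it converges by dominated convergence.\<close>

lemma smooth_density:
  assumes \<mu>: "prob_space \<mu>" "sets \<mu> = sets borel"
  shows "complex_of_real (\<integral>x. kern \<sigma> x y \<partial>\<mu>)
     = (\<integral>u. iexp (((1 / \<sigma>) *\<^sub>R y) \<bullet> u) * (\<integral>x. iexp ((- ((1 / \<sigma>) *\<^sub>R u)) \<bullet> x) \<partial>\<mu>) \<partial>N)"
proof -
  interpret N: prob_space N by (rule prob_space_std_normal_vec)
  interpret \<mu>: prob_space \<mu> by fact
  have [measurable_cong]: "sets \<mu> = sets borel" by fact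
  have "complex_of_real (\<integral>x. kern \<sigma> x y \<partial>\<mu>)
    = (\<integral>x. complex_of_real (kern \<sigma> x y) \<partial>\<mu>)"
    by (rule integral_complex_of_real[symmetric])
  also have "\<dots> = (\<integral>x. (\<integral>u. iexp (((1 / \<sigma>) *\<^sub>R (y - x)) \<bullet> u) \<partial>N) \<partial>\<mu>)"
    by (simp only: char_std_normal_vec)
  also have "\<dots> = (\<integral>u. (\<integral>x. iexp (((1 / \<sigma>) *\<^sub>R (y - x)) \<bullet> u) \<partial>\<mu>) \<partial>N)"
    by (rule bmf_Fubini[where B = 1, symmetric]) (auto intro: N.finite_measure_axioms \<mu>.finite_measure_axioms)
  also have "\<dots> = (\<integral>u. iexp (((1 / \<sigma>) *\<^sub>R y) \<bullet> u) * (\<integral>x. iexp ((- ((1 / \<sigma>) *\<^sub>R u)) \<bullet> x) \<partial>\<mu>) \<partial>N)"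
  proof (intro Bochner_Integration.integral_cong refl)
    fix u
    have "iexp (((1 / \<sigma>) *\<^sub>R (y - x)) \<bullet> u) = iexp (((1 / \<sigma>) *\<^sub>R y) \<bullet> u) * iexp ((- ((1 / \<sigma>) *\<^sub>R u)) \<bullet> x)" for x
    proof -
      have "((1 / \<sigma>) *\<^sub>R (y - x)) \<bullet> u = ((1 / \<sigma>) *\<^sub>R y) \<bullet> u + (- ((1 / \<sigma>) *\<^sub>R u)) \<bullet> x"
        by (simp add: inner_diff_left inner_commute[of u x] diff_divide_distrib)
      then show ?thesis by (simp only: of_real_add distrib_left exp_add)
    qed
    then show "(\<integral>x. iexp (((1 / \<sigma>) *\<^sub>R (y - x)) \<bullet> u) \<partial>\<mu>)
      = iexp (((1 / \<sigma>) *\<^sub>R y) \<bullet> u) * (\<integral>x. iexp ((- ((1 / \<sigma>) *\<^sub>R u)) \<bullet> x) \<partial>\<mu>)"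
      by (simp only: integral_mult_right_zero)
  qed
  finally show ?thesis .
qed

lemma smooth_density_tendsto:
  "(\<lambda>n. \<integral>x. kern \<sigma> x y \<partial>\<nu> n)
     \<longlonglongrightarrow> (\<integral>x. kern \<sigma> x y \<partial>\<nu>')"
proof -
  let ?c = "\<lambda>\<mu> u. iexp (((1 / \<sigma>) *\<^sub>R y) \<bullet> u) * (\<integral>x. iexp ((- ((1 / \<sigma>) *\<^sub>R u)) \<bullet> x) \<partial>\<mu>)"
  interpret N: prob_space N by (rule prob_space_std_normal_vec)
  have m: "(\<lambda>u. \<integral>x. iexp ((- ((1 / \<sigma>) *\<^sub>R u)) \<bullet> x) \<partial>\<mu>) \<in> borel_measurable N"
    if "prob_space \<mu>" "sets \<mu> = sets borel" for \<mu>
  proof -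
    interpret \<mu>: prob_space \<mu> by fact
    have [measurable_cong]: "sets \<mu> = sets borel" by fact
    show ?thesis by measurable
  qed
  have b: "cmod (\<integral>x. iexp (v \<bullet> x) \<partial>\<mu>) \<le> 1" if "prob_space \<mu>" "sets \<mu> = sets borel" for \<mu> :: "(real^'m) measure" and v
  proof -
    interpret \<mu>: prob_space \<mu> by fact
    have [measurable_cong]: "sets \<mu> = sets borel" by fact
    have "cmod (\<integral>x. iexp (v \<bullet> x) \<partial>\<mu>) \<le> (\<integral>x. 1 \<partial>\<mu>)"
      by (rule norm_integral_le) (auto intro: \<mu>.integrable_const_bound[of _ 1])
    then show ?thesis by (simp add: \<mu>.prob_space)
  qed
  have "(\<lambda>n. complex_of_real (\<integral>x. kern \<sigma> x y \<partial>\<nu> n))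
     \<longlonglongrightarrow> complex_of_real (\<integral>x. kern \<sigma> x y \<partial>\<nu>')"
    unfolding smooth_density[OF prob(1) sets(1)] smooth_density[OF prob(2) sets(2)]
  proof (rule integral_dominated_convergence[where w = "\<lambda>_. 1"])
    show "AE u in N. (\<lambda>n. ?c (\<nu> n) u)
      \<longlonglongrightarrow> ?c (\<nu>') u"
      by (intro AE_I2 tendsto_mult tendsto_const char)
    show "AE u in N. cmod (?c (\<nu> n) u) \<le> 1" for n
      using b[OF prob(1) sets(1)] by (intro AE_I2) (simp only: norm_mult norm_exp_i_times mult_1_left)
    show "(\<lambda>u. ?c (\<nu>') u)
      \<in> borel_measurable N"
      by (rule borel_measurable_times[OF _ m[OF prob(2) sets(2)]]) measurable
    show "(\<lambda>u. ?c (\<nu> n) u)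
      \<in> borel_measurable N" for n
      by (rule borel_measurable_times[OF _ m[OF prob(1) sets(1)]]) measurable
  qed (rule N.integrable_const)
  then show ?thesis by (simp only: tendsto_of_real_iff)
qed

text \<open>The substitution \<open>y = x + \<sigma> *\<^sub>R u\<close> moves \<open>x\<close> out
  of \<open>f\<close> and into the kernel, so that integrating over \<open>x\<close> meets only
  \<open>smooth_density\<close>.\<close>

lemma smoothing_eq:
  fixes f :: "real^'m \<Rightarrow> real"
  assumes f: "f \<in> borel_measurable borel" and \<sigma>: "0 < \<sigma>"
  shows "(\<integral>u. f (x + \<sigma> *\<^sub>R u) \<partial>std_normal_vec) = gauss_const TYPE('m) / \<sigma> ^ CARD('m)
    * (\<integral>y. f y * kern \<sigma> x y \<partial>lborel)"
proof -
  note [measurable] = f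
  have "(\<integral>y. f y * kern \<sigma> x y \<partial>lborel)
    = \<bar>\<sigma>\<bar> ^ DIM(real^'m) *\<^sub>R (\<integral>u. f (x + \<sigma> *\<^sub>R u) * exp (- (norm ((1 / \<sigma>) *\<^sub>R ((x + \<sigma> *\<^sub>R u) - x)))\<^sup>2 / 2) \<partial>lborel)"
    using \<sigma> by (intro lborel_integral_affine) auto
  also have "\<dots> = \<sigma> ^ CARD('m) * (\<integral>u. f (x + \<sigma> *\<^sub>R u) * exp (- (norm u)\<^sup>2 / 2) \<partial>lborel)"
    using \<sigma> by simp
  finally have 1: "(\<integral>y. f y * kern \<sigma> x y \<partial>lborel)
    = \<sigma> ^ CARD('m) * (\<integral>u. f (x + \<sigma> *\<^sub>R u) * exp (- (norm u)\<^sup>2 / 2) \<partial>lborel)" .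
  have "(\<integral>u. f (x + \<sigma> *\<^sub>R u) \<partial>std_normal_vec)
    = (\<integral>u. gauss_const TYPE('m) * (f (x + \<sigma> *\<^sub>R u) * exp (- (norm u)\<^sup>2 / 2)) \<partial>lborel)"
    by (subst integral_std_normal_vec) (auto simp: mult_ac)
  then show ?thesis unfolding 1 using \<sigma> by simp
qed

lemma smoothing_tendsto:
  fixes f :: "real^'m \<Rightarrow> real"
  assumes f: "f \<in> borel_measurable borel" and B: "\<And>x. \<bar>f x\<bar> \<le> B" and supp: "\<And>x. r < norm x \<Longrightarrow> f x = 0"
    and \<sigma>: "0 < \<sigma>"
  shows "(\<lambda>n. \<integral>x. (\<integral>u. f (x + \<sigma> *\<^sub>R u) \<partial>std_normal_vec) \<partial>\<nu> n)
     \<longlonglongrightarrow> (\<integral>x. (\<integral>u. f (x + \<sigma> *\<^sub>R u) \<partial>std_normal_vec) \<partial>\<nu>')"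
proof -
  note [measurable] = f
  \<comment> \<open>The support of \<open>f\<close> allows Lebesgue measure to be restricted to a
    ball. The result is finite, so Fubini applies to bounded functions and the constant
    \<open>B\<close> can dominate.\<close>
  let ?N = "density lborel (\<lambda>y::real^'m. ennreal (indicator (cball 0 r) y))"
  have N: "finite_measure ?N"
  proof
    have "emeasure ?N (space ?N) = emeasure lborel (cball (0::real^'m) r)"
      by (subst emeasure_density) (auto simp: ennreal_indicator intro!: borel_measurable_indicator)
    then show "emeasure ?N (space ?N) \<noteq> \<infinity>" using emeasure_lborel_cball_finite[of "0::real^'m" r] by simp
  qed
  have toN: "(\<integral>y. f y * h y \<partial>lborel) = (\<integral>y. f y * h y \<partial>?N)" if [measurable]: "h \<in> borel_measurable borel" for h
  proof -
    have "(\<integral>y. f y * h y \<partial>?N) = (\<integral>y. indicator (cball 0 r) y *\<^sub>R (f y * h y) \<partial>lborel)"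
      by (subst integral_density) (auto intro!: borel_measurable_indicator)
    also have "\<dots> = (\<integral>y. f y * h y \<partial>lborel)"
      by (intro Bochner_Integration.integral_cong refl) (auto simp: indicator_def supp)
    finally show ?thesis ..
  qed
  have B0: "0 \<le> B" using B[of 0] by linarith
  have eq: "(\<integral>x. (\<integral>u. f (x + \<sigma> *\<^sub>R u) \<partial>std_normal_vec) \<partial>\<mu>)
    = gauss_const TYPE('m) / \<sigma> ^ CARD('m) * (\<integral>y. f y * (\<integral>x. kern \<sigma> x y \<partial>\<mu>) \<partial>?N)"
    if "prob_space \<mu>" "sets \<mu> = sets borel" for \<mu>
  proof -
    interpret \<mu>: prob_space \<mu> by fact
    have [measurable_cong]: "sets \<mu> = sets borel" by fact
    have "(\<integral>x. (\<integral>y. f y * kern \<sigma> x y \<partial>?N) \<partial>\<mu>) = (\<integral>y. (\<integral>x. f y * kern \<sigma> x y \<partial>\<mu>) \<partial>?N)"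
    proof (rule bmf_Fubini[where B = B, symmetric])
      fix x y
      have "\<bar>f y\<bar> * \<bar>kern \<sigma> x y\<bar> \<le> B * 1" by (intro mult_mono B B0) auto
      then show "norm (f y * kern \<sigma> x y) \<le> B" by (simp add: abs_mult)
    qed (auto intro: \<mu>.finite_measure_axioms N)
    then show ?thesis
      unfolding smoothing_eq[OF f \<sigma>] by (simp add: toN)
  qed
  have "(\<lambda>n. \<integral>y. f y * (\<integral>x. kern \<sigma> x y \<partial>\<nu> n) \<partial>?N) \<longlonglongrightarrow> (\<integral>y. f y * (\<integral>x. kern \<sigma> x y \<partial>\<nu>') \<partial>?N)"
  proof (rule integral_dominated_convergence[where w = "\<lambda>_. B"])
    have m: "(\<lambda>y. f y * (\<integral>x. kern \<sigma> x y \<partial>\<mu>)) \<in> borel_measurable ?N" and b: "\<bar>\<integral>x. kern \<sigma> x y \<partial>\<mu>\<bar> \<le> 1"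
      if "prob_space \<mu>" "sets \<mu> = sets borel" for \<mu> y
    proof -
      interpret \<mu>: prob_space \<mu> by fact
      have [measurable_cong]: "sets \<mu> = sets borel" by fact
      show "(\<lambda>y. f y * (\<integral>x. kern \<sigma> x y \<partial>\<mu>)) \<in> borel_measurable ?N" by measurable
      have "norm (\<integral>x. kern \<sigma> x y \<partial>\<mu>) \<le> (\<integral>x. 1 \<partial>\<mu>)"
        by (rule norm_integral_le) (auto intro: \<mu>.integrable_const_bound[of _ 1])
      then show "\<bar>\<integral>x. kern \<sigma> x y \<partial>\<mu>\<bar> \<le> 1" by (simp add: \<mu>.prob_space)
    qed
    show "(\<lambda>y. f y * (\<integral>x. kern \<sigma> x y \<partial>\<nu>')) \<in> borel_measurable ?N" by (rule m[OF prob(2) sets(2)])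
    show "(\<lambda>y. f y * (\<integral>x. kern \<sigma> x y \<partial>\<nu> n)) \<in> borel_measurable ?N" for n by (rule m[OF prob(1) sets(1)])
    show "integrable ?N (\<lambda>_. B)" by (rule bmf_integrable[OF N bmf_const])
    show "AE y in ?N. (\<lambda>n. f y * (\<integral>x. kern \<sigma> x y \<partial>\<nu> n)) \<longlonglongrightarrow> f y * (\<integral>x. kern \<sigma> x y \<partial>\<nu>')"
      by (intro AE_I2 tendsto_mult tendsto_const smooth_density_tendsto)
    show "AE y in ?N. norm (f y * (\<integral>x. kern \<sigma> x y \<partial>\<nu> n)) \<le> B" for n
    proof (rule AE_I2)
      fix y
      have "\<bar>f y\<bar> * \<bar>\<integral>x. kern \<sigma> x y \<partial>\<nu> n\<bar> \<le> B * 1" by (intro mult_mono B B0 b prob sets) auto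
      then show "norm (f y * (\<integral>x. kern \<sigma> x y \<partial>\<nu> n)) \<le> B" by (simp add: abs_mult)
    qed
  qed
  then show ?thesis
    unfolding eq[OF prob(1) sets(1)] eq[OF prob(2) sets(2)] by (intro tendsto_mult tendsto_const)
qed

text \<open>The smoothing error is uniform in \<open>x\<close>, hence bounded by
  \<open>e / 4\<close> under every probability law at once; the smoothed integrals themselves
  converge.\<close>

lemma compact_support_tendsto:
  fixes f :: "real^'m \<Rightarrow> real"
  assumes cont: "continuous_on UNIV f" and B: "\<And>x. \<bar>f x\<bar> \<le> B" and supp: "\<And>x. r < norm x \<Longrightarrow> f x = 0"
  shows "(\<lambda>n. \<integral>x. f x \<partial>\<nu> n) \<longlonglongrightarrow> (\<integral>x. f x \<partial>\<nu>')"
proof (rule tendstoI)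
  fix e :: real assume e: "0 < e"
  have f [measurable]: "f \<in> borel_measurable borel" using cont by (rule borel_measurable_continuous_onI)
  have "\<exists>\<sigma>>0. \<forall>x. \<bar>(\<integral>u. f (x + \<sigma> *\<^sub>R u) \<partial>std_normal_vec) - f x\<bar> \<le> e / 4"
    by (rule smoothing_close[OF compact_support_uniformly_continuous[OF cont supp] B]) (use e in auto)
  then obtain \<sigma> where \<sigma>: "0 < \<sigma>" "\<And>x. \<bar>(\<integral>u. f (x + \<sigma> *\<^sub>R u) \<partial>std_normal_vec) - f x\<bar> \<le> e / 4" by blast
  let ?G = "\<lambda>x. \<integral>u. f (x + \<sigma> *\<^sub>R u) \<partial>std_normal_vec"
  have close: "\<bar>(\<integral>x. ?G x \<partial>\<mu>) - (\<integral>x. f x \<partial>\<mu>)\<bar> \<le> e / 4" if "prob_space \<mu>" "sets \<mu> = sets borel" for \<mu>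
  proof -
    interpret \<mu>: prob_space \<mu> by fact
    interpret N: prob_space N by (rule prob_space_std_normal_vec)
    have [measurable_cong]: "sets \<mu> = sets borel" by fact
    have bf: "bmf \<mu> f" by (rule bmfI[of _ _ B]) (use B in auto)
    have "bmf \<mu> ?G"
    proof (rule bmfI[of _ _ "B + e / 4"])
      show "?G \<in> borel_measurable \<mu>" by measurable
      fix x show "norm (?G x) \<le> B + e / 4" using \<sigma>(2)[of x] B[of x] unfolding real_norm_def by linarith
    qed
    then have d: "(\<integral>x. ?G x \<partial>\<mu>) - (\<integral>x. f x \<partial>\<mu>) = (\<integral>x. ?G x - f x \<partial>\<mu>)" and i: "integrable \<mu> (\<lambda>x. ?G x - f x)"
      using bf by (auto simp: \<mu>.integrable_bmf)
    have "norm (\<integral>x. ?G x - f x \<partial>\<mu>) \<le> (\<integral>x. e / 4 \<partial>\<mu>)"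
      by (rule norm_integral_le[OF i]) (use \<sigma>(2) in auto)
    then show ?thesis unfolding d by (simp add: \<mu>.prob_space)
  qed
  have "\<forall>\<^sub>F n in sequentially. dist (\<integral>x. ?G x \<partial>\<nu> n) (\<integral>x. ?G x \<partial>\<nu>') < e / 4"
    using smoothing_tendsto[OF f B supp \<sigma>(1)] e by (intro tendstoD) auto
  then show "\<forall>\<^sub>F n in sequentially. dist (\<integral>x. f x \<partial>\<nu> n) (\<integral>x. f x \<partial>\<nu>') < e"
  proof eventually_elim
    case (elim n)
    with close[OF prob(1) sets(1), of n] close[OF prob(2) sets(2)] e
    show ?case unfolding dist_real_def by linarith
  qed
qed

text \<open>The cutoff \<open>c\<close> is itself a compactly supported test function. Its integrals
  converge, so the mass that \<open>\<nu> n\<close> leaves outside the cutoff is eventually as small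
  as for the limit, which is the required tightness.\<close>

lemma weak_convergence:
  fixes f :: "real^'m \<Rightarrow> real"
  assumes cont: "continuous_on UNIV f" and B: "\<And>x. \<bar>f x\<bar> \<le> B"
  shows "(\<lambda>n. \<integral>x. f x \<partial>\<nu> n) \<longlonglongrightarrow> (\<integral>x. f x \<partial>\<nu>')"
proof (rule tendstoI)
  fix e :: real assume e: "0 < e"
  have B0: "0 \<le> B" using B[of 0] by linarith
  \<comment> \<open>Removing the cutoff under \<open>\<nu> n\<close> and under the limit costs at
    most \<open>B * d\<close> each, hence \<open>e / 3\<close> together, next to
    \<open>e / 3\<close> for the truncated function.\<close>
  define d where "d = e / (6 * (B + 1))"
  have d: "0 < d" using e B0 by (simp add: d_def)
  have Bd: "B * d \<le> e / 6" using e B0 by (simp add: d_def field_simps)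
  interpret \<nu>': prob_space \<nu>' by (rule prob)
  have [measurable_cong]: "sets \<nu>' = sets borel" by (rule sets)
  obtain r :: nat where r: "measure \<nu>' {x. real r < norm x} < d"
    using order_tendstoD(2)[OF tight_vec[OF prob(2) sets(2)] d] by (auto simp: eventually_sequentially)
  define c where "c x = max 0 (min 1 (real r + 1 - norm x))" for x :: "real^'m"
  have c: "continuous_on UNIV c" unfolding c_def by (intro continuous_intros)
  have c01: "0 \<le> c x" "c x \<le> 1" for x by (auto simp: c_def)
  have cs: "c x = 0" if "real r + 1 < norm x" for x using that by (simp add: c_def)
  have [measurable]: "f \<in> borel_measurable borel" "c \<in> borel_measurable borel"
    using cont c by (auto intro: borel_measurable_continuous_onI)
  have 1: "(\<lambda>n. \<integral>x. f x * c x \<partial>\<nu> n) \<longlonglongrightarrow> (\<integral>x. f x * c x \<partial>\<nu>')"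
  proof (rule compact_support_tendsto[where B = B and r = "real r + 1"])
    fix x
    have "\<bar>f x\<bar> * \<bar>c x\<bar> \<le> B * 1" using c01[of x] by (intro mult_mono B B0) auto
    then show "\<bar>f x * c x\<bar> \<le> B" by (simp add: abs_mult)
  qed (auto intro!: continuous_intros cont c simp: cs)
  have 2: "(\<lambda>n. \<integral>x. c x \<partial>\<nu> n) \<longlonglongrightarrow> (\<integral>x. c x \<partial>\<nu>')"
    by (rule compact_support_tendsto[where B = 1 and r = "real r + 1"]) (use c c01 cs in auto)
  have diff: "\<bar>(\<integral>x. f x \<partial>\<mu>) - (\<integral>x. f x * c x \<partial>\<mu>)\<bar> \<le> B * (1 - (\<integral>x. c x \<partial>\<mu>))"
    if "prob_space \<mu>" "sets \<mu> = sets borel" for \<mu>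
  proof -
    interpret \<mu>: prob_space \<mu> by fact
    have [measurable_cong]: "sets \<mu> = sets borel" by fact
    have bf: "bmf \<mu> f" by (rule bmfI[of _ _ B]) (use B in auto)
    have bc: "bmf \<mu> c" by (rule bmfI[of _ _ 1]) (use c01 in auto)
    note I = \<mu>.integrable_bmf
    have "(\<integral>x. f x \<partial>\<mu>) - (\<integral>x. f x * c x \<partial>\<mu>) = (\<integral>x. f x - f x * c x \<partial>\<mu>)"
      by (rule Bochner_Integration.integral_diff[symmetric, OF I[OF bf] I[OF bmf_mult[OF bf bc]]])
    also have "norm \<dots> \<le> (\<integral>x. B * (1 - c x) \<partial>\<mu>)"
    proof (rule norm_integral_le[OF I[OF bmf_diff[OF bf bmf_mult[OF bf bc]]] I[OF bmf_mult[OF bmf_const bmf_diff[OF bmf_const bc]]]])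
      fix x
      have "f x - f x * c x = f x * (1 - c x)" by (simp add: right_diff_distrib)
      then have "norm (f x - f x * c x) = \<bar>f x\<bar> * (1 - c x)"
        using c01[of x] by (simp add: abs_mult)
      also have "\<dots> \<le> B * (1 - c x)" using c01[of x] by (intro mult_right_mono B) auto
      finally show "norm (f x - f x * c x) \<le> B * (1 - c x)" .
    qed
    also have "\<dots> = B * (1 - (\<integral>x. c x \<partial>\<mu>))"
      using I[OF bc] by (simp add: \<mu>.prob_space)
    finally show ?thesis by simp
  qed
  have "1 - (\<integral>x. c x \<partial>\<nu>') < d"
  proof -
    have "bmf \<nu>' c" by (rule bmfI[of _ _ 1]) (use c01 in auto)
    then have ci: "integrable \<nu>' c" by (rule \<nu>'.integrable_bmf)
    have sp: "space \<nu>' = UNIV" using sets_eq_imp_space_eq[OF sets(2)] by simp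
    have "1 - (\<integral>x. c x \<partial>\<nu>') = (\<integral>x. 1 - c x \<partial>\<nu>')" using ci by (simp add: \<nu>'.prob_space)
    also have "\<dots> \<le> (\<integral>x. indicator {x. real r < norm x} x \<partial>\<nu>')"
    proof (rule integral_mono)
      show "integrable \<nu>' (\<lambda>x. 1 - c x)" using ci by simp
      have "{x::real^'m. real r < norm x} \<in> sets borel" by measurable
      then show "integrable \<nu>' (indicator {x. real r < norm x} :: _ \<Rightarrow> real)"
        by (intro \<nu>'.integrable_bmf bmf_indicator) (simp add: sets)
    qed (auto simp: indicator_def c_def)
    also have "\<dots> = measure \<nu>' {x. real r < norm x}" using sp by simp
    finally show ?thesis using r by simp
  qed
  then have "\<forall>\<^sub>F n in sequentially. 1 - d < (\<integral>x. c x \<partial>\<nu> n)"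
    using order_tendstoD(1)[OF 2, of "1 - d"] by simp
  moreover have "\<forall>\<^sub>F n in sequentially. dist (\<integral>x. f x * c x \<partial>\<nu> n) (\<integral>x. f x * c x \<partial>\<nu>') < e / 3"
    using 1 e by (intro tendstoD) auto
  ultimately show "\<forall>\<^sub>F n in sequentially. dist (\<integral>x. f x \<partial>\<nu> n) (\<integral>x. f x \<partial>\<nu>') < e"
  proof eventually_elim
    case (elim n)
    have "B * (1 - (\<integral>x. c x \<partial>\<nu> n)) \<le> B * d" "B * (1 - (\<integral>x. c x \<partial>\<nu>')) \<le> B * d"
      using elim(1) \<open>1 - (\<integral>x. c x \<partial>\<nu>') < d\<close> by (auto intro!: mult_left_mono B0)
    with diff[OF prob(1) sets(1), of n] diff[OF prob(2) sets(2)] elim(2) Bd e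
    show ?case unfolding dist_real_def by linarith
  qed
qed

end

section \<open>Causal processes and their coupled versions\<close>

locale innovations = prob_space M for M :: "'w measure" +
  fixes E :: "'e measure" and eps :: "int \<Rightarrow> 'w \<Rightarrow> 'e" and eps0s :: "'w \<Rightarrow> 'e"
  assumes eps_meas: "\<And>i. eps i \<in> measurable M E"
    and eps0s_meas: "eps0s \<in> measurable M E"
    and indep: "indep_vars (\<lambda>_. E) (\<lambda>j. case j of None \<Rightarrow> eps0s | Some i \<Rightarrow> eps i) UNIV"
    and ident: "\<And>i. distr M E (eps i) = distr M E (eps 0)"
    and ident0s: "distr M E eps0s = distr M E (eps 0)"

sublocale innovations \<subseteq> seq: sequence_space "distr M E (eps 0)"
proof -
  interpret \<mu>: prob_space "distr M E (eps 0)" by (rule prob_space_distr[OF eps_meas])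
  show "sequence_space (distr M E (eps 0))"
    unfolding sequence_space_def by (rule product_prob_spaceI) (rule \<mu>.prob_space_axioms)
qed

context innovations begin

text \<open>The index \<open>None\<close> carries the independent copy, so that the original and the
  coupled pasts are both re-indexings of one i.i.d. family.\<close>

definition innov :: "int option \<Rightarrow> 'w \<Rightarrow> 'e" where
  "innov j = (case j of None \<Rightarrow> eps0s | Some i \<Rightarrow> eps i)"

lemma sets_S: "sets seq.S = sets (PiM UNIV (\<lambda>_::nat. E))"
  by (rule sets_PiM_cong) auto

lemma measurable_S: "h \<in> borel_measurable (PiM UNIV (\<lambda>_. E)) \<Longrightarrow> h \<in> borel_measurable seq.S"
  using measurable_cong_sets[OF sets_S refl] by blast

lemma measurable_innov: "innov j \<in> measurable M E"
  by (auto simp: innov_def eps_meas eps0s_meas split: option.split)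

lemma measurable_innov_seq: "(\<lambda>\<omega> j. innov (\<phi> j) \<omega>) \<in> measurable M seq.S"
  by (rule measurable_PiM_single') (auto intro: measurable_innov measurable_space[OF measurable_innov])

text \<open>Any injective choice of innovations, the copy included, has the product law. Equality in
  law of \<open>Fi\<close> and \<open>Fi_star\<close> and joint statements about both reduce to
  writing down an injective index map.\<close>

lemma distr_innov_seq:
  assumes "inj \<phi>"
  shows "distr M seq.S (\<lambda>\<omega> (j::nat). innov (\<phi> j) \<omega>) = seq.S"
proof -
  let ?\<mu> = "distr M E (eps 0)"
  let ?K = "PiM UNIV (\<lambda>_::int option. ?\<mu>)"
  have K: "distr M (PiM UNIV (\<lambda>_. E)) (\<lambda>\<omega>. \<lambda>j\<in>UNIV. innov j \<omega>) = ?K"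
  proof -
    have "distr M (PiM UNIV (\<lambda>_. E)) (\<lambda>\<omega>. \<lambda>j\<in>UNIV. innov j \<omega>) = PiM UNIV (\<lambda>j. distr M E (innov j))"
    proof -
      have "innov = (\<lambda>j. case j of None \<Rightarrow> eps0s | Some i \<Rightarrow> eps i)" by (rule ext) (rule innov_def)
      then have "indep_vars (\<lambda>_. E) innov UNIV" using indep by (simp only:)
      then show ?thesis
        using indep_vars_iff_distr_eq_PiM[where I = UNIV and X = innov and M' = "\<lambda>_. E", OF UNIV_not_empty measurable_innov]
        by (simp only:)
    qed
    also have "\<dots> = ?K"
    proof (rule PiM_cong)
      fix j show "distr M E (innov j) = distr M E (eps 0)"
        by (cases j) (auto simp: innov_def intro: ident ident0s)
    qed simp
    finally show ?thesis .
  qed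
  have K': "distr M ?K (\<lambda>\<omega> j. innov j \<omega>) = ?K"
  proof -
    have "distr M ?K (\<lambda>\<omega> j. innov j \<omega>) = distr M (PiM UNIV (\<lambda>_. E)) (\<lambda>\<omega>. \<lambda>j\<in>UNIV. innov j \<omega>)"
      by (rule distr_cong) (auto intro!: sets_PiM_cong)
    then show ?thesis using K by simp
  qed
  have mK: "(\<lambda>\<omega> j. innov j \<omega>) \<in> measurable M ?K"
    by (rule measurable_PiM_single') (auto intro: measurable_innov measurable_space[OF measurable_innov])
  have mr: "(\<lambda>w. \<lambda>n\<in>UNIV. w (\<phi> n)) \<in> measurable ?K seq.S"
    by (rule measurable_PiM_single') (auto simp: space_PiM)
  have "seq.S = distr ?K seq.S (\<lambda>w. \<lambda>n\<in>UNIV. w (\<phi> n))"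
    by (rule distr_PiM_reindex[symmetric]) (use assms in \<open>auto intro: prob_space_distr eps_meas\<close>)
  also have "\<dots> = distr (distr M ?K (\<lambda>\<omega> j. innov j \<omega>)) seq.S (\<lambda>w. \<lambda>n\<in>UNIV. w (\<phi> n))"
    unfolding K' ..
  also have "\<dots> = distr M seq.S ((\<lambda>w. \<lambda>n\<in>UNIV. w (\<phi> n)) \<circ> (\<lambda>\<omega> j. innov j \<omega>))"
    by (rule distr_distr[OF mr mK])
  also have "(\<lambda>w. \<lambda>n\<in>UNIV. w (\<phi> n)) \<circ> (\<lambda>\<omega> j. innov j \<omega>) = (\<lambda>\<omega> j. innov (\<phi> j) \<omega>)"
    by (auto simp: fun_eq_iff)
  finally show ?thesis ..
qed

lemma integral_innov_seq:
  fixes F :: "(nat \<Rightarrow> 'e) \<Rightarrow> 'b::{banach,second_countable_topology}"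
  assumes "inj \<phi>" "F \<in> borel_measurable seq.S"
  shows "(\<integral>s. F s \<partial>seq.S) = (\<integral>\<omega>. F (\<lambda>j. innov (\<phi> j) \<omega>) \<partial>M)"
  by (subst distr_innov_seq[OF assms(1), symmetric], subst integral_distr[OF measurable_innov_seq])
    (use assms(2) in auto)

lemma Fi_innov: "Fi eps i = (\<lambda>\<omega> j. innov (Some (i - int j)) \<omega>)"
  by (simp add: Fi_def innov_def fun_eq_iff)

lemma Fi_star_innov: "Fi_star eps eps0s k = (\<lambda>\<omega> j. innov (if j = k then None else Some (int k - int j)) \<omega>)"
  by (auto simp: Fi_star_def innov_def fun_eq_iff)

lemma inj_Fi: "inj (\<lambda>j. Some (i - int j))"
  by (auto simp: inj_on_def)

lemma inj_Fi_star: "inj (\<lambda>j. if j = k then None else Some (int k - int j))"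
  by (auto simp: inj_on_def split: if_splits)

lemma measurable_Fi: "Fi eps i \<in> measurable M seq.S"
  unfolding Fi_innov by (rule measurable_innov_seq)

lemma measurable_Fi_star: "Fi_star eps eps0s k \<in> measurable M seq.S"
  unfolding Fi_star_innov by (rule measurable_innov_seq)

lemma integral_Fi:
  fixes F :: "(nat \<Rightarrow> 'e) \<Rightarrow> 'b::{banach,second_countable_topology}"
  assumes "F \<in> borel_measurable seq.S"
  shows "(\<integral>s. F s \<partial>seq.S) = (\<integral>\<omega>. F (Fi eps i \<omega>) \<partial>M)"
  unfolding Fi_innov by (rule integral_innov_seq[OF inj_Fi assms])

lemma measure_Fi:
  assumes "A \<in> sets seq.S"
  shows "measure M {\<omega>\<in>space M. Fi eps i \<omega> \<in> A} = measure seq.S A"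
proof -
  have "measure seq.S A = measure (distr M seq.S (Fi eps i)) A"
    unfolding Fi_innov by (subst distr_innov_seq[OF inj_Fi]) rule
  also have "\<dots> = measure M {\<omega>\<in>space M. Fi eps i \<omega> \<in> A}"
    by (subst measure_distr[OF measurable_Fi assms]) (auto intro!: arg_cong[of _ _ "measure M"])
  finally show ?thesis ..
qed

lemma measure_Fi_star:
  assumes "A \<in> sets seq.S"
  shows "measure M {\<omega>\<in>space M. Fi_star eps eps0s k \<omega> \<in> A} = measure seq.S A"
proof -
  have "measure seq.S A = measure (distr M seq.S (Fi_star eps eps0s k)) A"
    unfolding Fi_star_innov by (subst distr_innov_seq[OF inj_Fi_star]) rule
  also have "\<dots> = measure M {\<omega>\<in>space M. Fi_star eps eps0s k \<omega> \<in> A}"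
    by (subst measure_distr[OF measurable_Fi_star assms]) (auto intro!: arg_cong[of _ _ "measure M"])
  finally show ?thesis ..
qed

lemma seq_shift_Fi: "seq_shift i (Fi eps n \<omega>) = Fi eps (n - int i) \<omega>"
  by (auto simp: fun_eq_iff Fi_def algebra_simps)

text \<open>Deleting either of two adjacent coordinates of one innovation sequence gives the original
  and the coupled process.\<close>
lemma l2_incr_coupling:
  assumes g: "bmf seq.S g"
  shows "(l2 seq.S (seq.incr k g))\<^sup>2 \<le> (\<integral>\<omega>. (g (Fi eps (int k) \<omega>) - g (Fi_star eps eps0s k \<omega>))\<^sup>2 \<partial>M)"
proof -
  \<comment> \<open>The list is \<open>eps k\<close>, ..., \<open>eps 0\<close>, then the copy, then
    \<open>eps (-1)\<close> and so on. Deleting position \<open>Suc k\<close> removes the copy,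
    deleting position \<open>k\<close> removes \<open>eps 0\<close>.\<close>
  define \<phi> where "\<phi> j = (if j \<le> k then Some (int k - int j) else if j = Suc k then None else Some (int k - int j + 1))" for j
  have inj: "inj \<phi>" unfolding \<phi>_def by (auto simp: inj_on_def split: if_splits)
  have 1: "seq_del (Suc k) (\<lambda>j. innov (\<phi> j) \<omega>) = Fi eps (int k) \<omega>" for \<omega>
    unfolding Fi_innov by (auto simp: fun_eq_iff seq_del_def \<phi>_def intro!: arg_cong2[of _ _ _ _ innov])
  have 2: "seq_del k (\<lambda>j. innov (\<phi> j) \<omega>) = Fi_star eps eps0s k \<omega>" for \<omega>
    unfolding Fi_star_innov by (auto simp: fun_eq_iff seq_del_def \<phi>_def intro!: arg_cong2[of _ _ _ _ innov])
  have "(\<lambda>w. (g (seq_del (Suc k) w) - g (seq_del k w))\<^sup>2) \<in> borel_measurable seq.S"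
    by (intro bmf_measurable bmf_power bmf_diff bmf_comp[OF g] seq.measurable_seq_del)
  from integral_innov_seq[OF inj this] seq.l2_incr_le[OF g, of k]
  show ?thesis by (simp add: 1 2)
qed

text \<open>The squared difference of the two indicators is the indicator of a disagreement. Process
  and copy have the same law, so the two kinds of disagreement are equally likely; this gives the
  factor \<open>2\<close> and lets the one measured by \<open>theta\<close> stand for both. The
  constant \<open>c\<close> cancels.\<close>

lemma l2_incr_indicator:
  assumes A: "A \<in> sets seq.S"
  shows "(l2 seq.S (seq.incr k (\<lambda>s. indicator A s - c)))\<^sup>2
    \<le> 2 * measure M {\<omega>\<in>space M. Fi_star eps eps0s k \<omega> \<notin> A \<and> Fi eps (int k) \<omega> \<in> A}"
proof -
  let ?e = "Fi eps (int k)" and ?s = "Fi_star eps eps0s k"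
  let ?P = "{\<omega>\<in>space M. ?s \<omega> \<notin> A \<and> ?e \<omega> \<in> A}" and ?Q = "{\<omega>\<in>space M. ?s \<omega> \<in> A \<and> ?e \<omega> \<notin> A}"
  let ?B = "{\<omega>\<in>space M. ?s \<omega> \<in> A \<and> ?e \<omega> \<in> A}"
  have se: "{\<omega>\<in>space M. ?e \<omega> \<in> A} \<in> sets M" "{\<omega>\<in>space M. ?s \<omega> \<in> A} \<in> sets M"
    using measurable_sets[OF measurable_Fi A, of "int k"] measurable_sets[OF measurable_Fi_star A, of k]
    by (auto simp: vimage_def Int_def conj_commute)
  have sP: "?P \<in> sets M" and sQ: "?Q \<in> sets M" and sB: "?B \<in> sets M"
  proof -
    have "?P = {\<omega>\<in>space M. ?e \<omega> \<in> A} - {\<omega>\<in>space M. ?s \<omega> \<in> A}"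
      "?Q = {\<omega>\<in>space M. ?s \<omega> \<in> A} - {\<omega>\<in>space M. ?e \<omega> \<in> A}"
      "?B = {\<omega>\<in>space M. ?s \<omega> \<in> A} \<inter> {\<omega>\<in>space M. ?e \<omega> \<in> A}" by auto
    then show "?P \<in> sets M" "?Q \<in> sets M" "?B \<in> sets M" using se by auto
  qed
  have "measure M ?P + measure M ?B = measure M (?P \<union> ?B)"
    by (rule finite_measure_Union[symmetric]) (use sP sB in auto)
  also have "?P \<union> ?B = {\<omega>\<in>space M. ?e \<omega> \<in> A}" by auto
  also have "measure M \<dots> = measure M {\<omega>\<in>space M. ?s \<omega> \<in> A}"
    by (simp add: measure_Fi[OF A] measure_Fi_star[OF A])
  also have "{\<omega>\<in>space M. ?s \<omega> \<in> A} = ?Q \<union> ?B" by auto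
  also have "measure M (?Q \<union> ?B) = measure M ?Q + measure M ?B"
    by (rule finite_measure_Union) (use sQ sB in auto)
  finally have PQ: "measure M ?P = measure M ?Q" by simp
  have g: "bmf seq.S (\<lambda>s. indicator A s - c :: real)" by (intro bmf_diff bmf_indicator A bmf_const)
  have "(l2 seq.S (seq.incr k (\<lambda>s. indicator A s - c)))\<^sup>2 \<le>
     (\<integral>\<omega>. ((indicator A (?e \<omega>) - c) - (indicator A (?s \<omega>) - c))\<^sup>2 \<partial>M)"
    by (rule l2_incr_coupling[OF g])
  also have "\<dots> = (\<integral>\<omega>. indicator ?P \<omega> + indicator ?Q \<omega> \<partial>M)"
    by (intro Bochner_Integration.integral_cong refl) (auto simp: indicator_def)
  also have "\<dots> = measure M ?P + measure M ?Q"
    using sP sQ by (simp add: emeasure_eq_measure Int_absorb2[OF sets.sets_into_space])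
  finally show ?thesis using PQ by simp
qed

text \<open>The generalised quantile \<open>Q\<close> may lie strictly to the left of \<open>0\<close>, but exceeding \<open>Q\<close>
  and exceeding \<open>0\<close> differ by a null event.\<close>
lemma tail_transfer:
  fixes h :: "(nat \<Rightarrow> 'e) \<Rightarrow> real"
  assumes h: "h \<in> borel_measurable (PiM UNIV (\<lambda>_. E))"
    and p: "measure M {\<omega>\<in>space M. h (Fi eps i \<omega>) \<le> 0} = 1 - a" and a: "0 < a"
  defines "Q \<equiv> qinv (cdfF M eps h) (1 - a)"
  shows "measure M {\<omega>\<in>space M. ereal (h (Fi eps (int k) \<omega>)) > Q} = a"
    and "measure M {\<omega>\<in>space M. h (Fi_star eps eps0s k \<omega>) \<le> 0 \<and> h (Fi eps (int k) \<omega>) > 0}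
      \<le> measure M {\<omega>\<in>space M. ereal (h (Fi_star eps eps0s k \<omega>)) \<le> Q \<and> ereal (h (Fi eps (int k) \<omega>)) > Q}"
proof -
  have hS [measurable]: "h \<in> borel_measurable seq.S" using h by (rule measurable_S)
  note [measurable] = measurable_Fi measurable_Fi_star
  have law: "measure M {\<omega>\<in>space M. h (Fi eps j \<omega>) \<le> u} = measure seq.S {s\<in>space seq.S. h s \<le> u}" for j u
  proof -
    have "measure M {\<omega>\<in>space M. Fi eps j \<omega> \<in> {s\<in>space seq.S. h s \<le> u}} = measure seq.S {s\<in>space seq.S. h s \<le> u}"
      by (rule measure_Fi) measurable
    moreover have "{\<omega>\<in>space M. Fi eps j \<omega> \<in> {s\<in>space seq.S. h s \<le> u}} = {\<omega>\<in>space M. h (Fi eps j \<omega>) \<le> u}"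
      using measurable_space[OF measurable_Fi] by auto
    ultimately show ?thesis by simp
  qed
  have F: "cdfF M eps h u = measure seq.S {s\<in>space seq.S. h s \<le> u}" for u
    unfolding cdfF_def by (rule law)
  have F0: "cdfF M eps h 0 = 1 - a" using p by (simp add: F law)
  have gt: "measure seq.S {s\<in>space seq.S. u < h s} = 1 - cdfF M eps h u" for u
  proof -
    have "{s\<in>space seq.S. u < h s} = space seq.S - {s\<in>space seq.S. h s \<le> u}" by auto
    then show ?thesis unfolding F by (simp add: seq.P.prob_compl)
  qed
  let ?A = "{s\<in>space seq.S. Q < ereal (h s)}" and ?Pos = "{s\<in>space seq.S. 0 < h s}"
  have Q0: "Q \<le> 0" unfolding Q_def qinv_def
    by (rule Inf_lower) (auto simp: F0 zero_ereal_def intro!: exI[of _ 0])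
  have A: "?A \<in> sets seq.S" "?Pos \<in> sets seq.S" by measurable
  have sub: "?Pos \<subseteq> ?A"
  proof
    fix s assume s: "s \<in> ?Pos"
    then have "0 < ereal (h s)" by simp
    with Q0 have "Q < ereal (h s)" by (rule order_le_less_trans)
    with s show "s \<in> ?A" by simp
  qed
  have mA0: "measure seq.S ?Pos = a" unfolding gt F0 by simp
  have "measure seq.S ?A \<le> a"
  proof -
    let ?U = "{ereal u | u. 1 - a \<le> cdfF M eps h u}"
    have ne: "?U \<noteq> {}" using F0 by (auto intro!: exI[of _ 0])
    \<comment> \<open>The infimum is reached along a decreasing sequence of admissible points, so
      \<open>?A\<close> is an increasing union of events of probability at most \<open>a\<close>.
      Whether the infimum is attained does not matter.\<close>
    obtain f where f: "decseq f" "range f \<subseteq> ?U" "Inf ?U = (INF i. f i)"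
      using Inf_countable_INF[OF ne] by blast
    then have "\<forall>i::nat. \<exists>u. f i = ereal u \<and> 1 - a \<le> cdfF M eps h u" by blast
    then obtain u where u: "\<And>i. f i = ereal (u i)" "\<And>i. 1 - a \<le> cdfF M eps h (u i)" by metis
    have Qf: "Q = (INF i. f i)" unfolding Q_def qinv_def by (rule f(3))
    have Qless: "Q < ereal (h s) \<longleftrightarrow> (\<exists>i. u i < h s)" for s
      unfolding Qf INF_less_iff by (simp add: u(1))
    have un: "?A = (\<Union>i. {s\<in>space seq.S. u i < h s})" unfolding Qless by auto
    have dec: "u j \<le> u i" if "i \<le> j" for i j using decseqD[OF f(1) that] by (simp add: u(1))
    have "(\<lambda>i. measure seq.S {s\<in>space seq.S. u i < h s}) \<longlonglongrightarrow> measure seq.S (\<Union>i. {s\<in>space seq.S. u i < h s})"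
    proof (rule seq.P.finite_Lim_measure_incseq)
      show "range (\<lambda>i. {s\<in>space seq.S. u i < h s}) \<subseteq> sets seq.S" by auto
      show "incseq (\<lambda>i. {s\<in>space seq.S. u i < h s})"
        unfolding incseq_def using dec by (auto intro: order_le_less_trans)
    qed
    then show ?thesis unfolding un
      by (rule LIMSEQ_le_const2) (auto simp: gt intro!: exI[of _ 0] order_trans[OF diff_left_mono[OF u(2)]])
  qed
  moreover have "a \<le> measure seq.S ?A"
    unfolding mA0[symmetric] by (rule seq.P.finite_measure_mono[OF sub A(1)])
  ultimately have mA: "measure seq.S ?A = a" by simp
  have inv: "{\<omega>\<in>space M. Fi eps j \<omega> \<in> ?A} = {\<omega>\<in>space M. ereal (h (Fi eps j \<omega>)) > Q}" for j
    using measurable_space[OF measurable_Fi] by auto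
  show "measure M {\<omega>\<in>space M. ereal (h (Fi eps (int k) \<omega>)) > Q} = a"
    using measure_Fi[OF A(1), of "int k"] by (simp only: inv mA)
  \<comment> \<open>If the coupled value is nonpositive but does not stay below or at
    \<open>Q\<close>, it lies strictly above \<open>Q\<close> and not above \<open>0\<close>: this
    is the null event \<open>?Z\<close>.\<close>
  let ?Z = "{\<omega>\<in>space M. Fi_star eps eps0s k \<omega> \<in> ?A - ?Pos}"
  have "measure M ?Z = measure seq.S (?A - ?Pos)"
    by (rule measure_Fi_star) (use A in auto)
  also have "\<dots> = 0" using seq.P.finite_measure_Diff[OF A sub] mA mA0 by simp
  finally have Z: "measure M ?Z = 0" .
  have [measurable]: "?A - ?Pos \<in> sets seq.S" using A by auto
  have "measure M {\<omega>\<in>space M. h (Fi_star eps eps0s k \<omega>) \<le> 0 \<and> h (Fi eps (int k) \<omega>) > 0}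
    \<le> measure M ({\<omega>\<in>space M. ereal (h (Fi_star eps eps0s k \<omega>)) \<le> Q \<and> ereal (h (Fi eps (int k) \<omega>)) > Q} \<union> ?Z)"
  proof (rule finite_measure_mono)
    show "{\<omega>\<in>space M. h (Fi_star eps eps0s k \<omega>) \<le> 0 \<and> h (Fi eps (int k) \<omega>) > 0}
      \<subseteq> {\<omega>\<in>space M. ereal (h (Fi_star eps eps0s k \<omega>)) \<le> Q \<and> ereal (h (Fi eps (int k) \<omega>)) > Q} \<union> ?Z"
    proof
      fix \<omega> assume w: "\<omega> \<in> {\<omega>\<in>space M. h (Fi_star eps eps0s k \<omega>) \<le> 0 \<and> h (Fi eps (int k) \<omega>) > 0}"
      have "Q < ereal (h (Fi eps (int k) \<omega>))"
        using w Q0 by (intro order_le_less_trans[OF Q0]) auto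
      moreover have "Fi_star eps eps0s k \<omega> \<in> space seq.S"
        using w measurable_space[OF measurable_Fi_star] by auto
      ultimately show "\<omega> \<in> {\<omega>\<in>space M. ereal (h (Fi_star eps eps0s k \<omega>)) \<le> Q \<and> ereal (h (Fi eps (int k) \<omega>)) > Q} \<union> ?Z"
        using w by auto
    qed
  qed measurable
  also have "\<dots> \<le> measure M {\<omega>\<in>space M. ereal (h (Fi_star eps eps0s k \<omega>)) \<le> Q \<and> ereal (h (Fi eps (int k) \<omega>)) > Q} + measure M ?Z"
    by (rule measure_Un_le) measurable
  finally show "measure M {\<omega>\<in>space M. h (Fi_star eps eps0s k \<omega>) \<le> 0 \<and> h (Fi eps (int k) \<omega>) > 0}
      \<le> measure M {\<omega>\<in>space M. ereal (h (Fi_star eps eps0s k \<omega>)) \<le> Q \<and> ereal (h (Fi eps (int k) \<omega>)) > Q}"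
    using Z by simp
qed

end

text \<open>If all the series diverged, both limits in the definition would be limits of the constant \<open>\<infinity>\<close>,
  so no junk value of \<open>lim\<close> or \<open>Lim\<close> can make the condition vacuous.\<close>
lemma TAS_summable:
  assumes "TAS M eps eps0s G q"
  shows "\<exists>a0>0. \<exists>n0. summable (\<lambda>k. theta M eps eps0s G n0 a0 k powr (1 / q))"
proof (rule ccontr)
  let ?s = "\<lambda>a n. \<Sum>k. ennreal (theta M eps eps0s G n a k powr (1 / q))"
  assume "\<not> ?thesis"
  then have ns: "\<not> summable (\<lambda>k. theta M eps eps0s G n a k powr (1 / q))" if "0 < a" for a n
    using that by blast
  have top: "?s a n = top" if "0 < a" for a n
  proof (rule ccontr)
    assume "?s a n \<noteq> top"
    then have "summable (\<lambda>k. theta M eps eps0s G n a k powr (1 / q))"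
      by (intro summable_suminf_not_top) auto
    with ns[OF that] show False by blast
  qed
  have "lim (\<lambda>n. ?s a n) = top" if "0 < a" for a
    unfolding top[OF that] by (rule limI[OF tendsto_const])
  then have "\<forall>\<^sub>F a in at_right 0. lim (\<lambda>n. ?s a n) = top"
    using eventually_at_right_less[of "0::real"] by (auto elim: eventually_mono)
  then have "((\<lambda>a. lim (\<lambda>n. ?s a n)) \<longlongrightarrow> top) (at_right 0)"
    by (rule tendsto_eventually)
  then have "Lim (at_right 0) (\<lambda>a. lim (\<lambda>n. ?s a n)) = top"
    by (intro tendsto_Lim trivial_limit_at_right_real)
  with assms show False unfolding TAS_def by simp
qed

section \<open>Normalised design vectors, tail coefficients and the linear forms of the sum\<close>

lemma Sigma_n_quad: "v \<bullet> (Sigma_n x n *v v) = (1 / real n) * (\<Sum>i\<in>{1..n}. (v \<bullet> x n i)\<^sup>2)"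
proof -
  have "(\<Sum>i\<in>I. outer (x n i) (x n i)) *v v = (\<Sum>i\<in>I. (x n i \<bullet> v) *\<^sub>R x n i)" for I :: "nat set"
    by (induction I rule: infinite_finite_induct) (simp_all add: matrix_vector_mult_add_rdistrib outer_mult)
  then show ?thesis
    unfolding Sigma_n_def by (simp add: scaleR_matrix_vector_assoc[symmetric] inner_sum_right inner_commute power2_eq_square)
qed

lemma psd_Sigma_n: "psd_mat (Sigma_n x n)"
  unfolding psd_mat_def
proof
  show "transpose (Sigma_n x n) = Sigma_n x n"
    unfolding Sigma_n_def by (simp add: vec_eq_iff transpose_def outer_def mult.commute)
  show "\<forall>v. 0 \<le> v \<bullet> (Sigma_n x n *v v)"
    unfolding Sigma_n_quad by (intro allI mult_nonneg_nonneg sum_nonneg) auto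
qed

text \<open>The vectors \<open>zvec\<close> have the identity as empirical second-moment matrix, so
  the total weight of a linear form depends only on the norm of its direction.\<close>

lemma zvec_normalized:
  assumes "invertible (Sigma_n x n)"
  shows "(1 / real n) * (\<Sum>i\<in>{1..n}. (w \<bullet> zvec x n i)\<^sup>2) = w \<bullet> w"
proof -
  let ?R = "psd_sqrt (matrix_inv (Sigma_n x n))"
  note R = inv_sqrt_sandwich[OF psd_Sigma_n assms]
  have "(1 / real n) * (\<Sum>i\<in>{1..n}. (w \<bullet> zvec x n i)\<^sup>2) = (1 / real n) * (\<Sum>i\<in>{1..n}. ((?R *v w) \<bullet> x n i)\<^sup>2)"
    unfolding zvec_def psd_matD(3)[OF R(1)] ..
  also have "\<dots> = (?R *v w) \<bullet> (Sigma_n x n *v (?R *v w))" by (rule Sigma_n_quad[symmetric])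
  also have "\<dots> = w \<bullet> ((?R ** Sigma_n x n ** ?R) *v w)"
    unfolding psd_matD(3)[OF R(1)] by (simp add: matrix_vector_mul_assoc matrix_mul_assoc)
  finally show ?thesis unfolding R(2) by simp
qed

context innovations begin

text \<open>A real \<open>Sup\<close> is informative only for a nonempty set that is bounded above.
  Each ratio is at most \<open>1\<close>, as a conditional probability or, for a null conditioning
  event, as the default value \<open>0\<close> of division by zero.\<close>

lemma theta_bounds:
  assumes G: "\<And>N. G N \<in> borel_measurable (PiM UNIV (\<lambda>_. E))"
  defines "Q \<equiv> (\<lambda>a N. qinv (cdfF M eps (G N)) (1 - a))"
  shows "0 < a \<Longrightarrow> a \<le> a0 \<Longrightarrow> n0 \<le> N \<Longrightarrow>
      measure M {\<omega>\<in>space M. ereal (G N (Fi_star eps eps0s k \<omega>)) \<le> Q a N \<and> ereal (G N (Fi eps (int k) \<omega>)) > Q a N}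
        / measure M {\<omega>\<in>space M. ereal (G N (Fi eps (int k) \<omega>)) > Q a N} \<le> theta M eps eps0s G n0 a0 k"
    and "0 < a0 \<Longrightarrow> 0 \<le> theta M eps eps0s G n0 a0 k" and "0 < a0 \<Longrightarrow> theta M eps eps0s G n0 a0 k \<le> 1"
proof -
  let ?num = "\<lambda>a N. {\<omega>\<in>space M. ereal (G N (Fi_star eps eps0s k \<omega>)) \<le> Q a N \<and> ereal (G N (Fi eps (int k) \<omega>)) > Q a N}"
    and ?den = "\<lambda>a N. {\<omega>\<in>space M. ereal (G N (Fi eps (int k) \<omega>)) > Q a N}"
  have [measurable]: "G N \<in> borel_measurable seq.S" for N using G by (rule measurable_S)
  note [measurable] = measurable_Fi measurable_Fi_star
  define r where "r = (\<lambda>(a, N).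
      measure M (?num a N)
        / measure M (?den a N))"
  have \<theta>: "theta M eps eps0s G n0 a0 k = Sup (r ` ({0<..a0} \<times> {n0..}))"
    unfolding theta_def r_def Q_def Let_def ..
  have r0: "0 \<le> r x" for x unfolding r_def by (auto split: prod.split)
  have r1: "r x \<le> 1" for x
  proof (cases x)
    case (Pair a N)
    have "measure M (?num a N)
      \<le> measure M (?den a N)"
      by (rule finite_measure_mono) (auto, measurable)
    then show ?thesis unfolding Pair r_def by (simp add: divide_le_eq_1 zero_less_measure_iff)
  qed
  have bdd: "bdd_above (r ` X)" for X using r1 by (auto intro!: bdd_aboveI[of _ 1])
  show "measure M (?num a N)
        / measure M (?den a N) \<le> theta M eps eps0s G n0 a0 k"
    if "0 < a" "a \<le> a0" "n0 \<le> N"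
  proof -
    have "r (a, N) \<le> theta M eps eps0s G n0 a0 k"
      unfolding \<theta> by (rule cSup_upper[OF _ bdd]) (use that in auto)
    then show ?thesis by (simp add: r_def)
  qed
  assume a0: "0 < a0"
  then have mem: "r (a0, n0) \<in> r ` ({0<..a0} \<times> {n0..})" by auto
  show "0 \<le> theta M eps eps0s G n0 a0 k"
    unfolding \<theta> by (rule order_trans[OF r0 cSup_upper[OF mem bdd]])
  show "theta M eps eps0s G n0 a0 k \<le> 1"
    unfolding \<theta> by (rule cSup_least) (use mem r1 in auto)
qed

lemma l2_incr_theta:
  assumes G: "\<And>N. G N \<in> borel_measurable (PiM UNIV (\<lambda>_. E))"
    and p: "measure M {\<omega>\<in>space M. G N (Fi eps i \<omega>) \<le> 0} = 1 - a" and a: "0 < a" "a \<le> a0" "n0 \<le> N" and q: "2 \<le> q"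
  shows "l2 seq.S (seq.incr k (\<lambda>s. indicator {s\<in>space seq.S. 0 < G N s} s - c))
    \<le> sqrt a * (sqrt 2 * theta M eps eps0s G n0 a0 k powr (1 / q))"
proof -
  have [measurable]: "G N \<in> borel_measurable seq.S" using G by (rule measurable_S)
  let ?A = "{s\<in>space seq.S. 0 < G N s}" and ?\<theta> = "theta M eps eps0s G n0 a0 k"
  let ?Q = "qinv (cdfF M eps (G N)) (1 - a)"
  have \<theta>: "0 \<le> ?\<theta>" "?\<theta> \<le> 1" using theta_bounds(2,3)[where G = G, OF G] a by (auto intro: less_le_trans)
  have "(l2 seq.S (seq.incr k (\<lambda>s. indicator ?A s - c)))\<^sup>2
    \<le> 2 * measure M {\<omega>\<in>space M. Fi_star eps eps0s k \<omega> \<notin> ?A \<and> Fi eps (int k) \<omega> \<in> ?A}"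
    by (rule l2_incr_indicator) measurable
  also have "{\<omega>\<in>space M. Fi_star eps eps0s k \<omega> \<notin> ?A \<and> Fi eps (int k) \<omega> \<in> ?A}
    = {\<omega>\<in>space M. G N (Fi_star eps eps0s k \<omega>) \<le> 0 \<and> G N (Fi eps (int k) \<omega>) > 0}"
    using measurable_space[OF measurable_Fi] measurable_space[OF measurable_Fi_star] by (auto simp: not_less)
  also have "measure M \<dots> \<le> measure M {\<omega>\<in>space M. ereal (G N (Fi_star eps eps0s k \<omega>)) \<le> ?Q \<and> ereal (G N (Fi eps (int k) \<omega>)) > ?Q}"
    by (rule tail_transfer(2)[where h = "G N", OF G p a(1)])
  also have "\<dots> \<le> a * ?\<theta>"
    using theta_bounds(1)[where G = G and k = k, OF G a] a(1)
    unfolding tail_transfer(1)[where h = "G N", OF G p a(1)]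
    by (simp add: divide_le_eq mult.commute)
  finally have "(l2 seq.S (seq.incr k (\<lambda>s. indicator ?A s - c)))\<^sup>2 \<le> 2 * (a * ?\<theta>)" by simp
  then have "l2 seq.S (seq.incr k (\<lambda>s. indicator ?A s - c)) \<le> sqrt (2 * (a * ?\<theta>))"
    by (rule real_le_rsqrt)
  also have "\<dots> = sqrt a * (sqrt 2 * sqrt ?\<theta>)" by (simp add: real_sqrt_mult)
  also have "\<dots> \<le> sqrt a * (sqrt 2 * ?\<theta> powr (1 / q))"
  proof -
    have "sqrt ?\<theta> = ?\<theta> powr (1 / 2)" using \<theta>(1) by (simp add: powr_half_sqrt)
    also have "\<dots> \<le> ?\<theta> powr (1 / q)" using q by (intro powr_mono' \<theta>) (simp add: field_simps)
    finally show ?thesis using a(1) by (intro mult_left_mono) auto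
  qed
  finally show ?thesis .
qed

text \<open>The summation index is reversed, because shifting \<open>\<F>\<^sub>n\<close> moves back in time.\<close>
lemma Tvec_inner:
  assumes gam: "\<And>l i. i \<in> {1..n} \<Longrightarrow> 0 < gam l n i" and \<omega>: "\<omega> \<in> space M"
  shows "u \<bullet> Tvec x alpha gam G eps n \<omega> = (\<Sum>l\<in>UNIV. \<Sum>i<n.
     ((1 / sqrt (real n)) * (alpha l n * (1 - alpha l n)) powr (-1/2) * ((\<chi> j. u $ (l, j)) \<bullet> zvec x n (n - i)))
      * (indicator {s\<in>space seq.S. 0 < G l n s} (seq_shift i (Fi eps (int n) \<omega>)) - alpha l n))"
proof -
  let ?k = "\<lambda>l. (1 / sqrt (real n)) * (alpha l n * (1 - alpha l n)) powr (-1/2)"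
  let ?g = "\<lambda>l i. psi (1 - alpha l n) (gam l n i * G l n (Fi eps (int i) \<omega>))"
  have "u \<bullet> Tvec x alpha gam G eps n \<omega> = (\<Sum>l\<in>UNIV. \<Sum>j\<in>UNIV. u $ (l, j) * ((1 / sqrt (real n)) *
     (\<Sum>i\<in>{1..n}. (alpha l n * (1 - alpha l n)) powr (-1/2) * ?g l i * zvec x n i $ j)))"
    unfolding inner_vec_def Tvec_def Let_def
    by (simp add: sum.cartesian_product UNIV_Times_UNIV split_beta')
  also have "\<dots> = (\<Sum>l\<in>UNIV. \<Sum>i\<in>{1..n}. (?k l * ((\<chi> j. u $ (l, j)) \<bullet> zvec x n i)) * ?g l i)"
  proof (rule sum.cong[OF refl])
    fix l :: 2
    have "(\<Sum>j\<in>UNIV. u $ (l, j) * ((1 / sqrt (real n)) * (\<Sum>i\<in>{1..n}. (alpha l n * (1 - alpha l n)) powr (-1/2) * ?g l i * zvec x n i $ j)))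
      = (\<Sum>j\<in>UNIV. \<Sum>i\<in>{1..n}. ?k l * (u $ (l, j) * zvec x n i $ j) * ?g l i)"
      unfolding sum_distrib_left by (intro sum.cong refl) (simp only: mult_ac)
    also have "\<dots> = (\<Sum>i\<in>{1..n}. \<Sum>j\<in>UNIV. ?k l * (u $ (l, j) * zvec x n i $ j) * ?g l i)"
      by (rule sum.swap)
    also have "\<dots> = (\<Sum>i\<in>{1..n}. (?k l * ((\<chi> j. u $ (l, j)) \<bullet> zvec x n i)) * ?g l i)"
      by (intro sum.cong refl) (simp only: inner_vec_def vec_lambda_beta inner_real_def sum_distrib_left sum_distrib_right)
    finally show "(\<Sum>j\<in>UNIV. u $ (l, j) * ((1 / sqrt (real n)) * (\<Sum>i\<in>{1..n}. (alpha l n * (1 - alpha l n)) powr (-1/2) * ?g l i * zvec x n i $ j)))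
      = \<dots>" .
  qed
  also have "\<dots> = (\<Sum>l\<in>UNIV. \<Sum>i<n. (?k l * ((\<chi> j. u $ (l, j)) \<bullet> zvec x n (n - i))) * ?g l (n - i))"
  proof (rule sum.cong[OF refl])
    fix l :: 2
    show "(\<Sum>i\<in>{1..n}. (?k l * ((\<chi> j. u $ (l, j)) \<bullet> zvec x n i)) * ?g l i)
      = (\<Sum>i<n. (?k l * ((\<chi> j. u $ (l, j)) \<bullet> zvec x n (n - i))) * ?g l (n - i))"
      by (rule sum.reindex_bij_witness[of _ "\<lambda>i. n - i" "\<lambda>i. n - i"]) auto
  qed
  also have "\<dots> = (\<Sum>l\<in>UNIV. \<Sum>i<n. (?k l * ((\<chi> j. u $ (l, j)) \<bullet> zvec x n (n - i)))
      * (indicator {s\<in>space seq.S. 0 < G l n s} (seq_shift i (Fi eps (int n) \<omega>)) - alpha l n))"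
  proof (intro sum.cong refl arg_cong2[of _ _ _ _ "(*)"])
    fix l i assume "i \<in> {..<n}"
    then have i: "int n - int i = int (n - i)" "0 < gam l n (n - i)" by (auto intro: gam)
    have "Fi eps (int (n - i)) \<omega> \<in> space seq.S" using measurable_space[OF measurable_Fi \<omega>] .
    \<comment> \<open>A positive \<open>gam\<close> does not change the sign of the error, so the
      score is the centred exceedance indicator.\<close>
    then show "?g l (n - i) = indicator {s\<in>space seq.S. 0 < G l n s} (seq_shift i (Fi eps (int n) \<omega>)) - alpha l n"
      unfolding seq_shift_Fi i(1) psi_def using i(2) by (auto simp: indicator_def zero_less_mult_iff mult_le_0_iff)
  qed
  finally show ?thesis .
qed

end

section \<open>The covariance matrix and the proof of the theorem\<close>

lemma Gamma_n_quad:
  fixes T :: "'w \<Rightarrow> real^'m"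
  assumes i: "\<And>a b. integrable M (\<lambda>\<omega>. T \<omega> $ a * T \<omega> $ b)"
  shows "u \<bullet> (Gamma_n M T *v u) = (\<integral>\<omega>. (u \<bullet> T \<omega>)\<^sup>2 \<partial>M)"
proof -
  have "(\<integral>\<omega>. (u \<bullet> T \<omega>)\<^sup>2 \<partial>M) = (\<integral>\<omega>. (\<Sum>a\<in>UNIV. \<Sum>b\<in>UNIV. (u $ a * u $ b) * (T \<omega> $ a * T \<omega> $ b)) \<partial>M)"
    unfolding inner_vec_def power2_eq_square sum_product
    by (intro Bochner_Integration.integral_cong refl sum.cong) (simp add: mult_ac)
  also have "\<dots> = (\<Sum>a\<in>UNIV. \<Sum>b\<in>UNIV. (u $ a * u $ b) * (\<integral>\<omega>. T \<omega> $ a * T \<omega> $ b \<partial>M))"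
    using i by simp
  also have "\<dots> = u \<bullet> (Gamma_n M T *v u)"
    unfolding inner_vec_def matrix_vector_mult_def Gamma_n_def
    by (simp add: sum_distrib_left mult_ac)
  finally show ?thesis ..
qed

lemma transpose_Gamma_n: "transpose (Gamma_n M T) = Gamma_n M T"
  unfolding Gamma_n_def by (simp add: vec_eq_iff transpose_def mult.commute)

theorem theorem2:
  fixes M :: "'w measure" and E :: "'e measure"
    and eps :: "int \<Rightarrow> 'w \<Rightarrow> 'e" and eps0s :: "'w \<Rightarrow> 'e"
    and x :: "nat \<Rightarrow> nat \<Rightarrow> real^'p"
    and y :: "nat \<Rightarrow> nat \<Rightarrow> 'w \<Rightarrow> real"
    and beta :: "2 \<Rightarrow> nat \<Rightarrow> real^'p"
    and alpha :: "2 \<Rightarrow> nat \<Rightarrow> real"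
    and gam :: "2 \<Rightarrow> nat \<Rightarrow> nat \<Rightarrow> real"
    and G :: "2 \<Rightarrow> nat \<Rightarrow> (nat \<Rightarrow> 'e) \<Rightarrow> real"
    and f :: "2 \<Rightarrow> nat \<Rightarrow> real \<Rightarrow> real"
  assumes M: "prob_space M"
    and eps_meas: "\<And>i. eps i \<in> measurable M E"
    and eps0s_meas: "eps0s \<in> measurable M E"
    and indep: "prob_space.indep_vars M (\<lambda>_. E)
                  (\<lambda>j. case j of None \<Rightarrow> eps0s | Some i \<Rightarrow> eps i) UNIV"
    and ident: "\<And>i. distr M E (eps i) = distr M E (eps 0)"
    and ident0s: "distr M E eps0s = distr M E (eps 0)"
    and G_meas: "\<And>l n. G l n \<in> borel_measurable (PiM UNIV (\<lambda>_. E))"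
    and model: "\<And>l n i \<omega>. i \<in> {1..n} \<Longrightarrow> \<omega> \<in> space M \<Longrightarrow>
                  y n i \<omega> = x n i \<bullet> beta l n + gam l n i * G l n (Fi eps (int i) \<omega>)"
    and gam_pos: "\<And>l n i. i \<in> {1..n} \<Longrightarrow> 0 < gam l n i"
    and gam_norm: "\<And>l n. n \<ge> 1 \<Longrightarrow> (1 / real n) * (\<Sum>i\<in>{1..n}. gam l n i) = 1"
    and alpha_range: "\<And>l n. 0 < alpha l n \<and> alpha l n < 1"
    and quant: "\<And>l n i. i \<in> {1..n} \<Longrightarrow>
                  measure M {\<omega>\<in>space M. G l n (Fi eps (int i) \<omega>) \<le> 0} = 1 - alpha l n"
    and density: "\<And>l n. distributed M lborel (\<lambda>\<omega>. G l n (Fi eps 0 \<omega>)) (\<lambda>u. ennreal (f l n u))"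
    and f_nonneg: "\<And>l n u. 0 \<le> f l n u"
    and Sigma_nonsing: "eventually (\<lambda>n. invertible (Sigma_n x n)) sequentially"
    and A1: "\<And>l. \<exists>q\<ge>2. TAS M eps eps0s (G l) q"
    and A2: "\<And>l. \<exists>a. 0 < a \<and> a < 1 \<and> (\<exists>C.
               (\<forall>n. \<exists>D. continuous_on
                   {u. qinv (cdfF M eps (G l n)) (1 - a) < ereal u \<and> ereal u < qinv (cdfF M eps (G l n)) 1} D
                 \<and> (\<forall>u. qinv (cdfF M eps (G l n)) (1 - a) < ereal u \<and> ereal u < qinv (cdfF M eps (G l n)) 1
                     \<longrightarrow> (cdfF M eps (G l n) has_real_derivative D u) (at u) \<and> 0 < D u \<and> D u \<le> C))
             \<and> liminf (\<lambda>n. \<bar>qinv (cdfF M eps (G l n)) 1 - qinv (cdfF M eps (G l n)) (1 - a)\<bar>) > 0)"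
    and A3: "\<And>l. (\<lambda>n. Max ((\<lambda>i. norm (zvec x n i)) ` {1..n}))
                   \<in> o(\<lambda>n. sqrt (real n * alpha l n))"
    and A4: "\<And>l. \<exists>c1 c2. 0 < c1 \<and> c1 \<le> c2 \<and>
                   (\<forall>n i. i \<in> {1..n} \<longrightarrow> c1 \<le> gam l n i \<and> gam l n i \<le> c2)"
    and alpha_lim: "\<And>l. alpha l \<longlonglongrightarrow> 0"
    and nalpha_lim: "\<And>l. filterlim (\<lambda>n. real n * alpha l n) at_top sequentially"
    and tau_lim: "\<And>l. filterlim (\<lambda>n. sqrt (real n * alpha l n) * f l n 0
                           / (1 - cdfF M eps (G l n) 0)) at_top sequentially"
    and z_tau: "\<And>l. (\<lambda>n. Max ((\<lambda>i. norm (zvec x n i)) ` {1..n}))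
                   \<in> o(\<lambda>n. sqrt (real n * alpha l n) * f l n 0 / (1 - cdfF M eps (G l n) 0))"
    and f_local: "\<And>l c e. e > 0 \<Longrightarrow> eventually (\<lambda>n. \<forall>i\<in>{1..n}. \<forall>\<phi>::real^'p. norm \<phi> \<le> c \<longrightarrow>
                   \<bar>f l n ((1 / gam l n i) * (1 / (sqrt (real n * alpha l n) * f l n 0
                                / (1 - cdfF M eps (G l n) 0))) * (zvec x n i \<bullet> \<phi>)) - f l n 0\<bar>
                   / f l n 0 \<le> e) sequentially"
    and tSigma_eig: "\<And>l. \<exists>c>0. eventually (\<lambda>n. \<forall>ev\<in>eigvals (tSigma_n (gam l) x n). c \<le> ev) sequentially"
  shows "(\<exists>C. eventually (\<lambda>n. psd_mat (Gamma_n M (Tvec x alpha gam G eps n))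
              \<and> (\<forall>ev\<in>eigvals (Gamma_n M (Tvec x alpha gam G eps n)). \<bar>ev\<bar> \<le> C)) sequentially)
       \<and> ((\<exists>c>0. eventually (\<lambda>n. \<forall>ev\<in>eigvals (Gamma_n M (Tvec x alpha gam G eps n)). c \<le> ev) sequentially)
          \<longrightarrow> conv_distr M (\<lambda>n \<omega>. psd_sqrt (matrix_inv (Gamma_n M (Tvec x alpha gam G eps n)))
                                    *v Tvec x alpha gam G eps n \<omega>) std_normal_vec)"
proof -
  interpret innovations M E eps eps0s
    by (intro innovations.intro innovations_axioms.intro M eps_meas eps0s_meas indep ident ident0s)
  define A where "A l n = {s\<in>space seq.S. 0 < G l n s}" for l n
  define g where "g n l = (\<lambda>s. indicator (A l n) s - alpha l n :: real)" for n l
  define a where "a u n l i = (1 / sqrt (real n)) * (alpha l n * (1 - alpha l n)) powr (-1/2)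
    * ((\<chi> j. u $ (l, j)) \<bullet> zvec x n (n - i))" for u :: "real^(2 \<times> 'p)" and n l i
  define U where "U u n = (\<lambda>s. \<Sum>l\<in>UNIV. \<Sum>i<n. a u n l i * g n l (seq_shift i s))" for u n
  define T where "T n = Tvec x alpha gam G eps n" for n
  define v where "v n l = sqrt (alpha l n)" for n l
  define R where "R n = psd_sqrt (matrix_inv (Gamma_n M (T n)))" for n

  have al: "0 < alpha l n" "alpha l n < 1" for l n using alpha_range by auto
  have v0: "0 \<le> v n l" for n l using al[of l n] by (simp add: v_def)
  have sA: "A l n \<in> sets seq.S" for l n
  proof -
    have [measurable]: "G l n \<in> borel_measurable seq.S" using G_meas by (rule measurable_S)
    show ?thesis unfolding A_def by measurable
  qed
  have g: "bmf seq.S (g n l)" for n l unfolding g_def by (intro bmf_diff bmf_indicator sA bmf_const)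
  have gb: "\<bar>g n l s\<bar> \<le> 1" for n l s using al[of l n] by (auto simp: g_def indicator_def)
  have g_lim: "(\<lambda>K. l2 seq.S (\<lambda>s. g n l s - seq.proj K (g n l) s)) \<longlonglongrightarrow> 0" for n l
    unfolding g_def by (rule seq.l2_proj_tendsto[OF sA])
  \<comment> \<open>The level is prescribed only at times in \<open>{1..n}\<close>, which is empty
    for \<open>n = 0\<close>; time \<open>1\<close> represents all of them.\<close>
  have mA: "measure seq.S (A l n) = alpha l n" if "1 \<le> n" for l n
  proof -
    have [measurable]: "G l n \<in> borel_measurable seq.S" using G_meas by (rule measurable_S)
    let ?B = "{s\<in>space seq.S. G l n s \<le> 0}"
    have "{\<omega>\<in>space M. Fi eps (int 1) \<omega> \<in> ?B} = {\<omega>\<in>space M. G l n (Fi eps (int 1) \<omega>) \<le> 0}"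
      using measurable_space[OF measurable_Fi] by auto
    then have "measure seq.S ?B = 1 - alpha l n"
      using measure_Fi[of ?B "int 1"] quant[of 1 n l] that by simp
    moreover have "A l n = space seq.S - ?B" unfolding A_def by auto
    ultimately show ?thesis by (simp add: seq.P.prob_compl)
  qed
  have g_mean: "(\<integral>s. g n l s \<partial>seq.S) = 0" if "1 \<le> n" for n l
  proof -
    have "integrable seq.S (indicator (A l n) :: _ \<Rightarrow> real)"
      by (rule seq.P.integrable_bmf[OF bmf_indicator[OF sA]])
    then show ?thesis
      unfolding g_def using mA[OF that] sets.sets_into_space[OF sA[of l n]]
      by (simp add: seq.P.prob_space Int_absorb2)
  qed

  have TU: "u \<bullet> T n \<omega> = U u n (Fi eps (int n) \<omega>)" if "\<omega> \<in> space M" for u n \<omega>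
    unfolding T_def U_def a_def g_def A_def by (rule Tvec_inner[OF gam_pos that])
  have bU: "bmf seq.S (U u n)" for u n
    unfolding U_def by (intro bmf_sum bmf_mult bmf_const bmf_comp[OF g seq.measurable_seq_shift])
  have T_meas: "T n \<in> borel_measurable M" for n
  proof (rule borel_measurable_euclidean_space[THEN iffD2], intro ballI)
    fix b :: "real^(2 \<times> 'p)"
    have "(\<lambda>\<omega>. U b n (Fi eps (int n) \<omega>)) \<in> borel_measurable M"
      by (rule bmf_measurable[OF bmf_comp[OF bU measurable_Fi]])
    then show "(\<lambda>\<omega>. T n \<omega> \<bullet> b) \<in> borel_measurable M"
      by (rule measurable_cong[THEN iffD1, rotated]) (simp add: TU[symmetric] inner_commute)
  qed
  have T_int: "integrable M (\<lambda>\<omega>. T n \<omega> $ p * T n \<omega> $ q)" for n p q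
  proof -
    have b: "bmf M (\<lambda>\<omega>. U (axis p 1) n (Fi eps (int n) \<omega>) * U (axis q 1) n (Fi eps (int n) \<omega>))"
      by (intro bmf_mult bmf_comp[OF bU measurable_Fi])
    have "integrable M (\<lambda>\<omega>. U (axis p 1) n (Fi eps (int n) \<omega>) * U (axis q 1) n (Fi eps (int n) \<omega>))"
      by (rule integrable_bmf[OF b])
    then show ?thesis
      by (rule Bochner_Integration.integrable_cong[THEN iffD1, OF refl, rotated])
        (simp add: TU[symmetric] inner_axis')
  qed
  \<comment> \<open>The bridge between the matrix and the sequence space: bounds on
    \<open>Gamma_n\<close> become norm bounds on the weighted sums \<open>U u n\<close>.\<close>
  have quad: "u \<bullet> (Gamma_n M (T n) *v u) = (l2 seq.S (U u n))\<^sup>2" for u n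
  proof -
    have "u \<bullet> (Gamma_n M (T n) *v u) = (\<integral>\<omega>. (U u n (Fi eps (int n) \<omega>))\<^sup>2 \<partial>M)"
      unfolding Gamma_n_quad[OF T_int] by (intro Bochner_Integration.integral_cong refl) (simp add: TU)
    then show ?thesis
      unfolding l2_sq using integral_Fi[OF bmf_measurable[OF bmf_power[OF bU[of u n], of 2]], of "int n"] by simp
  qed
  have psd: "psd_mat (Gamma_n M (T n))" for n
    unfolding psd_mat_def by (simp add: transpose_Gamma_n quad)

  have "\<exists>q a0 n0. 2 \<le> q \<and> 0 < a0 \<and> summable (\<lambda>k. theta M eps eps0s (G l) n0 a0 k powr (1 / q))" for l
    using A1[of l] TAS_summable by blast
  then obtain q a0 n0 where q: "\<And>l. 2 \<le> q l" and a0: "\<And>l. 0 < a0 l"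
    and sm: "\<And>l. summable (\<lambda>k. theta M eps eps0s (G l) (n0 l) (a0 l) k powr (1 / q l))" by metis
  let ?\<theta> = "\<lambda>k l. sqrt 2 * theta M eps eps0s (G l) (n0 l) (a0 l) k powr (1 / q l)"
  \<comment> \<open>Each level has its own exponent and thresholds; the sum over both gives one
    summable sequence dominating either.\<close>
  define \<rho> where "\<rho> k = (\<Sum>l\<in>UNIV. ?\<theta> k l)" for k
  have \<rho>: "summable \<rho>" "0 \<le> \<rho> k" for k
    unfolding \<rho>_def by (auto intro!: summable_sum summable_mult sm sum_nonneg)
  have rho: "\<forall>\<^sub>F n in sequentially. \<forall>l k. l2 seq.S (seq.incr k (g n l)) \<le> v n l * \<rho> k"
  proof -
    \<comment> \<open>Once \<open>alpha l n\<close> is below \<open>a0 l\<close> and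
      \<open>n\<close> beyond \<open>n0 l\<close>, the pair is among those over which
      \<open>theta\<close> takes its supremum.\<close>
    have "\<forall>\<^sub>F n in sequentially. alpha l n < a0 l" for l
      using order_tendstoD(2)[OF alpha_lim a0] .
    then have "\<forall>\<^sub>F n in sequentially. \<forall>l. alpha l n < a0 l" by (simp add: eventually_all_finite)
    moreover have "\<forall>\<^sub>F n in sequentially. \<forall>l. n0 l \<le> n" by (simp add: eventually_all_finite eventually_ge_at_top)
    ultimately show ?thesis using eventually_ge_at_top[of "1::nat"]
    proof eventually_elim
      case (elim n)
      show ?case
      proof (intro allI)
        fix l k
        have "l2 seq.S (seq.incr k (g n l)) \<le> sqrt (alpha l n) * (?\<theta> k l)"
          unfolding g_def A_def
          by (rule l2_incr_theta[where i = "int 1"])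
            (use G_meas quant[of 1 n l] elim al q in \<open>auto intro: less_imp_le\<close>)
        also have "\<dots> \<le> sqrt (alpha l n) * \<rho> k"
          unfolding \<rho>_def using al[of l n]
          by (intro mult_left_mono member_le_sum[of l UNIV "?\<theta> k"]) auto
        finally show "l2 seq.S (seq.incr k (g n l)) \<le> v n l * \<rho> k" by (simp add: v_def)
      qed
    qed
  qed

  have half: "\<forall>\<^sub>F n in sequentially. \<forall>l. alpha l n \<le> 1 / 2"
  proof -
    have "\<forall>\<^sub>F n in sequentially. alpha l n < 1 / 2" for l using order_tendstoD(2)[OF alpha_lim, of "1 / 2"] by simp
    then have "\<forall>\<^sub>F n in sequentially. \<forall>l. alpha l n < 1 / 2" by (simp add: eventually_all_finite)
    then show ?thesis by eventually_elim (auto intro: less_imp_le)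
  qed
  have scale: "(alpha l n * (1 - alpha l n)) powr (-1/2) = 1 / (sqrt (alpha l n) * sqrt (1 - alpha l n))" for l n
    using al[of l n] by (simp add: powr_minus powr_half_sqrt inverse_eq_divide real_sqrt_mult)
  have part_norm: "(norm (\<chi> j. u $ (l, j)))\<^sup>2 \<le> (norm u)\<^sup>2" for u :: "real^(2 \<times> 'p)" and l
  proof -
    have "(norm (\<chi> j. u $ (l, j)))\<^sup>2 = (\<Sum>j\<in>UNIV. (u $ (l, j))\<^sup>2)"
      unfolding power2_norm_eq_inner inner_vec_def by (simp add: power2_eq_square)
    also have "\<dots> \<le> (\<Sum>l\<in>UNIV. \<Sum>j\<in>UNIV. (u $ (l, j))\<^sup>2)"
      by (rule member_le_sum[of l UNIV "\<lambda>l. \<Sum>j\<in>UNIV. (u $ (l, j))\<^sup>2"]) (auto intro: sum_nonneg)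
    also have "\<dots> = (norm u)\<^sup>2"
      unfolding power2_norm_eq_inner inner_vec_def
      by (simp add: power2_eq_square sum.cartesian_product UNIV_Times_UNIV split_beta')
    finally show ?thesis .
  qed
  \<comment> \<open>The square of \<open>v n l\<close> cancels the \<open>alpha l n\<close> in the
    normalisation and leaves only \<open>1 / (1 - alpha l n)\<close>, at most \<open>2\<close> by
    \<open>half\<close>.\<close>
  have weights: "\<forall>\<^sub>F n in sequentially. \<forall>u l. (v n l)\<^sup>2 * (\<Sum>i<n. (a u n l i)\<^sup>2) \<le> 2 * (norm u)\<^sup>2"
    using half Sigma_nonsing eventually_ge_at_top[of "1::nat"]
  proof eventually_elim
    case (elim n)
    show ?case
    proof (intro allI)
      fix u :: "real^(2 \<times> 'p)" and l :: 2
      let ?w = "\<chi> j. u $ (l, j)"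
      let ?c = "alpha l n * (1 - alpha l n)"
      have c: "0 < ?c" using al[of l n] by simp
      have "(\<Sum>i<n. (a u n l i)\<^sup>2) = (\<Sum>i\<in>{1..n}. ((1 / sqrt (real n)) * ?c powr (-1/2) * (?w \<bullet> zvec x n i))\<^sup>2)"
        unfolding a_def by (rule sum.reindex_bij_witness[of _ "\<lambda>i. n - i" "\<lambda>i. n - i"]) auto
      also have "\<dots> = (?c powr (-1/2))\<^sup>2 * ((1 / real n) * (\<Sum>i\<in>{1..n}. (?w \<bullet> zvec x n i)\<^sup>2))"
        unfolding sum_distrib_left by (intro sum.cong refl) (simp add: power_mult_distrib power_divide)
      also have "(1 / real n) * (\<Sum>i\<in>{1..n}. (?w \<bullet> zvec x n i)\<^sup>2) = ?w \<bullet> ?w"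
        using elim by (intro zvec_normalized) auto
      also have "(?c powr (-1/2))\<^sup>2 = 1 / ?c"
        unfolding scale using al[of l n] by (simp add: power_mult_distrib power_divide)
      finally have "(v n l)\<^sup>2 * (\<Sum>i<n. (a u n l i)\<^sup>2) = (norm ?w)\<^sup>2 / (1 - alpha l n)"
        using al[of l n] by (simp add: v_def power2_norm_eq_inner)
      also have "\<dots> \<le> (norm ?w)\<^sup>2 / (1 / 2)"
        using elim(1)[rule_format, of l] by (intro divide_left_mono) auto
      also have "\<dots> \<le> 2 * (norm u)\<^sup>2" using part_norm[of u l] by simp
      finally show "(v n l)\<^sup>2 * (\<Sum>i<n. (a u n l i)\<^sup>2) \<le> 2 * (norm u)\<^sup>2" .
    qed
  qed
  have small: "\<forall>\<^sub>F n in sequentially. \<forall>u l. \<forall>i<n. \<bar>a u n l i\<bar> \<le> \<eta> * norm u" if \<eta>: "0 < \<eta>" for \<eta>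
  proof -
    let ?m = "\<lambda>n. Max ((\<lambda>i. norm (zvec x n i)) ` {1..n})"
    \<comment> \<open>Half of \<open>\<eta>\<close> is used here because the remaining factor
      \<open>1 / sqrt (1 - alpha l n)\<close> is bounded by \<open>2\<close>.\<close>
    have "\<forall>\<^sub>F n in sequentially. norm (?m n) \<le> (\<eta> / 2) * norm (sqrt (real n * alpha l n))" for l
      by (rule landau_o.smallD[OF A3]) (use \<eta> in simp)
    then have "\<forall>\<^sub>F n in sequentially. \<forall>l. norm (?m n) \<le> (\<eta> / 2) * norm (sqrt (real n * alpha l n))"
      by (simp add: eventually_all_finite)
    then show ?thesis using half
    proof eventually_elim
      case (elim n)
      show ?case
      proof (intro allI impI)
        fix u :: "real^(2 \<times> 'p)" and l :: 2 and i assume i: "i < n"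
        let ?w = "\<chi> j. u $ (l, j)"
        have w: "norm ?w \<le> norm u" using part_norm[of u l] by (rule power2_le_imp_le) simp
        have "norm (zvec x n (n - i)) \<le> ?m n" using i by (intro Max_ge) auto
        also have "\<dots> \<le> (\<eta> / 2) * (sqrt (real n) * sqrt (alpha l n))"
          using elim(1)[rule_format, of l] al[of l n] by (simp add: real_sqrt_mult)
        finally have z: "norm (zvec x n (n - i)) \<le> (\<eta> / 2) * (sqrt (real n) * sqrt (alpha l n))" .
        have "\<bar>?w \<bullet> zvec x n (n - i)\<bar> \<le> norm ?w * norm (zvec x n (n - i))" by (rule Cauchy_Schwarz_ineq2)
        also have "\<dots> \<le> norm u * ((\<eta> / 2) * (sqrt (real n) * sqrt (alpha l n)))"
          by (intro mult_mono w z) auto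
        finally have 1: "\<bar>?w \<bullet> zvec x n (n - i)\<bar> \<le> norm u * ((\<eta> / 2) * (sqrt (real n) * sqrt (alpha l n)))" .
        have s: "1 / 2 \<le> sqrt (1 - alpha l n)"
          using elim(2)[rule_format, of l] by (intro real_le_rsqrt) (simp add: power2_eq_square)
        have "\<bar>a u n l i\<bar> = (1 / (sqrt (real n) * (sqrt (alpha l n) * sqrt (1 - alpha l n)))) * \<bar>?w \<bullet> zvec x n (n - i)\<bar>"
          unfolding a_def scale using al[of l n] by (simp add: abs_mult)
        also have "\<dots> \<le> (1 / (sqrt (real n) * (sqrt (alpha l n) * sqrt (1 - alpha l n)))) * (norm u * ((\<eta> / 2) * (sqrt (real n) * sqrt (alpha l n))))"
          using al[of l n] by (intro mult_left_mono 1) auto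
        also have "\<dots> = (norm u * \<eta>) * ((1 / 2) / sqrt (1 - alpha l n))"
          using al[of l n] i by (simp add: field_simps)
        also have "\<dots> \<le> (norm u * \<eta>) * 1"
          using s \<eta> al[of l n] by (intro mult_left_mono) (auto simp: divide_le_eq)
        finally show "\<bar>a u n l i\<bar> \<le> \<eta> * norm u" by (simp add: mult.commute)
      qed
    qed
  qed

  \<comment> \<open>The first \<open>2\<close> counts the levels; \<open>sqrt 2\<close> comes from
    the bound in \<open>weights\<close>.\<close>
  define C0 where "C0 = 2 * (sqrt 2 * (\<Sum>k. \<rho> k))"
  have l2U: "\<forall>\<^sub>F n in sequentially. \<forall>u. l2 seq.S (U u n) \<le> C0 * norm u"
    using rho weights eventually_ge_at_top[of "1::nat"]
  proof eventually_elim
    case (elim n)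
    show ?case
    proof
      fix u :: "real^(2 \<times> 'p)"
      have "l2 seq.S (U u n) \<le> real CARD(2) * (sqrt (2 * (norm u)\<^sup>2) * (\<Sum>k. \<rho> k))"
        unfolding U_def
      proof (rule seq.clt_bound(1)[where v = "v n" and \<rho> = \<rho>])
        show "(\<integral>s. g n l s \<partial>seq.S) = 0" for l by (rule g_mean[OF elim(3)])
        show "l2 seq.S (seq.incr k (g n l)) \<le> v n l * \<rho> k" for l k using elim(1) by blast
        show "(v n l)\<^sup>2 * (\<Sum>i<n. (a u n l i)\<^sup>2) \<le> 2 * (norm u)\<^sup>2" for l using elim(2) by blast
      qed (rule g gb g_lim \<rho> v0)+
      then show "l2 seq.S (U u n) \<le> C0 * norm u"
        by (simp add: C0_def real_sqrt_mult mult_ac)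
    qed
  qed
  have part1: "\<forall>\<^sub>F n in sequentially. psd_mat (Gamma_n M (T n)) \<and> (\<forall>ev\<in>eigvals (Gamma_n M (T n)). \<bar>ev\<bar> \<le> C0\<^sup>2)"
    using l2U
  proof eventually_elim
    case (elim n)
    have "\<bar>ev\<bar> \<le> C0\<^sup>2" if "ev \<in> eigvals (Gamma_n M (T n))" for ev
    proof -
      have "\<exists>w. w \<noteq> 0 \<and> Gamma_n M (T n) *v w = ev *\<^sub>R w" using that by (simp add: eigvals_def)
      then obtain w where w: "w \<noteq> 0" "Gamma_n M (T n) *v w = ev *\<^sub>R w" by auto
      then have "ev * (norm w)\<^sup>2 = (l2 seq.S (U w n))\<^sup>2"
        using quad[of w n] by (simp add: power2_norm_eq_inner)
      then have "\<bar>ev * (norm w)\<^sup>2\<bar> = \<bar>(l2 seq.S (U w n))\<^sup>2\<bar>" by (rule arg_cong)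
      then have "\<bar>ev\<bar> * (norm w)\<^sup>2 = (l2 seq.S (U w n))\<^sup>2" by (simp add: abs_mult)
      also have "\<dots> \<le> (C0 * norm w)\<^sup>2" using elim by (intro power_mono) auto
      also have "\<dots> = C0\<^sup>2 * (norm w)\<^sup>2" by (simp add: power_mult_distrib)
      finally show ?thesis using w(1) by simp
    qed
    with psd show ?case by blast
  qed

  have part2: "conv_distr M (\<lambda>n \<omega>. R n *v T n \<omega>) std_normal_vec"
    if "0 < c" and ev: "\<forall>\<^sub>F n in sequentially. \<forall>ev\<in>eigvals (Gamma_n M (T n)). c \<le> ev" for c
  proof -
    have pos: "\<forall>\<^sub>F n in sequentially. \<forall>w. c * (w \<bullet> w) \<le> w \<bullet> (Gamma_n M (T n) *v w)"
      using ev by eventually_elim (auto intro: eigvals_lower_bound transpose_Gamma_n)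
    \<comment> \<open>Standardising makes the second moment exactly the squared norm of
      \<open>w\<close>. The same identity, with the lower eigenvalue bound tested on
      \<open>R n *v w\<close>, keeps these directions bounded in \<open>n\<close>.\<close>
    have unit: "\<forall>\<^sub>F n in sequentially. \<forall>w. transpose (R n) = R n \<and> (l2 seq.S (U (R n *v w) n))\<^sup>2 = (norm w)\<^sup>2
        \<and> c * (norm (R n *v w))\<^sup>2 \<le> (norm w)\<^sup>2"
      using pos
    proof eventually_elim
      case (elim n)
      have "invertible (Gamma_n M (T n))" using invertible_if_pos[OF \<open>0 < c\<close>] elim by blast
      note S = inv_sqrt_sandwich[OF psd this, folded R_def]
      show ?case
      proof (intro allI conjI)
        fix w
        show "transpose (R n) = R n" by (rule psd_matD(1)[OF S(1)])
        have "(l2 seq.S (U (R n *v w) n))\<^sup>2 = (R n *v w) \<bullet> (Gamma_n M (T n) *v (R n *v w))" by (rule quad[symmetric])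
        also have "\<dots> = w \<bullet> ((R n ** Gamma_n M (T n) ** R n) *v w)"
          unfolding psd_matD(3)[OF S(1)] by (simp add: matrix_vector_mul_assoc matrix_mul_assoc)
        finally show "(l2 seq.S (U (R n *v w) n))\<^sup>2 = (norm w)\<^sup>2"
          unfolding S(2) by (simp add: power2_norm_eq_inner)
        then show "c * (norm (R n *v w))\<^sup>2 \<le> (norm w)\<^sup>2"
          using elim[rule_format, of "R n *v w"] by (simp add: quad power2_norm_eq_inner)
      qed
    qed
    define X where "X n \<omega> = R n *v T n \<omega>" for n \<omega>
    have X_meas: "X n \<in> borel_measurable M" for n
    proof -
      have "(\<lambda>t. R n *v t) \<in> borel_measurable borel"
        by (intro borel_measurable_continuous_onI matrix_vector_mult_linear_continuous_on)
      from measurable_compose[OF T_meas this] show ?thesis unfolding X_def .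
    qed
    have char: "(\<lambda>n. \<integral>\<omega>. iexp (w \<bullet> X n \<omega>) \<partial>M) \<longlonglongrightarrow> exp (- (norm w)\<^sup>2 / 2)" for w
    proof -
      \<comment> \<open>The summand \<open>1\<close> keeps \<open>K\<close> positive for
        \<open>w = 0\<close>, since \<open>\<eta> / K\<close> is used below.\<close>
      define K where "K = norm w / sqrt c + 1"
      have K: "0 < K" unfolding K_def using \<open>0 < c\<close> by (intro add_nonneg_pos) auto
      have Rw: "\<forall>\<^sub>F n in sequentially. norm (R n *v w) \<le> K" using unit
      proof eventually_elim
        case (elim n)
        then have "(norm (R n *v w))\<^sup>2 \<le> (norm w / sqrt c)\<^sup>2"
          using \<open>0 < c\<close> by (simp add: power_divide field_simps)
        then have "norm (R n *v w) \<le> norm w / sqrt c"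
          by (rule power2_le_imp_le) (use \<open>0 < c\<close> in simp)
        then show ?case by (simp add: K_def)
      qed
      \<comment> \<open>The direction varies with \<open>n\<close>. The bounds
        \<open>weights\<close> and \<open>small\<close> hold for all directions at once, so the
        bound \<open>K\<close> on their norms is enough.\<close>
      have "(\<lambda>n. gauss_gap seq.S (U (R n *v w) n)) \<longlonglongrightarrow> 0"
        unfolding U_def
      proof (rule seq.clt_array[where v = v and \<rho> = \<rho> and A = "2 * K\<^sup>2"])
        show "\<forall>\<^sub>F n in sequentially. \<forall>l. (\<integral>s. g n l s \<partial>seq.S) = 0"
          using eventually_ge_at_top[of "1::nat"] by eventually_elim (auto intro: g_mean)
        show "\<forall>\<^sub>F n in sequentially. \<forall>l. (v n l)\<^sup>2 * (\<Sum>i<n. (a (R n *v w) n l i)\<^sup>2) \<le> 2 * K\<^sup>2"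
          using weights Rw
        proof eventually_elim
          case (elim n)
          have "2 * (norm (R n *v w))\<^sup>2 \<le> 2 * K\<^sup>2" using elim(2) by (intro mult_left_mono power_mono) auto
          then show ?case using elim(1) order_trans by blast
        qed
        show "\<forall>\<^sub>F n in sequentially. \<forall>l. \<forall>i<n. \<bar>a (R n *v w) n l i\<bar> \<le> \<eta>" if "0 < \<eta>" for \<eta>
        proof -
          have "0 < \<eta> / K" using that K by simp
          from small[OF this] Rw show ?thesis
          proof eventually_elim
            case (elim n)
            have "\<eta> / K * norm (R n *v w) \<le> \<eta> / K * K" using elim(2) that K by (intro mult_left_mono) auto
            also have "\<dots> = \<eta>" using K by simp
            finally show ?case using elim(1) order_trans by blast
          qed
        qed
      qed (rule g gb g_lim rho \<rho> v0)+
      moreover have "\<forall>\<^sub>F n in sequentially.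
        gauss_gap seq.S (U (R n *v w) n)
        = (\<integral>\<omega>. iexp (w \<bullet> X n \<omega>) \<partial>M) - exp (- (norm w)\<^sup>2 / 2)"
        using unit
      proof eventually_elim
        case (elim n)
        have "bmf seq.S (\<lambda>s. iexp (U (R n *v w) n s))"
          using bmf_iexp[OF bU, of 1 "R n *v w" n] by simp
        then have "(\<integral>s. iexp (U (R n *v w) n s) \<partial>seq.S) = (\<integral>\<omega>. iexp (U (R n *v w) n (Fi eps (int n) \<omega>)) \<partial>M)"
          by (intro integral_Fi bmf_measurable)
        also have "\<dots> = (\<integral>\<omega>. iexp (w \<bullet> X n \<omega>) \<partial>M)"
          using symmetric_dot[of "R n" w] elim
          by (intro Bochner_Integration.integral_cong refl) (simp add: TU[symmetric] X_def)
        finally show ?case using elim by simp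
      qed
      ultimately have "(\<lambda>n. (\<integral>\<omega>. iexp (w \<bullet> X n \<omega>) \<partial>M) - exp (- (norm w)\<^sup>2 / 2)) \<longlonglongrightarrow> 0"
        by (rule Lim_transform_eventually)
      then show ?thesis by (simp add: LIM_zero_iff)
    qed
    interpret cc: char_convergence "\<lambda>n. distr M borel (X n)" "std_normal_vec :: (real^(2 \<times> 'p)) measure"
    proof (intro char_convergence.intro)
      show "prob_space (distr M borel (X n))" for n by (rule prob_space_distr[OF X_meas])
      show "prob_space (std_normal_vec :: (real^(2 \<times> 'p)) measure)" by (rule prob_space_std_normal_vec)
      show "(\<lambda>n. \<integral>y. iexp (w \<bullet> y) \<partial>distr M borel (X n)) \<longlonglongrightarrow> (\<integral>y. iexp (w \<bullet> y) \<partial>std_normal_vec)" for w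
        using char[of w] unfolding char_std_normal_vec by (subst integral_distr[OF X_meas]) auto
    qed auto
    show ?thesis unfolding conv_distr_def
    proof (intro allI impI)
      fix h :: "real^(2 \<times> 'p) \<Rightarrow> real"
      assume h: "continuous_on UNIV h \<and> bounded (range h)"
      then obtain B where "\<And>y. \<bar>h y\<bar> \<le> B" unfolding bounded_iff by auto
      with h have "(\<lambda>n. \<integral>y. h y \<partial>distr M borel (X n)) \<longlonglongrightarrow> (\<integral>y. h y \<partial>std_normal_vec)"
        by (intro cc.weak_convergence) auto
      moreover have "(\<integral>y. h y \<partial>distr M borel (X n)) = (\<integral>\<omega>. h (R n *v T n \<omega>) \<partial>M)" for n
        using h by (subst integral_distr[OF X_meas]) (auto simp: X_def intro: borel_measurable_continuous_onI)
      ultimately show "(\<lambda>n. \<integral>\<omega>. h (R n *v T n \<omega>) \<partial>M) \<longlonglongrightarrow> (\<integral>y. h y \<partial>std_normal_vec)"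
        by simp
    qed
  qed
  show ?thesis
    using part1 part2 unfolding T_def R_def by blast
qed

end
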